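(* Let $(\mu_n)_{n\in\mathbb N\cup\{\infty\}}\subset\mathscr K(X)$ be such that $\mu_n\to\mu_\infty$ vaguely and $G^{\mu_n}1\to G^{\mu_\infty}1$ uniformly on $X$. For $n\in\mathbb N\cup\{\infty\}$ let $(\check{\bf S}^n_t)_{t\ge0}$ be the integrated semigroup associated with $(\check R^n_\alpha)_{\alpha>0}$ on the space $C_0(X)$. Then for all $u\in C_0(X)$, $\lim_{n\to\infty}\|\check{\bf S}^n_tu-\check{\bf S}^\infty_tu\|_\infty=0$ locally uniformly in $t\in[0,\infty)$.
   Context: $X$ is a locally compact separable metric space, $m$ a positive Radon measure on the Borel sets of $X$ with full support, $X_\partial=X\cup\{\partial\}$ the one-point compactification; every function $u$ on $X$ is extended by $u(\partial)=0$. $\mathscr B_b(X)$ denotes the bounded Borel functions on $X$ with the sup norm $\|\cdot\|_\infty$, and $C_0(X)$ the continuous functions vanishing at infinity. $\mathbb X=(\Omega,\mathscr M,\mathscr M_t,(\mathbb P_x)_{x\in X_\partial},(\mathbb X_t)_{0\le t\le\infty},(\theta_t),\zeta)$ is a standard process in the sense of Blumenthal–Getoor (not necessarily symmetric) with state space $X$ and cemetery $\partial$ (with $\mathbb X_\infty=\partial$). It is transient and has a dual standard process $\hat{\mathbb X}$ (duality with respect to $m$) with the same properties. Its transition semigroup ${\bf P}_tu(x)=\mathbb E_x[u(\mathbb X_t)]$ has a jointly measurable density $p_t(x,y)$ with respect to $m$, with $p_t(x,y)>0$ for all $t>0$, $x,y\in X$. For $\alpha\ge0$, $G_\alpha(x,y)=\int_0^\infty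 e^{-\alpha t}p_t(x,y)\,dt$, $G:=G_0\not\equiv\infty$, and $G:X\times X\to(0,\infty]$ is lower semicontinuous. For a positive Radon measure $\mu$ on $X$, $G^\mu u(x)=\int_XG(x,y)u(y)\,d\mu(y)$; $\mu$ is $G$-Kato if $G^\mu1\in C_0(X)$, and $\mathscr K(X)$ is the set of $G$-Kato measures. Each $\mu\in\mathscr K(X)$ has a unique (up to equivalence) positive continuous additive functional (PCAF) ${\bf A}$ of $\mathbb X$ with Revuz measure $\mu$; it satisfies $\mathbb E_x[\int_0^\infty e^{-\alpha t}u(\mathbb X_t)\,d{\bf A}_t]=\int_XG_\alpha(x,y)u(y)\,d\mu(y)$ for $u\in\mathscr B_b(X)$, $\alpha\ge0$, $x\in X$. For $n\in\mathbb N\cup\{\infty\}$ let ${\bf A}^n$ be the PCAF of $\mu_n$, $\tau^n_t=\inf\{s\ge0:{\bf A}^n_s>t\}$, and $\check R^n_\alpha u(x)=\mathbb E_x[\int_0^\infty e^{-\alpha t}u(\mathbb X_{\tau^n_t})\,dt]$, which maps $C_0(X)$ into $C_0(X)$. The integrated semigroup $(\check{\bf S}^n_t)_{t\ge0}$ is the strongly continuous family of bounded linear operators on $C_0(X)$ determined by $\check R^n_\alpha=\alpha\int_0^\infty e^{-\alpha t}\check{\bf S}^n_t\,dt$ for all $\alpha>0$ (strong integral). Vague convergence $\mu_n\to\mu_\infty$ means $\int\varphi\,d\mu_n\to\int\varphi\,d\mu_\infty$ for all continuous $\varphi$ with compact support. *)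

theory Defs
  imports "HOL-Probability.Probability"
begin

section \<open>State space and function spaces\<close>

text \<open>The state space \<open>X\<close> is a type \<open>'a\<close>, and \<open>'a option\<close> is its one-point compactification
  with \<open>None\<close> in the role of the cemetery. If \<open>X\<close> is compact, \<open>None\<close> is an isolated point.\<close>

abbreviation pt_topology :: "'a::topological_space option topology" where
  "pt_topology \<equiv> Alexandroff_compactification euclidean"

definition pt_borel :: "'a::topological_space option measure" where
  "pt_borel = sigma UNIV {U. openin pt_topology U}"

definition ext :: "('a \<Rightarrow> 'b::zero) \<Rightarrow> 'a option \<Rightarrow> 'b" where
  "ext u z = (case z of None \<Rightarrow> 0 | Some x \<Rightarrow> u x)"

definition vanishes_at_infinity :: "('a::topological_space \<Rightarrow> real) \<Rightarrow> bool" where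
  "vanishes_at_infinity u \<longleftrightarrow> (\<forall>\<epsilon>>0. \<exists>K. compact K \<and> (\<forall>x. x \<notin> K \<longrightarrow> \<bar>u x\<bar> < \<epsilon>))"

text \<open>\<open>C\<^sub>0(X)\<close> as a subspace of the bounded continuous functions, whose norm is the sup norm.\<close>

definition C0 :: "('a::topological_space \<Rightarrow>\<^sub>C real) set" where
  "C0 = {u. vanishes_at_infinity (apply_bcontfun u)}"

definition lower_semicontinuous :: "('a::topological_space \<Rightarrow> 'b::linorder) \<Rightarrow> bool" where
  "lower_semicontinuous f \<longleftrightarrow> (\<forall>a. open {x. a < f x})"

text \<open>On a locally compact separable metric space every Borel measure that is finite on compact
  sets is regular.\<close>

definition radon :: "'a::topological_space measure \<Rightarrow> bool" where
  "radon \<mu> \<longleftrightarrow> sets \<mu> = sets borel \<and> (\<forall>K. compact K \<longrightarrow> emeasure \<mu> K < \<infinity>)"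


section \<open>Standard processes\<close>

text \<open>All time indices range over \<open>[0,\<infinity>]\<close>, i.e. over \<open>ennreal\<close>; \<open>M \<infinity>\<close> is the ambient
  sigma-algebra on which the measures \<open>P x\<close> live.\<close>

locale markov_process = filtration \<Omega> M
  for \<Omega> :: "'w set" and M :: "ennreal \<Rightarrow> 'w measure" +
  fixes P :: "'a::topological_space option \<Rightarrow> 'w measure"
    and X :: "ennreal \<Rightarrow> 'w \<Rightarrow> 'a option"
    and \<theta> :: "ennreal \<Rightarrow> 'w \<Rightarrow> 'w"
  assumes prob_space_P: "prob_space (P z)"
    and sets_P: "sets (P z) = sets (M \<infinity>)"
    and shift_closed: "\<omega> \<in> \<Omega> \<Longrightarrow> \<theta> t \<omega> \<in> \<Omega>"
    and absorbing: "\<omega> \<in> \<Omega> \<Longrightarrow> X s \<omega> = None \<Longrightarrow> s \<le> t \<Longrightarrow> X t \<omega> = None"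
    and at_infinity: "\<omega> \<in> \<Omega> \<Longrightarrow> X \<infinity> \<omega> = None"
    and adapted: "X t \<in> M t \<rightarrow>\<^sub>M pt_borel"
    and kernel: "D \<in> sets borel \<Longrightarrow>
      (\<lambda>x. emeasure (P (Some x)) {\<omega>\<in>\<Omega>. X t \<omega> \<in> Some ` D}) \<in> borel_measurable borel"
    and start_cemetery: "AE \<omega> in P None. X 0 \<omega> = None"
    and homogeneous: "\<omega> \<in> \<Omega> \<Longrightarrow> X t (\<theta> h \<omega>) = X (t + h) \<omega>"
    and markov: "\<Lambda> \<in> sets (M t) \<Longrightarrow> B \<in> sets pt_borel \<Longrightarrow>
      emeasure (P z) (\<Lambda> \<inter> {\<omega>\<in>\<Omega>. X (t + s) \<omega> \<in> B})
        = (\<integral>\<^sup>+\<omega>\<in>\<Lambda>. emeasure (P (X t \<omega>)) {\<omega>'\<in>\<Omega>. X s \<omega>' \<in> B} \<partial>P z)"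

definition lifetime :: "(ennreal \<Rightarrow> 'w \<Rightarrow> 'a option) \<Rightarrow> 'w \<Rightarrow> ennreal" where
  "lifetime X \<omega> = Inf {t. X t \<omega> = None}"

definition natural_filtration ::
    "'w set \<Rightarrow> (ennreal \<Rightarrow> 'w \<Rightarrow> 'a::topological_space option) \<Rightarrow> ennreal \<Rightarrow> 'w measure" where
  "natural_filtration \<Omega> X t = sigma \<Omega> {X s -` B \<inter> \<Omega> | s B. s \<le> t \<and> B \<in> sets pt_borel}"

text \<open>The augmentation \<open>\<F>\<^sub>t\<close> of the natural filtration \<open>\<F>\<^sup>0\<^sub>t\<close>: the intersection, over all finite
  initial measures \<open>\<nu>\<close> on the compactified state space, of the completions of \<open>\<F>\<^sup>0\<^sub>t\<close> in
  \<open>\<F>\<^sup>0\<^sub>\<infinity>\<close> with respect to \<open>P\<^sup>\<nu> = \<integral> P z \<nu>(dz)\<close>.\<close>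

definition augmented_filtration ::
    "'w set \<Rightarrow> ('a::topological_space option \<Rightarrow> 'w measure) \<Rightarrow> (ennreal \<Rightarrow> 'w \<Rightarrow> 'a option)
      \<Rightarrow> ennreal \<Rightarrow> 'w measure" where
  "augmented_filtration \<Omega> P X t = sigma \<Omega> {\<Lambda>. \<Lambda> \<subseteq> \<Omega> \<and>
     (\<forall>\<nu>. finite_measure \<nu> \<longrightarrow> sets \<nu> = sets pt_borel \<longrightarrow>
        (\<exists>\<Lambda>'\<in>sets (natural_filtration \<Omega> X t). \<exists>N\<in>sets (natural_filtration \<Omega> X \<infinity>).
           (\<Lambda> - \<Lambda>') \<union> (\<Lambda>' - \<Lambda>) \<subseteq> N \<and> (\<integral>\<^sup>+z. emeasure (P z) N \<partial>\<nu>) = 0))}"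

text \<open>Completeness of \<open>M\<close> enters as \<open>\<F>\<^sub>t \<subseteq> M t\<close>.\<close>

locale standard_process = markov_process \<Omega> M P X \<theta>
  for \<Omega> :: "'w set" and M
    and P :: "'a::topological_space option \<Rightarrow> 'w measure" and X and \<theta> +
  assumes normal: "AE \<omega> in P (Some x). X 0 \<omega> = Some x"
    and right_continuous_filtration: "t < \<infinity> \<Longrightarrow> sets (M t) = (\<Inter>s\<in>{t<..}. sets (M s))"
    and complete_filtration: "sets (augmented_filtration \<Omega> P X t) \<subseteq> sets (M t)"
    and right_continuous_paths:
      "AE \<omega> in P z. \<forall>t<\<infinity>. limitin pt_topology (\<lambda>s. X s \<omega>) (X t \<omega>) (at_right t)"
    and left_limits:
      "AE \<omega> in P z. \<forall>t>0. t < lifetime X \<omega> \<longrightarrow>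
         (\<exists>l. limitin pt_topology (\<lambda>s. X s \<omega>) l (at_left t))"
    and strong_markov_measurable:
      "stopping_time M T \<Longrightarrow> (\<lambda>\<omega>. X (T \<omega>) \<omega>) \<in> pre_sigma T \<rightarrow>\<^sub>M pt_borel"
    and strong_markov:
      "stopping_time M T \<Longrightarrow> \<Lambda> \<in> sets (pre_sigma T) \<Longrightarrow> B \<in> sets pt_borel \<Longrightarrow>
        emeasure (P z) (\<Lambda> \<inter> {\<omega>\<in>\<Omega>. X (T \<omega> + s) \<omega> \<in> B})
          = (\<integral>\<^sup>+\<omega>\<in>\<Lambda>. emeasure (P (X (T \<omega>) \<omega>)) {\<omega>'\<in>\<Omega>. X s \<omega>' \<in> B} \<partial>P z)"
    and quasi_left_continuous:
      "(\<And>n. stopping_time M (T' n)) \<Longrightarrow> (\<And>\<omega>. \<omega> \<in> \<Omega> \<Longrightarrow> incseq (\<lambda>n. T' n \<omega>)) \<Longrightarrow>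
        AE \<omega> in P z. (SUP n. T' n \<omega>) < lifetime X \<omega> \<longrightarrow>
          limitin pt_topology (\<lambda>n. X (T' n \<omega>) \<omega>) (X (SUP n. T' n \<omega>) \<omega>) sequentially"

definition transition ::
    "('a option \<Rightarrow> 'w measure) \<Rightarrow> (ennreal \<Rightarrow> 'w \<Rightarrow> 'a option) \<Rightarrow> real \<Rightarrow> ('a \<Rightarrow> ennreal) \<Rightarrow> 'a \<Rightarrow> ennreal"
  where "transition P X t f x = (\<integral>\<^sup>+\<omega>. ext f (X (ennreal t) \<omega>) \<partial>P (Some x))"

definition transient_process ::
    "('a::topological_space option \<Rightarrow> 'w measure) \<Rightarrow> (ennreal \<Rightarrow> 'w \<Rightarrow> 'a option) \<Rightarrow> bool" where
  "transient_process P X \<longleftrightarrow> (\<exists>f\<in>borel_measurable borel. (\<forall>x. 0 < f x) \<and>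
     (\<forall>x. (\<integral>\<^sup>+\<omega>. (\<integral>\<^sup>+t\<in>{0..}. ext f (X (ennreal t) \<omega>) \<partial>lborel) \<partial>P (Some x)) < \<infinity>))"


section \<open>Positive continuous additive functionals\<close>

text \<open>Additive functionals take values in \<open>[0,\<infinity>]\<close> and are extended to \<open>t = \<infinity>\<close> by continuity.
  As usual, \<open>almost surely\<close> refers to an exceptional set in \<open>\<F>\<^sub>\<infinity>\<close> that is null for
  every \<open>P x\<close>.\<close>

definition almost_surely ::
    "'w set \<Rightarrow> ('a::topological_space option \<Rightarrow> 'w measure) \<Rightarrow> (ennreal \<Rightarrow> 'w \<Rightarrow> 'a option)
      \<Rightarrow> ('w \<Rightarrow> bool) \<Rightarrow> bool" where
  "almost_surely \<Omega> P X Q \<longleftrightarrow> (\<exists>N\<in>sets (augmented_filtration \<Omega> P X \<infinity>).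
     (\<forall>x. emeasure (P x) N = 0) \<and> {\<omega>\<in>\<Omega>. \<not> Q \<omega>} \<subseteq> N)"

definition PCAF ::
    "'w set \<Rightarrow> ('a::topological_space option \<Rightarrow> 'w measure) \<Rightarrow> (ennreal \<Rightarrow> 'w \<Rightarrow> 'a option)
      \<Rightarrow> (ennreal \<Rightarrow> 'w \<Rightarrow> 'w) \<Rightarrow> (ennreal \<Rightarrow> 'w \<Rightarrow> ennreal) \<Rightarrow> bool" where
  "PCAF \<Omega> P X \<theta> A \<longleftrightarrow>
     (\<forall>t. A t \<in> borel_measurable (augmented_filtration \<Omega> P X t)) \<and>
     almost_surely \<Omega> P X (\<lambda>\<omega>. A 0 \<omega> = 0 \<and> mono (\<lambda>t. A t \<omega>) \<and> continuous_on UNIV (\<lambda>t. A t \<omega>) \<and>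
       (\<forall>t<lifetime X \<omega>. A t \<omega> < \<infinity>) \<and> (\<forall>t\<ge>lifetime X \<omega>. A t \<omega> = A (lifetime X \<omega>) \<omega>)) \<and>
     (\<forall>s<\<infinity>. \<forall>t<\<infinity>. \<forall>x. AE \<omega> in P x. A (t + s) \<omega> = A t \<omega> + A s (\<theta> t \<omega>))"

text \<open>\<open>\<integral>\<^sub>[\<^sub>0\<^sub>,\<^sub>\<infinity>\<^sub>) f da\<close> for a continuous nondecreasing \<open>a\<close> with values in \<open>[0,\<infinity>]\<close> and \<open>a 0 = 0\<close>.
  The truncation \<open>min (a t) k\<close> is a real distribution function with measure
  \<open>da\<close> restricted to \<open>{t. a t < k}\<close>; for negative \<open>t\<close>, \<open>ennreal t = 0\<close>, so there is no mass outside
  \<open>(0,\<infinity>)\<close>. For finite \<open>a\<close> this is the usual Stieltjes integral.\<close>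

definition stieltjes_integral :: "(real \<Rightarrow> ennreal) \<Rightarrow> (ennreal \<Rightarrow> ennreal) \<Rightarrow> ennreal" where
  "stieltjes_integral f a =
     (SUP k::nat. \<integral>\<^sup>+t\<in>{0..}. f t \<partial>interval_measure (\<lambda>t. enn2real (min (a (ennreal t)) (of_nat k))))"

text \<open>\<open>E\<^sub>x[\<integral>\<^sub>0\<^sup>\<infinity> h(t) f(X\<^sub>t) dA\<^sub>t]\<close>\<close>

definition AF_integral ::
    "('a option \<Rightarrow> 'w measure) \<Rightarrow> (ennreal \<Rightarrow> 'w \<Rightarrow> 'a option) \<Rightarrow> (ennreal \<Rightarrow> 'w \<Rightarrow> ennreal)
      \<Rightarrow> (real \<Rightarrow> ennreal) \<Rightarrow> ('a \<Rightarrow> ennreal) \<Rightarrow> 'a \<Rightarrow> ennreal" where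
  "AF_integral P X A h f x =
     (\<integral>\<^sup>+\<omega>. stieltjes_integral (\<lambda>t. h t * ext f (X (ennreal t) \<omega>)) (\<lambda>t. A t \<omega>) \<partial>P (Some x))"

text \<open>\<open>\<integral> f d\<mu> = lim\<^sub>t\<^sub>\<down>\<^sub>0 t\<^sup>-\<^sup>1 E\<^sub>m[\<integral>\<^sub>0\<^sup>t f(X\<^sub>s) dA\<^sub>s]\<close>\<close>

definition revuz_measure ::
    "('a::topological_space option \<Rightarrow> 'w measure) \<Rightarrow> (ennreal \<Rightarrow> 'w \<Rightarrow> 'a option) \<Rightarrow> 'a measure
      \<Rightarrow> (ennreal \<Rightarrow> 'w \<Rightarrow> ennreal) \<Rightarrow> 'a measure \<Rightarrow> bool" where
  "revuz_measure P X m A \<mu> \<longleftrightarrow> sets \<mu> = sets borel \<and>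
     (\<forall>f\<in>borel_measurable borel.
        ((\<lambda>t. (\<integral>\<^sup>+x. AF_integral P X A (indicator {0..t}) f x \<partial>m) / ennreal t)
           \<longlongrightarrow> (\<integral>\<^sup>+x. f x \<partial>\<mu>)) (at_right (0::real)))"


section \<open>Green functions and the Kato class\<close>

definition green :: "(real \<Rightarrow> 'a \<Rightarrow> 'a \<Rightarrow> ennreal) \<Rightarrow> real \<Rightarrow> 'a \<Rightarrow> 'a \<Rightarrow> ennreal" where
  "green p \<alpha> x y = (\<integral>\<^sup>+t\<in>{0<..}. ennreal (exp (- \<alpha> * t)) * p t x y \<partial>lborel)"

definition green_potential ::
    "(real \<Rightarrow> 'a \<Rightarrow> 'a \<Rightarrow> ennreal) \<Rightarrow> real \<Rightarrow> 'a measure \<Rightarrow> ('a \<Rightarrow> ennreal) \<Rightarrow> 'a \<Rightarrow> ennreal" where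
  "green_potential p \<alpha> \<mu> f x = (\<integral>\<^sup>+y. green p \<alpha> x y * f y \<partial>\<mu>)"

definition kato ::
    "(real \<Rightarrow> 'a::topological_space \<Rightarrow> 'a \<Rightarrow> ennreal) \<Rightarrow> 'a measure \<Rightarrow> bool" where
  "kato p \<mu> \<longleftrightarrow> radon \<mu> \<and>
     (\<exists>g\<in>C0. \<forall>x. 0 \<le> apply_bcontfun g x \<and>
        green_potential p 0 \<mu> (\<lambda>_. 1) x = ennreal (apply_bcontfun g x))"

definition vague_convergence ::
    "(nat \<Rightarrow> 'a::topological_space measure) \<Rightarrow> 'a measure \<Rightarrow> bool" where
  "vague_convergence \<mu> \<mu>' \<longleftrightarrow>
     (\<forall>\<phi>::'a \<Rightarrow> real. continuous_on UNIV \<phi> \<longrightarrow> compact (closure {x. \<phi> x \<noteq> 0}) \<longrightarrow>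
        (\<lambda>n. \<integral>x. \<phi> x \<partial>\<mu> n) \<longlonglongrightarrow> (\<integral>x. \<phi> x \<partial>\<mu>'))"

text \<open>The last assumption is the Revuz formula: it says that the chosen (everywhere defined)
  version of the transition density represents the potentials of the PCAFs of Kato measures at
  every point. For nonnegative Borel \<open>f\<close> it is equivalent, by linearity and monotone
  convergence, to the formula for bounded Borel functions.\<close>

locale transient_dual_process =
  standard_process \<Omega> M P X \<theta> + dual: standard_process \<Omega>' M' P' X' \<theta>'
  for \<Omega> :: "'w set" and M
    and P :: "'a::{metric_space, second_countable_topology} option \<Rightarrow> 'w measure" and X and \<theta>
    and \<Omega>' :: "'v set" and M' and P' :: "'a option \<Rightarrow> 'v measure" and X' and \<theta>' +
  fixes m :: "'a measure" and p :: "real \<Rightarrow> 'a \<Rightarrow> 'a \<Rightarrow> ennreal"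
  assumes locally_compact_space: "locally compact (UNIV :: 'a set)"
    and radon_m: "radon m"
    and full_support: "open U \<Longrightarrow> U \<noteq> {} \<Longrightarrow> 0 < emeasure m U"
    and transient: "transient_process P X"
    and dual_transient: "transient_process P' X'"
    and duality: "0 \<le> t \<Longrightarrow> f \<in> borel_measurable borel \<Longrightarrow> g \<in> borel_measurable borel \<Longrightarrow>
      (\<integral>\<^sup>+x. f x * transition P X t g x \<partial>m) = (\<integral>\<^sup>+x. transition P' X' t f x * g x \<partial>m)"
    and density_measurable: "(\<lambda>(t, x, y). p t x y)
      \<in> borel_measurable (restrict_space borel {0<..} \<Otimes>\<^sub>M borel \<Otimes>\<^sub>M borel)"
    and density_pos: "0 < t \<Longrightarrow> 0 < p t x y"
    and density: "0 < t \<Longrightarrow> f \<in> borel_measurable borel \<Longrightarrow>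
      transition P X t f x = (\<integral>\<^sup>+y. p t x y * f y \<partial>m)"
    and green_not_infinite: "\<exists>x y. green p 0 x y \<noteq> \<infinity>"
    and green_lsc: "lower_semicontinuous (\<lambda>(x, y). green p 0 x y)"
    and revuz_formula: "kato p \<mu> \<Longrightarrow> PCAF \<Omega> P X \<theta> A \<Longrightarrow> revuz_measure P X m A \<mu> \<Longrightarrow>
      0 \<le> \<alpha> \<Longrightarrow> f \<in> borel_measurable borel \<Longrightarrow>
      AF_integral P X A (\<lambda>t. ennreal (exp (- \<alpha> * t))) f x = green_potential p \<alpha> \<mu> f x"


section \<open>Time change and integrated semigroup\<close>

definition inverse_AF :: "(ennreal \<Rightarrow> 'w \<Rightarrow> ennreal) \<Rightarrow> ennreal \<Rightarrow> 'w \<Rightarrow> ennreal" where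
  "inverse_AF A t \<omega> = Inf {s. t < A s \<omega>}"

text \<open>Paths are only almost surely regular, hence the completed measure: the inner integral need
  not be measurable on the exceptional set.\<close>

definition time_changed_resolvent ::
    "('a option \<Rightarrow> 'w measure) \<Rightarrow> (ennreal \<Rightarrow> 'w \<Rightarrow> 'a option) \<Rightarrow> (ennreal \<Rightarrow> 'w \<Rightarrow> ennreal)
      \<Rightarrow> real \<Rightarrow> ('a \<Rightarrow> real) \<Rightarrow> 'a \<Rightarrow> real" where
  "time_changed_resolvent P X A \<alpha> u x =
     (\<integral>\<omega>. (LINT t:{0..}|lborel.
        exp (- \<alpha> * t) * ext u (X (inverse_AF A (ennreal t) \<omega>) \<omega>)) \<partial>completion (P (Some x)))"

text \<open>The strong integral is taken in the Banach space of bounded continuous functions, in which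
  \<open>C0\<close> is a closed subspace.\<close>

definition integrated_semigroup ::
    "(real \<Rightarrow> ('a::topological_space \<Rightarrow> real) \<Rightarrow> 'a \<Rightarrow> real)
      \<Rightarrow> (real \<Rightarrow> ('a \<Rightarrow>\<^sub>C real) \<Rightarrow> ('a \<Rightarrow>\<^sub>C real)) \<Rightarrow> bool" where
  "integrated_semigroup R S \<longleftrightarrow>
     (\<forall>t\<ge>0. (\<forall>u\<in>C0. S t u \<in> C0) \<and>
        (\<forall>u\<in>C0. \<forall>v\<in>C0. S t (u + v) = S t u + S t v) \<and>
        (\<forall>c. \<forall>u\<in>C0. S t (c *\<^sub>R u) = c *\<^sub>R S t u) \<and>
        (\<exists>B. \<forall>u\<in>C0. norm (S t u) \<le> B * norm u)) \<and>
     (\<forall>u\<in>C0. continuous_on {0..} (\<lambda>t. S t u)) \<and>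
     (\<forall>\<alpha>>0. \<forall>u\<in>C0. \<exists>I\<in>C0. ((\<lambda>t. exp (- \<alpha> * t) *\<^sub>R S t u) has_integral I) {0..} \<and>
        (\<forall>x. R \<alpha> (apply_bcontfun u) x = \<alpha> * apply_bcontfun I x))"

end

theory Submission
  imports Defs
begin

text \<open>Put \<open>D r = u (X (\<tau> r))\<close> for the time-changed path. The operators
  \<open>R \<alpha> u x = E x [\<integral> exp (- \<alpha> r) D r dr]\<close> satisfy the resolvent equation for \<open>\<alpha> \<ge> 0\<close>, and
  \<open>R 0\<close> is the potential operator of \<open>\<mu>\<close>. The resolvent equation is obtained without the strong Markov
  property and without perfection of the additive functional: \<open>D\<close> is a limit of step functions built from
  the path at the deterministic times \<open>i / k\<close>, and the simple Markov property and additivity are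
  applied at these times only.

  Lower semicontinuity of the Green function and vague convergence give a locally uniform lower bound for the potentials
  of \<open>f\<close> and of \<open>1 - f\<close>, where \<open>0 \<le> f \<le> 1\<close>. As the potentials of \<open>1\<close> converge uniformly to a
  function vanishing at infinity, both bounds are sharp, and the potentials of every bounded continuous function
  converge uniformly. Then \<open>R \<alpha> u\<close> converges for small \<open>\<alpha>\<close> by a perturbation
  argument, and for all \<open>\<alpha> > 0\<close> by the resolvent equation.

  Finally \<open>S t u x = E x [\<integral>\<^sub>0\<^sup>t D r dr]\<close> by uniqueness of Laplace transforms, so these functions of \<open>t\<close> are
  Lipschitz uniformly in \<open>n\<close> and \<open>x\<close>. Approximating a bump function by polynomials in \<open>exp (- t)\<close>
  turns convergence of the Laplace transforms into locally uniform convergence of the functions.\<close>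

section \<open>Laplace transforms of continuous functions\<close>

text \<open>Additivity of \<open>A\<close> is assumed for each pair of times outside a null set that
  depends on the pair, and \<open>A\<close> is measurable only for the augmented filtration, so
  arguments at random times are avoided. This dictates the shape of the grid: between the clock
  readings at i/k and (i+1)/k the path is sampled at the right end (i+1)/k. The weight of such a
  cell is then known at the sampling time, as conditioning requires, and right-continuity of the
  path makes the step functions converge.

  The value \<alpha> = 0 is carried along because there the operators are bounded by the sup norm of
  the potential of 1, uniformly for large n. One fixed small \<alpha> then makes the perturbation a
  contraction for all these n.

  Inversion of a Laplace transform is not continuous in general. The uniform Lipschitz bound is what
  repairs this: at a fixed time, finitely many values of the transform, with coefficients that do
  not depend on the function, control the function up to a prescribed error.\<close>

lemma
  fixes a :: real
  assumes "0 < a"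
  shows set_integrable_exp_minus: "set_integrable lborel {0..} (\<lambda>t. exp (- a * t))"
    and set_integral_exp_minus: "(LINT t:{0..}|lborel. exp (- a * t)) = 1 / a"
proof -
  have "(\<integral>\<^sup>+t. ennreal (exp (- a * t)) * indicator {0..} t \<partial>lborel) = ennreal (0 - (- exp (- a * 0) / a))"
  proof (rule nn_integral_FTC_atLeast[where F = "\<lambda>t. - exp (- a * t) / a"])
    show "((\<lambda>t. - exp (- a * t) / a) \<longlongrightarrow> 0) at_top"
      using assms by real_asymp
  qed (use assms in \<open>auto intro!: derivative_eq_intros\<close>)
  then have "(\<integral>\<^sup>+t. ennreal (indicator {0..} t *\<^sub>R exp (- a * t)) \<partial>lborel) = ennreal (1 / a)"
    by (simp add: ennreal_mult ennreal_indicator mult.commute)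
  then have "has_bochner_integral lborel (\<lambda>t. indicator {0..} t *\<^sub>R exp (- a * t)) (1 / a)"
    using assms by (intro has_bochner_integral_nn_integral) auto
  then show "set_integrable lborel {0..} (\<lambda>t. exp (- a * t))"
    "(LINT t:{0..}|lborel. exp (- a * t)) = 1 / a"
    unfolding set_integrable_def set_lebesgue_integral_def by (auto simp: has_bochner_integral_iff)
qed

lemma one_plus_le_exp:
  fixes a t :: real
  assumes "0 < a" "0 \<le> t"
  shows "1 + t \<le> (1 + 2 / a) * exp (a / 2 * t)"
proof -
  have "1 + t \<le> (1 + 2 / a) * (1 + a / 2 * t)"
    using assms by (simp add: field_simps)
  also have "\<dots> \<le> (1 + 2 / a) * exp (a / 2 * t)"
    using assms by (intro mult_left_mono exp_ge_add_one_self) auto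
  finally show ?thesis .
qed

text \<open>Half of the exponent absorbs the growth, since \<open>1 + t\<close> is at most a
  constant times \<open>exp (a / 2 * t)\<close>. Linear growth is the natural class here: the
  functions of interest are integrals over \<open>{0..t}\<close> of bounded densities.\<close>

lemma set_integrable_laplace:
  fixes f :: "real \<Rightarrow> real"
  assumes a: "0 < a" and f: "continuous_on {0..} f"
    and B: "\<And>t. 0 \<le> t \<Longrightarrow> \<bar>f t\<bar> \<le> B * (1 + t)"
  shows "set_integrable lborel {0..} (\<lambda>t. exp (- a * t) * f t)"
proof (rule set_integrable_bound)
  show "set_integrable lborel {0..} (\<lambda>t. (B * (1 + 2 / a)) * exp (- (a / 2) * t))"
    using a by (intro set_integrable_mult_right set_integrable_exp_minus) auto
  show "set_borel_measurable lborel {0..} (\<lambda>t. exp (- a * t) * f t)"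
  proof -
    have "continuous_on {0..} (\<lambda>t. exp (- a * t) * f t)" by (intro continuous_intros f)
    then show ?thesis
      unfolding set_borel_measurable_def
      using borel_measurable_continuous_on_indicator[of "{0..}" "\<lambda>t. exp (- a * t) * f t"] by simp
  qed
  have "\<bar>exp (- a * t) * f t\<bar> \<le> (B * (1 + 2 / a)) * exp (- (a / 2) * t)" if t: "0 \<le> t" for t
  proof -
    have B0: "0 \<le> B" using B[of 0] by simp
    have "\<bar>exp (- a * t) * f t\<bar> \<le> exp (- a * t) * (B * (1 + t))"
      using B[OF t] by (simp add: abs_mult)
    also have "\<dots> \<le> exp (- a * t) * (B * ((1 + 2 / a) * exp (a / 2 * t)))"
      using B0 one_plus_le_exp[OF a t] by (intro mult_left_mono) auto
    also have "\<dots> = (B * (1 + 2 / a)) * (exp (- a * t) * exp (a / 2 * t))" by simp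
    also have "exp (- a * t) * exp (a / 2 * t) = exp (- (a / 2) * t)"
      by (simp add: exp_add[symmetric] field_simps)
    finally show ?thesis .
  qed
  then show "AE t in lborel. t \<in> {0..} \<longrightarrow>
      norm (exp (- a * t) * f t) \<le> norm ((B * (1 + 2 / a)) * exp (- (a / 2) * t))"
    by (auto intro!: AE_I2 intro: order_trans[OF _ abs_ge_self])
qed

text \<open>Approximates a triangular bump around \<open>t0\<close>, as a function of \<open>exp (- t)\<close>, by a polynomial.\<close>

lemma laplace_point_estimate:
  fixes t0 \<delta> \<epsilon> :: real
  assumes \<delta>: "0 < \<delta>" "\<delta> < t0" and \<epsilon>: "0 < \<epsilon>"
  obtains c :: "nat \<Rightarrow> real" and n :: nat where
    "\<And>f B \<eta>. continuous_on {0..} f \<Longrightarrow> (\<And>t. 0 \<le> t \<Longrightarrow> \<bar>f t\<bar> \<le> B * (1 + t)) \<Longrightarrow>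
       (\<And>t. \<bar>t - t0\<bar> \<le> \<delta> \<Longrightarrow> \<bar>f t - f t0\<bar> \<le> \<eta>) \<Longrightarrow>
       \<bar>f t0\<bar> \<le> \<eta> + (\<Sum>j\<le>n. \<bar>c j\<bar> * \<bar>LINT t:{0..}|lborel. exp (- (1 + real j) * t) * f t\<bar>) + \<epsilon> * B"
proof -
  define \<kappa> where "\<kappa> t = max 0 (1 - \<bar>t - t0\<bar> / \<delta>)" for t
  have \<kappa>_cont: "continuous_on S \<kappa>" for S
    unfolding \<kappa>_def using \<delta> by (intro continuous_intros) auto
  have \<kappa>_0: "\<kappa> t = 0" if "\<bar>t - t0\<bar> \<ge> \<delta>" for t
    using that \<delta> by (simp add: \<kappa>_def field_simps)
  have \<kappa>_supp: "t0 - \<delta> \<le> t \<and> t \<le> t0 + \<delta>" if "\<kappa> t \<noteq> 0" for t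
    using \<kappa>_0[of t] that by linarith
  have \<kappa>_nn: "0 \<le> \<kappa> t" for t by (simp add: \<kappa>_def)
  define K :: real where "K = (LINT t:{0..}|lborel. exp (- 1 * t) * (1 + t))"
  have K_int: "set_integrable lborel {0..} (\<lambda>t::real. exp (- 1 * t) * (1 + t))"
    using set_integrable_laplace[of 1 "\<lambda>t. 1 + t" 1] by (simp add: continuous_intros)
  have K0: "0 \<le> K"
    unfolding K_def set_lebesgue_integral_def
    by (intro Bochner_Integration.integral_nonneg) (auto simp: indicator_def)
  define C :: real where "C = (LINT t:{0..}|lborel. \<kappa> t)"
  have bump_int: "set_integrable lborel {0..} (\<lambda>t. \<kappa> t * f t)"
    if f: "continuous_on {0..} f" for f :: "real \<Rightarrow> real"
  proof -
    have "set_integrable lborel {t0 - \<delta>..t0 + \<delta>} (\<lambda>t. \<kappa> t * f t)"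
      using \<delta> by (intro borel_integrable_atLeastAtMost')
        (auto intro!: continuous_intros \<kappa>_cont continuous_on_subset[OF f])
    then show ?thesis
      unfolding set_integrable_def
      by (rule Bochner_Integration.integrable_cong[OF refl, THEN iffD1, rotated])
         (use \<kappa>_supp \<delta> in \<open>force simp: indicator_def\<close>)
  qed
  have C_int: "set_integrable lborel {0..} \<kappa>"
    using bump_int[of "\<lambda>_. 1"] by simp
  \<comment> \<open>Only positivity of \<open>C\<close> is wanted; the bump is at least 1/2 on the
    middle half of its support.\<close>
  have "(LINT t:{0..}|lborel. (1 / 2) * indicator {t0 - \<delta> / 2..t0 + \<delta> / 2} t) \<le> C"
    unfolding C_def
  proof (rule set_integral_mono[OF _ C_int])
    have "integrable lborel (\<lambda>t. (1 / 2) * indicator {t0 - \<delta> / 2..t0 + \<delta> / 2} t :: real)"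
      by (intro integrable_mult_right integrable_real_indicator)
         (auto simp: emeasure_lborel_Icc_eq)
    then show "set_integrable lborel {0..} (\<lambda>t. (1 / 2) * indicator {t0 - \<delta> / 2..t0 + \<delta> / 2} t :: real)"
      unfolding set_integrable_def by (intro integrable_mult_indicator) auto
  next
    fix t show "(1 / 2) * indicator {t0 - \<delta> / 2..t0 + \<delta> / 2} t \<le> \<kappa> t"
      using \<delta> by (auto simp: indicator_def \<kappa>_def field_simps abs_if)
  qed
  moreover have "(LINT t:{0..}|lborel. (1 / 2) * indicator {t0 - \<delta> / 2..t0 + \<delta> / 2} t) = \<delta> / 2"
  proof -
    have "(LINT t:{0..}|lborel. (1 / 2) * indicator {t0 - \<delta> / 2..t0 + \<delta> / 2} t)
        = (LINT t|lborel. (1 / 2) * indicator {t0 - \<delta> / 2..t0 + \<delta> / 2} t :: real)"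
      unfolding set_lebesgue_integral_def using \<delta>
      by (intro Bochner_Integration.integral_cong refl) (auto simp: indicator_def)
    also have "\<dots> = \<delta> / 2" using \<delta> by simp
    finally show ?thesis .
  qed
  ultimately have C0: "0 < C" using \<delta> by simp
  \<comment> \<open>In the variable y = exp (- t) the bump has to be continued to y = 0, where
    \<open>ln y\<close> and \<open>1 / y\<close> are singular. Below \<open>e1\<close> the time is
    frozen at t0 + \<delta> + 1, beyond the support, so the value is 0 there. Division by y reserves
    a factor exp (- t) for integrability, whence the exponents \<open>1 + real j\<close>.\<close>
  define e1 where "e1 = exp (- (t0 + \<delta> + 1))"
  have e1: "0 < e1" by (simp add: e1_def)
  define k where "k y = \<kappa> (- ln (max y e1)) / max y e1" for y
  have k_cont: "continuous_on {0..1} k"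
  proof -
    have "continuous_on {0..1} (\<lambda>y. \<kappa> (- ln (max y e1)))"
      using e1 by (intro continuous_on_compose2[OF \<kappa>_cont[of UNIV]] continuous_intros) auto
    then show ?thesis unfolding k_def using e1
      by (intro continuous_intros) auto
  qed
  have k_exp: "k (exp (- t)) * exp (- t) = \<kappa> t" for t
  proof (cases "exp (- t) \<ge> e1")
    case True then show ?thesis by (simp add: k_def max_def)
  next
    case False
    then have "t > t0 + \<delta> + 1" by (simp add: e1_def)
    moreover have "max (exp (- t)) e1 = e1" using False by simp
    ultimately show ?thesis
      by (simp only: k_def) (simp add: e1_def \<kappa>_0)
  qed
  \<comment> \<open>The uniform error is integrated against exp (- t) times the growth bound, which
    costs a factor \<open>B * K\<close>, and the estimate is finally divided by \<open>C\<close>.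
    The summand 1 keeps the divisor positive.\<close>
  define \<epsilon>' where "\<epsilon>' = \<epsilon> * C / (K + 1)"
  have \<epsilon>': "0 < \<epsilon>'" using \<epsilon> C0 K0 by (simp add: \<epsilon>'_def)
  obtain q where q: "real_polynomial_function q" "\<And>x. x \<in> {0..1} \<Longrightarrow> \<bar>k x - q x\<bar> < \<epsilon>'"
    using Stone_Weierstrass_real_polynomial_function[OF compact_Icc k_cont \<epsilon>'] by blast
  from q(1) obtain d n where q_eq: "q = (\<lambda>x. \<Sum>i\<le>n. d i * x ^ i)"
    unfolding real_polynomial_function_iff_sum by blast
  \<comment> \<open>The coefficients come from \<open>t0\<close>, \<delta> and \<epsilon> alone,
    through the polynomial \<open>q\<close>. The function \<open>f\<close> enters only afterwards,
    which makes the estimate uniform over families of functions.\<close>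
  show thesis
  proof (rule that[of "\<lambda>j. d j / C" n])
    fix f :: "real \<Rightarrow> real" and B \<eta>
    assume f: "continuous_on {0..} f" and B: "\<And>t. 0 \<le> t \<Longrightarrow> \<bar>f t\<bar> \<le> B * (1 + t)"
      and \<eta>: "\<And>t. \<bar>t - t0\<bar> \<le> \<delta> \<Longrightarrow> \<bar>f t - f t0\<bar> \<le> \<eta>"
    have B0: "0 \<le> B" using B[of 0] by simp
    let ?I = "\<lambda>j. LINT t:{0..}|lborel. exp (- (1 + real j) * t) * f t"
    have int_j: "set_integrable lborel {0..} (\<lambda>t. exp (- (1 + real j) * t) * f t)" for j
      by (rule set_integrable_laplace[OF _ f B]) auto
    have poly: "exp (- t) * q (exp (- t)) * f t = (\<Sum>j\<le>n. d j * (exp (- (1 + real j) * t) * f t))" for t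
      unfolding q_eq sum_distrib_left sum_distrib_right
    proof (intro sum.cong refl)
      fix j
      have "exp (- t) * exp (- t) ^ j = exp (- (1 + real j) * t)"
        by (simp add: exp_of_nat_mult[symmetric] exp_add[symmetric] algebra_simps)
      then show "exp (- t) * (d j * exp (- t) ^ j) * f t = d j * (exp (- (1 + real j) * t) * f t)"
        by (simp add: algebra_simps)
    qed
    have int_poly: "set_integrable lborel {0..} (\<lambda>t. exp (- t) * q (exp (- t)) * f t)"
      using int_j unfolding poly set_integrable_def scaleR_sum_right
      by (intro Bochner_Integration.integrable_sum) (simp add: mult.left_commute)
    have eq_poly: "(LINT t:{0..}|lborel. exp (- t) * q (exp (- t)) * f t) = (\<Sum>j\<le>n. d j * ?I j)"
      using int_j unfolding poly set_integrable_def set_lebesgue_integral_def scaleR_sum_right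
      by (subst Bochner_Integration.integral_sum) (auto simp: mult.left_commute[of _ "d _"])
    have int_f: "set_integrable lborel {0..} (\<lambda>t. \<kappa> t * f t)" by (rule bump_int[OF f])
    have "\<bar>(LINT t:{0..}|lborel. \<kappa> t * f t) - (LINT t:{0..}|lborel. exp (- t) * q (exp (- t)) * f t)\<bar>
        = \<bar>LINT t:{0..}|lborel. \<kappa> t * f t - exp (- t) * q (exp (- t)) * f t\<bar>"
      using int_f int_poly by (subst set_integral_diff) auto
    also have "\<dots> \<le> (LINT t:{0..}|lborel. \<bar>\<kappa> t * f t - exp (- t) * q (exp (- t)) * f t\<bar>)"
      using set_integral_diff(1)[OF int_f int_poly]
      by (intro set_integral_norm_bound[where f = "\<lambda>t. \<kappa> t * f t - exp (- t) * q (exp (- t)) * f t", unfolded real_norm_def])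
    also have "\<dots> \<le> (LINT t:{0..}|lborel. (\<epsilon>' * B) * (exp (- 1 * t) * (1 + t)))"
    proof (rule set_integral_mono)
      show "set_integrable lborel {0..} (\<lambda>t. \<bar>\<kappa> t * f t - exp (- t) * q (exp (- t)) * f t\<bar>)"
        using set_integral_diff(1)[OF int_f int_poly] by (rule set_integrable_abs)
      show "set_integrable lborel {0..} (\<lambda>t. (\<epsilon>' * B) * (exp (- 1 * t) * (1 + t)))"
        by (intro set_integrable_mult_right K_int)
      fix t :: real assume t: "t \<in> {0..}"
      have "\<kappa> t * f t - exp (- t) * q (exp (- t)) * f t = exp (- t) * (k (exp (- t)) - q (exp (- t))) * f t"
        by (subst k_exp[symmetric]) (simp add: algebra_simps)
      then have "\<bar>\<kappa> t * f t - exp (- t) * q (exp (- t)) * f t\<bar>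
          = exp (- t) * \<bar>k (exp (- t)) - q (exp (- t))\<bar> * \<bar>f t\<bar>"
        by (simp add: abs_mult)
      also have "\<dots> \<le> exp (- t) * \<epsilon>' * (B * (1 + t))"
        using t q(2)[of "exp (- t)"] \<epsilon>' B[of t] by (intro mult_mono mult_left_mono) auto
      finally show "\<bar>\<kappa> t * f t - exp (- t) * q (exp (- t)) * f t\<bar> \<le> (\<epsilon>' * B) * (exp (- 1 * t) * (1 + t))"
        by (simp add: algebra_simps)
    qed
    also have "\<dots> = \<epsilon>' * B * K" by (simp add: K_def)
    finally have A1: "\<bar>LINT t:{0..}|lborel. \<kappa> t * f t\<bar> \<le> \<bar>\<Sum>j\<le>n. d j * ?I j\<bar> + \<epsilon>' * B * K"
      unfolding eq_poly by linarith
    have int_d: "set_integrable lborel {0..} (\<lambda>t. \<kappa> t * (f t - f t0))"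
      by (rule bump_int) (intro continuous_intros f)
    have "f t0 * C - (LINT t:{0..}|lborel. \<kappa> t * f t) = - (LINT t:{0..}|lborel. \<kappa> t * (f t - f t0))"
    proof -
      have "(LINT t:{0..}|lborel. \<kappa> t * (f t - f t0))
          = (LINT t:{0..}|lborel. \<kappa> t * f t - f t0 * \<kappa> t)"
        by (simp add: algebra_simps)
      also have "\<dots> = (LINT t:{0..}|lborel. \<kappa> t * f t) - f t0 * C"
        using int_f C_int by (subst set_integral_diff) (auto simp: C_def)
      finally show ?thesis by simp
    qed
    moreover have "\<bar>LINT t:{0..}|lborel. \<kappa> t * (f t - f t0)\<bar> \<le> (LINT t:{0..}|lborel. \<bar>\<kappa> t * (f t - f t0)\<bar>)"
      using int_d by (intro set_integral_norm_bound[where f = "\<lambda>t. \<kappa> t * (f t - f t0)", unfolded real_norm_def])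
    moreover have "(LINT t:{0..}|lborel. \<bar>\<kappa> t * (f t - f t0)\<bar>) \<le> (LINT t:{0..}|lborel. \<eta> * \<kappa> t)"
    proof (rule set_integral_mono)
      show "set_integrable lborel {0..} (\<lambda>t. \<bar>\<kappa> t * (f t - f t0)\<bar>)"
        using int_d by (rule set_integrable_abs)
      show "set_integrable lborel {0..} (\<lambda>t. \<eta> * \<kappa> t)"
        by (intro set_integrable_mult_right C_int)
      fix t :: real assume "t \<in> {0..}"
      show "\<bar>\<kappa> t * (f t - f t0)\<bar> \<le> \<eta> * \<kappa> t"
      proof (cases "\<bar>t - t0\<bar> \<le> \<delta>")
        case True then show ?thesis using \<eta>[OF True] \<kappa>_nn[of t]
          by (simp add: abs_mult mult.commute[of \<eta>] mult_left_mono)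
      qed (use \<kappa>_0 in auto)
    qed
    moreover have "(LINT t:{0..}|lborel. \<eta> * \<kappa> t) = \<eta> * C" by (simp add: C_def)
    ultimately have "\<bar>f t0\<bar> * C \<le> \<eta> * C + (\<bar>\<Sum>j\<le>n. d j * ?I j\<bar> + \<epsilon>' * B * K)"
      using A1 C0 abs_mult[of "f t0" C] by auto
    also have "\<epsilon>' * B * K \<le> \<epsilon> * B * C"
    proof -
      have "\<epsilon>' * K \<le> \<epsilon> * C" using \<epsilon> C0 K0 by (simp add: \<epsilon>'_def field_simps)
      from mult_left_mono[OF this B0] show ?thesis by (simp add: algebra_simps)
    qed
    also have "\<bar>\<Sum>j\<le>n. d j * ?I j\<bar> \<le> (\<Sum>j\<le>n. \<bar>d j\<bar> * \<bar>?I j\<bar>)"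
      by (rule order_trans[OF sum_abs]) (simp add: abs_mult)
    also have "(\<Sum>j\<le>n. \<bar>d j\<bar> * \<bar>?I j\<bar>) = (\<Sum>j\<le>n. \<bar>d j / C\<bar> * \<bar>?I j\<bar>) * C"
      using C0 by (simp add: sum_distrib_right)
    finally have "\<bar>f t0\<bar> * C \<le> (\<eta> + (\<Sum>j\<le>n. \<bar>d j / C\<bar> * \<bar>?I j\<bar>) + \<epsilon> * B) * C"
      by (simp add: algebra_simps)
    then show "\<bar>f t0\<bar> \<le> \<eta> + (\<Sum>j\<le>n. \<bar>d j / C\<bar> * \<bar>?I j\<bar>) + \<epsilon> * B"
      using C0 by simp
  qed
qed

text \<open>All transform terms of the point estimate vanish; what remains is the oscillation of
  \<open>F\<close> near \<open>t\<close> and an arbitrarily small multiple of \<open>B\<close>. The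
  exponents 1, 2, ... suffice, as in Lerch's theorem.\<close>

lemma bounded_laplace_eq_0:
  fixes F :: "real \<Rightarrow> real"
  assumes F: "continuous_on {0..} F" and B: "\<And>t. 0 \<le> t \<Longrightarrow> \<bar>F t\<bar> \<le> B"
    and lt: "\<And>j::nat. (LINT t:{0..}|lborel. exp (- (1 + real j) * t) * F t) = 0"
    and t: "0 < t"
  shows "F t = 0"
proof -
  have B0: "0 \<le> B" using B[of 0] by simp
  have "\<bar>F t\<bar> \<le> e" if e: "0 < e" for e
  proof -
    have "isCont F t"
      using F t by (auto intro: continuous_on_interior)
    then obtain d where d: "0 < d" "\<And>s. \<bar>s - t\<bar> < d \<Longrightarrow> \<bar>F s - F t\<bar> < e / 2"
      using e unfolding continuous_at_eps_delta dist_real_def by (meson half_gt_zero)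
    define \<delta> where "\<delta> = min d t / 2"
    have \<delta>: "0 < \<delta>" "\<delta> < t" "\<delta> < d" using d t by (auto simp: \<delta>_def)
    have \<epsilon>: "0 < e / (2 * (B + 1))" using e B0 by simp
    have BF: "\<bar>F s\<bar> \<le> B * (1 + s)" if "0 \<le> s" for s
      using B[OF that] mult_left_mono[of 1 "1 + s" B] B0 that by simp
    show ?thesis
    proof (rule laplace_point_estimate[OF \<delta>(1,2) \<epsilon>])
      fix c :: "nat \<Rightarrow> real" and n
      assume *: "\<And>f B' \<eta>. continuous_on {0..} f \<Longrightarrow> (\<And>t. 0 \<le> t \<Longrightarrow> \<bar>f t\<bar> \<le> B' * (1 + t)) \<Longrightarrow>
         (\<And>s. \<bar>s - t\<bar> \<le> \<delta> \<Longrightarrow> \<bar>f s - f t\<bar> \<le> \<eta>) \<Longrightarrow>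
         \<bar>f t\<bar> \<le> \<eta> + (\<Sum>j\<le>n. \<bar>c j\<bar> * \<bar>LINT t:{0..}|lborel. exp (- (1 + real j) * t) * f t\<bar>)
           + e / (2 * (B + 1)) * B'"
      have "\<bar>F t\<bar> \<le> e / 2 + (\<Sum>j\<le>n. \<bar>c j\<bar> * \<bar>LINT t:{0..}|lborel. exp (- (1 + real j) * t) * F t\<bar>)
           + e / (2 * (B + 1)) * B"
        using d(2) \<delta>(3) by (intro *[OF F BF]) (auto intro: less_imp_le)
      also have "\<dots> = e / 2 + e / (2 * (B + 1)) * B" unfolding lt by simp
      also have "\<dots> \<le> e" using e B0 by (simp add: field_simps)
      finally show ?thesis .
    qed
  qed
  then show ?thesis using field_le_epsilon[of "\<bar>F t\<bar>" 0] by auto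
qed

text \<open>Gauge integrability over a half-line does not include absolute integrability, so
  dominated convergence is not at hand. The limit is read off from the definition by large boxes:
  their lower end lies below \<open>a\<close>, so that only the upper end cuts.\<close>

lemma has_integral_atLeast_imp_tendsto:
  fixes f :: "real \<Rightarrow> real"
  assumes "(f has_integral I) {a..}"
  shows "((\<lambda>T. integral {a..T} f) \<longlongrightarrow> I) at_top"
proof (rule tendstoI)
  fix e :: real assume "0 < e"
  with iffD1[OF has_integral' assms] obtain B where B: "0 < B" "\<And>c d. ball 0 B \<subseteq> cbox c d \<Longrightarrow>
      \<exists>z. ((\<lambda>x. if x \<in> {a..} then f x else 0) has_integral z) (cbox c d) \<and> norm (z - I) < e"
    by meson
  show "eventually (\<lambda>T. dist (integral {a..T} f) I < e) at_top"
    using eventually_ge_at_top[of "max B a"]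
  proof eventually_elim
    case (elim T)
    have "ball 0 B \<subseteq> cbox (min (-B) a) T" using elim by (auto simp: dist_real_def)
    from B(2)[OF this] obtain z where z:
      "((\<lambda>x. if x \<in> {a..} then f x else 0) has_integral z) {min (-B) a..T}" "norm (z - I) < e"
      by auto
    have "(f has_integral z) ({a..} \<inter> {min (-B) a..T})"
      using z(1) by (simp only: has_integral_restrict_Int)
    moreover have "{a..} \<inter> {min (-B) a..T} = {a..T}" by auto
    ultimately have "integral {a..T} f = z" by (auto intro: integral_unique)
    with z(2) show ?case by (simp add: dist_norm)
  qed
qed

text \<open>The transforms of \<open>f\<close> are merely gauge integrals and its growth is unknown.
  The primitive \<open>F\<close> of \<open>exp (- 1 * s) * f s\<close> is continuous and tends to 0
  by the hypothesis at \<alpha> = 1, hence is bounded, and integration by parts shows that its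
  transforms vanish too. So \<open>F\<close> is 0, and differentiation gives the claim for
  \<open>f\<close>.\<close>

lemma laplace_eq_0:
  fixes f :: "real \<Rightarrow> real"
  assumes f: "continuous_on {0..} f"
    and lt: "\<And>\<alpha>. 0 < \<alpha> \<Longrightarrow> ((\<lambda>t. exp (- \<alpha> * t) * f t) has_integral 0) {0..}"
    and t: "0 \<le> t"
  shows "f t = 0"
proof -
  define g where "g s = exp (- 1 * s) * f s" for s
  define F where "F T = integral {0..T} g" for T
  have g: "continuous_on {0..} g" unfolding g_def by (intro continuous_intros f)
  have gT: "continuous_on {0..T} g" for T by (rule continuous_on_subset[OF g]) auto
  have F_deriv: "(F has_real_derivative g s) (at s within {0..T})" if "s \<in> {0..T}" for s T
    unfolding F_def has_real_derivative_iff_has_vector_derivative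
    by (rule integral_has_vector_derivative[OF gT that])
  have F_contT: "continuous_on {0..T} F" for T
    unfolding continuous_on_eq_continuous_within by (blast intro: DERIV_continuous F_deriv)
  have F_cont: "continuous_on {0..} F"
    unfolding continuous_on_eq_continuous_within
  proof
    fix s :: real assume s: "s \<in> {0..}"
    have "continuous (at s within {0..s + 1}) F"
      using F_contT[of "s + 1"] s by (auto simp: continuous_on_eq_continuous_within)
    moreover have "at s within {0..s + 1} = at s within {0..}"
      using s by (intro at_within_nhd[of s "{..<s+1}"]) auto
    ultimately show "continuous (at s within {0..}) F" by simp
  qed
  have F_lim: "(F \<longlongrightarrow> 0) at_top"
    unfolding F_def g_def by (rule has_integral_atLeast_imp_tendsto[OF lt]) simp
  obtain B where B: "\<And>s. 0 \<le> s \<Longrightarrow> \<bar>F s\<bar> \<le> B"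
  proof -
    have "eventually (\<lambda>T. \<bar>F T\<bar> < 1) at_top"
      using tendstoD[OF F_lim, of 1] by (simp add: dist_real_def)
    then obtain T where T: "\<And>s. T \<le> s \<Longrightarrow> \<bar>F s\<bar> < 1" by (auto simp: eventually_at_top_linorder)
    have "bounded (F ` {0..T})"
      by (intro compact_imp_bounded compact_continuous_image F_contT) auto
    then obtain b where b: "\<And>s. s \<in> {0..T} \<Longrightarrow> \<bar>F s\<bar> \<le> b"
      unfolding bounded_iff real_norm_def by blast
    have "\<bar>F s\<bar> \<le> max b 1" if "0 \<le> s" for s
      using b[of s] T[of s] that by (cases "s \<le> T") auto
    then show ?thesis by (rule that)
  qed
  have B0: "0 \<le> B" using B[of 0] by simp
  have F_lt: "(LINT s:{0..}|lborel. exp (- (1 + real j) * s) * F s) = 0" for j :: nat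
  proof -
    define \<beta> where "\<beta> = 1 + real j"
    have \<beta>: "0 < \<beta>" by (simp add: \<beta>_def)
    have BF: "\<bar>F s\<bar> \<le> B * (1 + s)" if "0 \<le> s" for s
      using B[OF that] mult_left_mono[of 1 "1 + s" B] B0 that by simp
    have int: "set_integrable lborel {0..} (\<lambda>s. exp (- \<beta> * s) * F s)"
      by (rule set_integrable_laplace[OF \<beta> F_cont BF])
    have hi: "((\<lambda>s. exp (- \<beta> * s) * F s) has_integral (LINT s:{0..}|lborel. exp (- \<beta> * s) * F s)) {0..}"
      using set_borel_integral_eq_integral[OF int] by (simp add: has_integral_iff)
    have lim1: "((\<lambda>T. integral {0..T} (\<lambda>s. exp (- \<beta> * s) * F s))
        \<longlongrightarrow> (LINT s:{0..}|lborel. exp (- \<beta> * s) * F s)) at_top"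
      by (rule has_integral_atLeast_imp_tendsto[OF hi])
    have parts: "integral {0..T} (\<lambda>s. exp (- \<beta> * s) * F s)
        = (integral {0..T} (\<lambda>s. exp (- (\<beta> + 1) * s) * f s) - exp (- \<beta> * T) * F T) / \<beta>"
      if T: "0 \<le> T" for T
    proof -
      have "((\<lambda>s. exp (- \<beta> * s) * g s + (- \<beta> * exp (- \<beta> * s)) * F s) has_integral
          (exp (- \<beta> * T) * F T - exp (- \<beta> * 0) * F 0)) {0..T}"
      proof (rule fundamental_theorem_of_calculus[OF T], fold has_real_derivative_iff_has_vector_derivative)
        fix s assume s: "s \<in> {0..T}"
        have "((\<lambda>s. exp (- \<beta> * s)) has_real_derivative - \<beta> * exp (- \<beta> * s)) (at s within {0..T})"
          by (auto intro!: derivative_eq_intros)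
        from DERIV_mult[OF this F_deriv[OF s]]
        show "((\<lambda>s. exp (- \<beta> * s) * F s) has_real_derivative
            exp (- \<beta> * s) * g s + (- \<beta> * exp (- \<beta> * s)) * F s) (at s within {0..T})"
          by (simp add: algebra_simps)
      qed
      moreover have "F 0 = 0" by (simp add: F_def)
      moreover have i1: "(\<lambda>s. exp (- \<beta> * s) * g s) integrable_on {0..T}"
        by (intro integrable_continuous_real continuous_intros gT)
      moreover have i2: "(\<lambda>s. (- \<beta> * exp (- \<beta> * s)) * F s) integrable_on {0..T}"
        by (intro integrable_continuous_real continuous_intros F_contT)
      ultimately have "integral {0..T} (\<lambda>s. exp (- \<beta> * s) * g s)
          + integral {0..T} (\<lambda>s. (- \<beta> * exp (- \<beta> * s)) * F s) = exp (- \<beta> * T) * F T"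
        by (subst integral_add[OF i1 i2, symmetric]) (auto dest: integral_unique)
      moreover have "integral {0..T} (\<lambda>s. (- \<beta> * exp (- \<beta> * s)) * F s)
          = - \<beta> * integral {0..T} (\<lambda>s. exp (- \<beta> * s) * F s)"
        by (simp only: mult.assoc integral_mult_right)
      moreover have "(\<lambda>s. exp (- \<beta> * s) * g s) = (\<lambda>s. exp (- (\<beta> + 1) * s) * f s)"
        by (auto simp: g_def exp_add[symmetric] algebra_simps)
      ultimately show ?thesis using \<beta> by (simp add: field_simps)
    qed
    have "((\<lambda>T. (integral {0..T} (\<lambda>s. exp (- (\<beta> + 1) * s) * f s) - exp (- \<beta> * T) * F T) / \<beta>)
        \<longlongrightarrow> (0 - 0 * 0) / \<beta>) at_top"
    proof (intro tendsto_intros F_lim)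
      show "((\<lambda>T. integral {0..T} (\<lambda>s. exp (- (\<beta> + 1) * s) * f s)) \<longlongrightarrow> 0) at_top"
        using \<beta> by (intro has_integral_atLeast_imp_tendsto lt) auto
      show "((\<lambda>T. exp (- \<beta> * T)) \<longlongrightarrow> 0) at_top" using \<beta> by real_asymp
    qed (use \<beta> in auto)
    moreover have "eventually (\<lambda>T. (integral {0..T} (\<lambda>s. exp (- (\<beta> + 1) * s) * f s) - exp (- \<beta> * T) * F T) / \<beta>
        = integral {0..T} (\<lambda>s. exp (- \<beta> * s) * F s)) at_top"
      using eventually_ge_at_top[of 0] by eventually_elim (simp only: parts)
    ultimately have "((\<lambda>T. integral {0..T} (\<lambda>s. exp (- \<beta> * s) * F s)) \<longlongrightarrow> (0 - 0 * 0) / \<beta>) at_top"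
      by (rule Lim_transform_eventually)
    then have "((\<lambda>T. integral {0..T} (\<lambda>s. exp (- \<beta> * s) * F s)) \<longlongrightarrow> 0) at_top" by simp
    from tendsto_unique[OF _ lim1 this] show ?thesis by (simp add: \<beta>_def)
  qed
  have F0: "F s = 0" if "0 \<le> s" for s
  proof (cases "s = 0")
    case False with that show ?thesis
      by (intro bounded_laplace_eq_0[OF F_cont B F_lt]) auto
  qed (simp add: F_def)
  \<comment> \<open>The interval extends beyond \<open>t\<close>, so that at t = 0 the derivative is
    one-sided and still unique.\<close>
  have "((\<lambda>_. 0) has_real_derivative g t) (at t within {0..t + 1})"
    by (rule has_field_derivative_transform_within[OF F_deriv, of _ _ 1]) (use t F0 in auto)
  moreover have "((\<lambda>_. 0) has_real_derivative 0) (at t within {0..t + 1})" by simp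
  moreover have "at t within {0..t + 1} \<noteq> bot"
    using t by (simp add: trivial_limit_within islimpt_Icc)
  ultimately have "g t = 0"
    unfolding has_real_derivative_iff_has_vector_derivative by (rule vector_derivative_unique_within[rotated])
  then show ?thesis by (simp add: g_def)
qed

section \<open>Time change along a path\<close>

definition time_inverse :: "(ennreal \<Rightarrow> ennreal) \<Rightarrow> ennreal \<Rightarrow> ennreal" where
  "time_inverse a r = Inf {s. r < a s}"

text \<open>A cell is the interval of operational time between the clock readings at two consecutive
  grid times; the \<open>k * k\<close> cells of mesh 1/k cover real time up to \<open>k\<close>.
  Sampling at the right end serves twice: \<open>h\<close> is only right-continuous, and both clock
  readings of the cell are known at that time.\<close>

definition grid_step :: "(ennreal \<Rightarrow> real) \<Rightarrow> (ennreal \<Rightarrow> ennreal) \<Rightarrow> nat \<Rightarrow> real \<Rightarrow> real" where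
  "grid_step h a k r = (\<Sum>i<k*k. h (ennreal (real (Suc i) / real k)) *
     indicator {enn2real (a (ennreal (real i / real k)))..<enn2real (a (ennreal (real (Suc i) / real k)))} r)"

definition right_cont :: "(ennreal \<Rightarrow> real) \<Rightarrow> bool" where
  "right_cont h \<longleftrightarrow> (\<forall>t<\<infinity>. continuous (at_right t) h)"

text \<open>The sequence may hit \<open>t\<close>, whereas \<open>at_right t\<close> sees only
  larger points. The filter of \<open>{t..}\<close> at \<open>t\<close> is the same, because
  \<open>at\<close> always removes the point itself.\<close>

lemma right_cont_tendsto:
  assumes h: "right_cont h" and t: "t < \<infinity>" and s: "s \<longlonglongrightarrow> t" and ge: "\<And>k::nat. t \<le> s k"
  shows "(\<lambda>k. h (s k)) \<longlonglongrightarrow> h t"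
proof -
  have "at t within {t..} = at_right t"
    unfolding at_within_def by (rule arg_cong[where f = "\<lambda>S. inf (nhds t) (principal S)"]) auto
  then have "continuous (at t within {t..}) h"
    using h t by (simp add: right_cont_def)
  then show ?thesis
    by (rule continuous_within_tendsto_compose) (use s ge in auto)
qed

locale clock =
  fixes a :: "ennreal \<Rightarrow> ennreal"
  assumes a_0: "a 0 = 0" and a_mono: "mono a" and a_cont: "continuous_on UNIV a"
begin

text \<open>This equivalence is the working form of the inverse. Strictness on the left comes from
  continuity of the clock: the set where it exceeds \<open>r\<close> is open and thus contains a
  time before \<open>s\<close>, the case s = 0 being ruled out by \<open>a_0\<close>.\<close>

lemma time_inverse_less_iff: "time_inverse a r < s \<longleftrightarrow> r < a s"
proof
  assume "time_inverse a r < s"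
  then obtain s' where "r < a s'" "s' < s" by (auto simp: time_inverse_def Inf_less_iff)
  then show "r < a s" using monoD[OF a_mono, of s' s] by (auto intro: less_le_trans)
next
  assume r: "r < a s"
  have "s \<noteq> 0" using r a_0 by auto
  have "open {s. r < a s}"
    using open_vimage[OF open_greaterThan a_cont, of r] by (simp add: vimage_def)
  moreover have "0 < s" using \<open>s \<noteq> 0\<close> by (simp add: zero_less_iff_neq_zero)
  ultimately obtain b where b: "b < s" "{b<..s} \<subseteq> {s. r < a s}"
    using open_left[of "{s. r < a s}" s 0] r by blast
  then obtain s' where "b < s'" "s' < s" using dense by blast
  with b have "s' \<in> {s. r < a s}" by (intro subsetD[OF b(2)]) auto
  then have "r < a s'" "s' < s" using \<open>s' < s\<close> by auto
  then show "time_inverse a r < s"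
    by (auto simp: time_inverse_def Inf_less_iff)
qed

lemma clock_time_inverse_le: "a (time_inverse a r) \<le> r"
  using time_inverse_less_iff[of r "time_inverse a r"] by auto

lemma time_inverse_eq_top: "a \<infinity> \<le> r \<Longrightarrow> time_inverse a r = \<infinity>"
  using time_inverse_less_iff[of r \<infinity>] by (metis infinity_ennreal_def leD less_top)

lemma clock_le: "a s \<le> a \<infinity>"
  using a_mono by (auto simp: mono_def)

lemma tendsto_clock: "s \<longlonglongrightarrow> t \<Longrightarrow> (\<lambda>k::nat. a (s k)) \<longlonglongrightarrow> a t"
  using continuous_on_tendsto_compose[OF a_cont, of s t sequentially] by auto

lemma time_inverse_less_top:
  assumes "r < a \<infinity>"
  shows "time_inverse a r < \<infinity>"
proof -
  have "(\<lambda>n. a (of_nat n)) \<longlonglongrightarrow> a \<infinity>"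
    by (intro tendsto_clock) (simp add: of_nat_tendsto_top_ennreal)
  then have "eventually (\<lambda>n. r < a (of_nat n)) sequentially"
    using assms by (rule order_tendstoD)
  then obtain n where "r < a (of_nat n)" by (auto dest: eventually_happens)
  then have "time_inverse a r < of_nat n" by (simp add: time_inverse_less_iff)
  then show ?thesis by (auto intro: less_trans simp: of_nat_less_top)
qed

text \<open>The clock does not jump over \<open>r\<close>: just after the inverse time it is at
  least \<open>r\<close>, and continuity hands this down to the inverse time itself.\<close>

lemma clock_time_inverse:
  assumes "r < a \<infinity>"
  shows "a (time_inverse a r) = r"
proof (rule antisym[OF clock_time_inverse_le])
  obtain t where t: "time_inverse a r = ennreal t" "0 \<le> t"
    using time_inverse_less_top[OF assms] by (auto simp: less_top_ennreal)
  have "(\<lambda>n. a (ennreal (t + 1 / real (Suc n)))) \<longlonglongrightarrow> a (ennreal t)"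
  proof (intro tendsto_clock tendsto_ennrealI)
    show "(\<lambda>n. t + 1 / real (Suc n)) \<longlonglongrightarrow> t" by real_asymp
  qed
  moreover have "r \<le> a (ennreal (t + 1 / real (Suc n)))" for n
  proof -
    have "time_inverse a r < ennreal (t + 1 / real (Suc n))"
      using t by (simp add: ennreal_less_iff)
    then show ?thesis by (simp add: time_inverse_less_iff less_imp_le)
  qed
  ultimately show "r \<le> a (time_inverse a r)"
    unfolding t by (intro LIMSEQ_le_const) auto
qed

end

locale finite_clock = clock +
  assumes a_fin: "a \<infinity> < \<infinity>"
begin

lemma clock_finite: "a s < \<infinity>"
  using clock_le[of s] a_fin by simp

lemma clock_eq: "a s = ennreal (enn2real (a s))"
  using clock_finite[of s] by simp

lemma clock_real_mono: "s \<le> t \<Longrightarrow> enn2real (a s) \<le> enn2real (a t)"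
  using monoD[OF a_mono, of s t] clock_finite[of t] by (intro enn2real_mono) auto

lemma clock_le_iff: "0 \<le> r \<Longrightarrow> enn2real (a s) \<le> r \<longleftrightarrow> \<not> time_inverse a (ennreal r) < s"
  unfolding time_inverse_less_iff by (subst clock_eq) (simp add: ennreal_less_iff not_less del: ennreal_enn2real_if)

lemma less_clock_iff: "0 \<le> r \<Longrightarrow> r < enn2real (a s) \<longleftrightarrow> time_inverse a (ennreal r) < s"
  using clock_le_iff[of r s] by auto

text \<open>With \<open>t\<close> the inverse time of \<open>r\<close>, membership in a cell of
  operational time turns into i/k <= t < (i+1)/k. So there is a single candidate, the index floor (k
  t), whatever flat pieces the clock has.\<close>

lemma indicator_clock_eq:
  assumes "0 \<le> r" "time_inverse a (ennreal r) = ennreal t" "0 \<le> t" "0 < k"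
  shows "indicator {enn2real (a (ennreal (real i / real k)))..<enn2real (a (ennreal (real (Suc i) / real k)))} r
    = (if i = nat \<lfloor>real k * t\<rfloor> then 1 else (0::real))"
proof -
  have "enn2real (a (ennreal (real i / real k))) \<le> r \<longleftrightarrow> real i / real k \<le> t"
    using assms by (simp add: clock_le_iff ennreal_less_iff not_less)
  moreover have "r < enn2real (a (ennreal (real (Suc i) / real k))) \<longleftrightarrow> t < real (Suc i) / real k"
    using assms by (simp only: less_clock_iff) (simp add: ennreal_less_iff)
  moreover have "real i / real k \<le> t \<and> t < real (Suc i) / real k \<longleftrightarrow> i = nat \<lfloor>real k * t\<rfloor>"
  proof -
    have "real i / real k \<le> t \<and> t < real (Suc i) / real k \<longleftrightarrow> real i \<le> real k * t \<and> real k * t < real i + 1"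
      using assms by (simp add: field_simps)
    also have "\<dots> \<longleftrightarrow> \<lfloor>real k * t\<rfloor> = int i"
      by (auto simp: floor_eq_iff)
    also have "\<dots> \<longleftrightarrow> i = nat \<lfloor>real k * t\<rfloor>"
    proof -
      have "0 \<le> \<lfloor>real k * t\<rfloor>" using assms by simp
      then show ?thesis by auto
    qed
    finally show ?thesis .
  qed
  ultimately show ?thesis by (auto simp: indicator_def)
qed

lemma grid_step_eq_0: "enn2real (a \<infinity>) \<le> r \<Longrightarrow> grid_step h a k r = 0"
  unfolding grid_step_def
proof (intro sum.neutral ballI)
  fix i assume "enn2real (a \<infinity>) \<le> r"
  then have "enn2real (a (ennreal (real (Suc i) / real k))) \<le> r"
    using clock_real_mono[of "ennreal (real (Suc i) / real k)" \<infinity>] by simp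
  then show "h (ennreal (real (Suc i) / real k)) * indicator {enn2real (a (ennreal (real i / real k)))..<
      enn2real (a (ennreal (real (Suc i) / real k)))} r = 0"
    by (simp del: of_nat_Suc)
qed

lemma grid_step_eq:
  assumes r: "0 \<le> r" "time_inverse a (ennreal r) = ennreal t" "0 \<le> t" "0 < k"
  shows "grid_step h a k r = (if nat \<lfloor>real k * t\<rfloor> < k * k
    then h (ennreal (real (Suc (nat \<lfloor>real k * t\<rfloor>)) / real k)) else 0)"
  unfolding grid_step_def indicator_clock_eq[OF r]
  by (simp add: if_distrib[where f = "\<lambda>y. _ * y"] sum.delta' del: of_nat_Suc cong: if_cong)

lemma time_inverse_cases:
  assumes "0 \<le> r"
  obtains (dead) "enn2real (a \<infinity>) \<le> r" "time_inverse a (ennreal r) = \<infinity>"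
  | (alive) t where "r < enn2real (a \<infinity>)" "time_inverse a (ennreal r) = ennreal t" "0 \<le> t"
proof (cases "enn2real (a \<infinity>) \<le> r")
  case True
  then have "a \<infinity> \<le> ennreal r"
    by (subst clock_eq) (simp add: ennreal_leI del: ennreal_enn2real_if)
  then show ?thesis using dead True time_inverse_eq_top by blast
next
  case False
  then have "ennreal r < a \<infinity>" using assms
    by (subst clock_eq) (simp add: ennreal_less_iff del: ennreal_enn2real_if)
  from time_inverse_less_top[OF this] show ?thesis using alive False
    by (auto simp: less_top_ennreal)
qed

lemma grid_step_bound:
  assumes r: "0 \<le> r" and B: "\<And>t. \<bar>h t\<bar> \<le> B"
  shows "\<bar>grid_step h a k r\<bar> \<le> B * indicator {0..<enn2real (a \<infinity>)} r"
proof -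
  have B0: "0 \<le> B" using B[of 0] by simp
  from r show ?thesis
  proof (cases r rule: time_inverse_cases)
    case dead then show ?thesis using grid_step_eq_0[of r h k] by simp
  next
    case (alive t)
    show ?thesis
    proof (cases "k = 0")
      case True then show ?thesis using B0 by (simp add: grid_step_def)
    next
      case False
      then show ?thesis using grid_step_eq[OF r alive(2,3), of k h] B B0 alive(1) r by auto
    qed
  qed
qed

lemma grid_step_tendsto:
  assumes h: "right_cont h" "h \<infinity> = 0" and r: "0 \<le> r"
  shows "(\<lambda>k. grid_step h a k r) \<longlonglongrightarrow> h (time_inverse a (ennreal r))"
  using r
proof (cases r rule: time_inverse_cases)
  case dead then show ?thesis using grid_step_eq_0[of r h] h by simp
next
  case (alive t)
  \<comment> \<open>The index is \<open>Suc k\<close> to keep the mesh positive. The sampled times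
    lie between t and t + 1/(k+1), so right-continuity is enough.\<close>
  define s where "s k = real (Suc (nat \<lfloor>real (Suc k) * t\<rfloor>)) / real (Suc k)" for k
  have s_gt: "t \<le> s k" for k
  proof -
    have "real (Suc k) * t \<le> real (Suc (nat \<lfloor>real (Suc k) * t\<rfloor>))" by linarith
    then show ?thesis unfolding s_def by (simp add: pos_le_divide_eq mult.commute del: of_nat_Suc)
  qed
  have s_le: "s k \<le> t + 1 / real (Suc k)" for k
  proof -
    have "0 \<le> real (Suc k) * t" using alive by simp
    then have "real (Suc (nat \<lfloor>real (Suc k) * t\<rfloor>)) \<le> real (Suc k) * t + 1" by linarith
    then have "s k \<le> (real (Suc k) * t + 1) / real (Suc k)"
      unfolding s_def by (intro divide_right_mono) auto
    then show ?thesis by (simp add: add_divide_distrib)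
  qed
  have "s \<longlonglongrightarrow> t"
  proof (rule tendsto_sandwich[OF _ _ tendsto_const])
    show "(\<lambda>k. t + 1 / real (Suc k)) \<longlonglongrightarrow> t" by real_asymp
  qed (use s_gt s_le in auto)
  then have "(\<lambda>k. h (ennreal (s k))) \<longlonglongrightarrow> h (ennreal t)"
    using s_gt by (intro right_cont_tendsto[OF h(1)] tendsto_ennrealI) (auto intro: ennreal_leI)
  \<comment> \<open>The step function sees real time only up to \<open>Suc k\<close>; the finite
    inverse time falls within this range from some index on.\<close>
  moreover have "eventually (\<lambda>k. h (ennreal (s k)) = grid_step h a (Suc k) r) sequentially"
  proof -
    obtain N where N: "t < real N" using reals_Archimedean2 by blast
    show ?thesis using eventually_ge_at_top[of N]
    proof eventually_elim
      case (elim k)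
      have "real (Suc k) * t < real (Suc k) * real (Suc k)"
        using N elim by (intro mult_strict_left_mono) auto
      then have "nat \<lfloor>real (Suc k) * t\<rfloor> < Suc k * Suc k"
        using alive by (simp add: nat_less_iff floor_less_iff del: of_nat_Suc mult_Suc mult_Suc_right)
      then show ?case using grid_step_eq[OF r alive(2,3), of "Suc k" h] by (simp add: s_def)
    qed
  qed
  ultimately have "(\<lambda>k. grid_step h a (Suc k) r) \<longlonglongrightarrow> h (ennreal t)"
    by (rule Lim_transform_eventually)
  then show ?thesis unfolding alive(2) by (simp only: filterlim_sequentially_Suc[of "\<lambda>k. grid_step h a k r"])
qed

lemma borel_measurable_grid_step [measurable]: "grid_step h a k \<in> borel_measurable borel"
  unfolding grid_step_def by measurable

lemma borel_measurable_time_change: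
  assumes h: "right_cont h" "h \<infinity> = 0"
  shows "(\<lambda>r. indicator {0..} r * h (time_inverse a (ennreal r))) \<in> borel_measurable borel"
proof (rule borel_measurable_LIMSEQ_real)
  fix r :: real
  show "(\<lambda>k. indicator {0..} r * grid_step h a k r) \<longlonglongrightarrow> indicator {0..} r * h (time_inverse a (ennreal r))"
    using grid_step_tendsto[OF h, of r] by (cases "0 \<le> r") (auto intro: tendsto_mult)
qed measurable

lemma time_change_bound:
  fixes h :: "ennreal \<Rightarrow> real"
  assumes h: "h \<infinity> = 0" "\<And>t. \<bar>h t\<bar> \<le> B" and r: "0 \<le> r"
  shows "\<bar>h (time_inverse a (ennreal r))\<bar> \<le> B * indicator {0..<enn2real (a \<infinity>)} r"
  using r
proof (cases r rule: time_inverse_cases)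
  case dead then show ?thesis using h(1) order_trans[OF abs_ge_zero h(2)[of 0]] by simp
next
  case (alive t) then show ?thesis using h(2) r by simp
qed

lemma
  assumes h: "right_cont h" "h \<infinity> = 0" "\<And>t. \<bar>h t\<bar> \<le> B"
    and w: "w \<in> borel_measurable borel" "\<And>r. 0 \<le> r \<Longrightarrow> \<bar>w r\<bar> \<le> C"
  shows set_integrable_time_change: "set_integrable lborel {0..} (\<lambda>r. w r * h (time_inverse a (ennreal r)))"
    and integral_grid_step_tendsto: "(\<lambda>k. LINT r:{0..}|lborel. w r * grid_step h a k r)
      \<longlonglongrightarrow> (LINT r:{0..}|lborel. w r * h (time_inverse a (ennreal r)))"
    and integral_grid_step_bound: "\<bar>LINT r:{0..}|lborel. w r * grid_step h a k r\<bar> \<le> C * B * enn2real (a \<infinity>)"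
proof -
  have [measurable]: "w \<in> borel_measurable borel" by fact
  have [measurable]: "(\<lambda>r. indicator {0..} r * h (time_inverse a (ennreal r))) \<in> borel_measurable borel"
    by (rule borel_measurable_time_change[OF h(1,2)])
  have C0: "0 \<le> C" using w(2)[of 0] by simp
  \<comment> \<open>The majorant is constant on a bounded interval of operational time. Its integral
    is proportional to the total clock, so it can be integrated over paths once the mean total clock
    is finite.\<close>
  define g where "g r = C * B * indicator {0..<enn2real (a \<infinity>)} r" for r :: real
  have g: "integrable lborel g"
    unfolding g_def by (intro integrable_mult_right integrable_real_indicator) auto
  have b1: "norm (indicator {0..} r *\<^sub>R (w r * grid_step h a k r)) \<le> g r" for r k
  proof (cases "0 \<le> r")
    case True then show ?thesis
      using mult_mono[OF w(2)[OF True] grid_step_bound[OF True, of h B k] C0] h(3)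
      by (simp add: abs_mult g_def)
  qed (simp add: g_def)
  have m2: "(\<lambda>r. indicator {0..} r *\<^sub>R (w r * h (time_inverse a (ennreal r)))) \<in> borel_measurable lborel"
  proof -
    have "(\<lambda>r. w r * (indicator {0..} r * h (time_inverse a (ennreal r)))) \<in> borel_measurable lborel"
      by measurable
    then show ?thesis by (simp add: mult.left_commute)
  qed
  have b2: "norm (indicator {0..} r *\<^sub>R (w r * h (time_inverse a (ennreal r)))) \<le> g r" for r
  proof (cases "0 \<le> r")
    case True then show ?thesis
      using mult_mono[OF w(2)[OF True] time_change_bound[of h B r, OF h(2,3) True] C0]
      by (simp add: abs_mult g_def)
  qed (simp add: g_def)
  show "set_integrable lborel {0..} (\<lambda>r. w r * h (time_inverse a (ennreal r)))"
    unfolding set_integrable_def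
    using b2 by (intro Bochner_Integration.integrable_bound[OF g m2] AE_I2) (auto intro: order_trans[OF _ abs_ge_self])
  have i: "set_integrable lborel {0..} (\<lambda>r. w r * grid_step h a k r)" for k
    unfolding set_integrable_def
    using b1[of _ k] by (intro Bochner_Integration.integrable_bound[OF g] AE_I2) (auto intro: order_trans[OF _ abs_ge_self])
  show "(\<lambda>k. LINT r:{0..}|lborel. w r * grid_step h a k r)
      \<longlonglongrightarrow> (LINT r:{0..}|lborel. w r * h (time_inverse a (ennreal r)))"
    unfolding set_lebesgue_integral_def
  proof (rule integral_dominated_convergence[OF m2 _ g])
    show "AE r in lborel. (\<lambda>k. indicator {0..} r *\<^sub>R (w r * grid_step h a k r))
        \<longlonglongrightarrow> indicator {0..} r *\<^sub>R (w r * h (time_inverse a (ennreal r)))"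
    proof (rule AE_I2)
      fix r :: real
      show "(\<lambda>k. indicator {0..} r *\<^sub>R (w r * grid_step h a k r))
        \<longlonglongrightarrow> indicator {0..} r *\<^sub>R (w r * h (time_inverse a (ennreal r)))"
        using grid_step_tendsto[OF h(1,2), of r] by (cases "0 \<le> r") (auto intro!: tendsto_intros)
    qed
  qed (use b1 in auto)
  have "\<bar>LINT r:{0..}|lborel. w r * grid_step h a k r\<bar> \<le> (LINT r|lborel. g r)"
    unfolding set_lebesgue_integral_def real_norm_def[symmetric]
    using b1[of _ k] i[of k]
    by (intro Bochner_Integration.integral_norm_bound_integral[OF _ g]) (auto simp: set_integrable_def)
  also have "\<dots> = C * B * enn2real (a \<infinity>)" by (simp add: g_def)
  finally show "\<bar>LINT r:{0..}|lborel. w r * grid_step h a k r\<bar> \<le> C * B * enn2real (a \<infinity>)" .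
qed

end

lemma (in clock) finite_clock_min: "finite_clock (\<lambda>s. min (a s) (of_nat k))"
proof
  show "mono (\<lambda>s. min (a s) (of_nat k))"
    using a_mono by (auto simp: mono_def min_le_iff_disj)
  show "continuous_on UNIV (\<lambda>s. min (a s) (of_nat k))"
    by (intro continuous_intros a_cont)
qed (auto simp: a_0 min_less_iff_disj of_nat_less_top)

section \<open>Stieltjes integrals as integrals over operational time\<close>

lemma grid_ceiling_tendsto:
  fixes t :: real
  assumes "0 \<le> t"
  defines "s \<equiv> \<lambda>k. real (nat \<lceil>real (Suc k) * t\<rceil>) / real (Suc k)"
  shows "s \<longlonglongrightarrow> t" and "t \<le> s k"
proof -
  have ge: "t \<le> s k" for k
  proof -
    have "real (Suc k) * t \<le> real (nat \<lceil>real (Suc k) * t\<rceil>)" by linarith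
    then show ?thesis unfolding s_def by (simp add: pos_le_divide_eq mult.commute del: of_nat_Suc)
  qed
  have le: "s k \<le> t + 1 / real (Suc k)" for k
  proof -
    have "0 \<le> real (Suc k) * t" using assms by simp
    then have "real (nat \<lceil>real (Suc k) * t\<rceil>) \<le> real (Suc k) * t + 1" by linarith
    then have "s k \<le> (real (Suc k) * t + 1) / real (Suc k)"
      unfolding s_def by (intro divide_right_mono) auto
    then show ?thesis by (simp add: add_divide_distrib)
  qed
  show "s \<longlonglongrightarrow> t"
  proof (rule tendsto_sandwich[OF _ _ tendsto_const])
    show "(\<lambda>k. t + 1 / real (Suc k)) \<longlonglongrightarrow> t" by real_asymp
  qed (use ge le in auto)
  show "t \<le> s k" by (rule ge)
qed

lemma indicator_grid_Ioc:
  fixes t :: real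
  assumes "0 < t" "0 < k"
  shows "indicator {real i / real k<..real (Suc i) / real k} t
    = (if i = nat \<lceil>real k * t\<rceil> - 1 then 1 else (0::'b::zero_neq_one))"
proof -
  have "t \<in> {real i / real k<..real (Suc i) / real k} \<longleftrightarrow> real i < real k * t \<and> real k * t \<le> real i + 1"
    using assms by (simp add: field_simps)
  also have "\<dots> \<longleftrightarrow> \<lceil>real k * t\<rceil> = int i + 1"
    by (auto simp: ceiling_eq_iff)
  also have "\<dots> \<longleftrightarrow> i = nat \<lceil>real k * t\<rceil> - 1"
  proof -
    have "0 < \<lceil>real k * t\<rceil>" using assms by simp
    then show ?thesis by linarith
  qed
  finally show ?thesis by (auto simp: indicator_def)
qed

context finite_clock begin

definition dist_fun :: "real \<Rightarrow> real" where
  "dist_fun t = enn2real (a (ennreal t))"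

lemma dist_fun_mono: "s \<le> t \<Longrightarrow> dist_fun s \<le> dist_fun t"
  unfolding dist_fun_def by (intro clock_real_mono ennreal_leI)

lemma dist_fun_cont: "continuous_on UNIV dist_fun"
proof -
  have "continuous_on UNIV (\<lambda>t. a (ennreal t))"
    by (intro continuous_on_compose2[OF a_cont] continuous_on_ennreal continuous_intros) auto
  then have "((\<lambda>t. a (ennreal t)) \<longlongrightarrow> a (ennreal t)) (at t)" for t
    by (auto simp: continuous_on_eq_continuous_at continuous_at)
  then have "((\<lambda>t. enn2real (a (ennreal t))) \<longlongrightarrow> enn2real (a (ennreal t))) (at t)" for t
    using clock_eq[of "ennreal t"] by (intro tendsto_enn2real) auto
  then show ?thesis
    by (simp add: dist_fun_def[abs_def] continuous_on_eq_continuous_at continuous_at)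
qed

lemma emeasure_dist_fun_Ioc:
  "s \<le> t \<Longrightarrow> emeasure (interval_measure dist_fun) {s<..t} = ennreal (dist_fun t - dist_fun s)"
  using dist_fun_cont
  by (intro emeasure_interval_measure_Ioc dist_fun_mono)
     (auto simp: continuous_on_eq_continuous_at continuous_at_imp_continuous_within)

lemma dist_fun_nonpos: "t \<le> 0 \<Longrightarrow> dist_fun t = 0"
  by (simp add: dist_fun_def ennreal_neg a_0)

lemma dist_fun_le: "dist_fun t \<le> enn2real (a \<infinity>)"
  unfolding dist_fun_def by (intro clock_real_mono) auto

lemma dist_fun_nonneg: "0 \<le> dist_fun t" by (simp add: dist_fun_def)

lemma emeasure_dist_fun_UNIV: "emeasure (interval_measure dist_fun) UNIV < \<infinity>"
proof -
  have "(SUP n. emeasure (interval_measure dist_fun) {- real n<..real n})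
      = emeasure (interval_measure dist_fun) (\<Union>n. {- real n<..real n})"
    by (rule SUP_emeasure_incseq) (auto simp: incseq_def)
  also have "(\<Union>n. {- real n<..real n}) = UNIV"
  proof (intro equalityI subsetI)
    fix x :: real
    obtain n where "\<bar>x\<bar> < real n" using reals_Archimedean2 by blast
    then show "x \<in> (\<Union>n. {- real n<..real n})" by (auto simp: abs_less_iff intro!: exI[of _ n])
  qed auto
  finally have "emeasure (interval_measure dist_fun) UNIV
      = (SUP n. emeasure (interval_measure dist_fun) {- real n<..real n})" ..
  also have "\<dots> \<le> ennreal (enn2real (a \<infinity>))"
  proof (intro SUP_least)
    fix n
    have "emeasure (interval_measure dist_fun) {- real n<..real n} = ennreal (dist_fun (real n) - dist_fun (- real n))"
      by (intro emeasure_dist_fun_Ioc) auto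
    also have "\<dots> \<le> ennreal (enn2real (a \<infinity>))"
      using dist_fun_le[of "real n"] dist_fun_nonneg[of "- real n"] by (intro ennreal_leI) linarith
    finally show "emeasure (interval_measure dist_fun) {- real n<..real n} \<le> ennreal (enn2real (a \<infinity>))" .
  qed
  finally show ?thesis by (rule order_le_less_trans) simp
qed

text \<open>Both sides are limits of the same sums, values of \<open>h\<close> at right ends times
  increments of the clock: on the left over cells of real time, on the right over the cells of
  \<open>grid_step\<close>. The cells of real time are left-open because these are the ones whose
  interval measure is a difference of the distribution function.\<close>

lemma nn_integral_interval_measure:
  assumes h: "right_cont h" "h \<infinity> = 0" "\<And>t. 0 \<le> h t" "\<And>t. h t \<le> B"
  shows "(\<integral>\<^sup>+t\<in>{0..}. ennreal (h (ennreal t)) \<partial>interval_measure dist_fun)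
    = (\<integral>\<^sup>+r\<in>{0..}. ennreal (h (time_inverse a (ennreal r))) \<partial>lborel)"
proof -
  let ?\<nu> = "interval_measure dist_fun"
  have hB: "\<bar>h t\<bar> \<le> B" for t using h(3,4)[of t] by simp
  have B0: "0 \<le> B" using h(3,4)[of 0] by linarith
  let ?s = "\<lambda>k i. ennreal (real (Suc i) / real (Suc k))"
  define g where "g k t = (\<Sum>i<Suc k * Suc k. ennreal (h (?s k i)) *
      indicator {real i / real (Suc k)<..real (Suc i) / real (Suc k)} t)" for k t
  have [measurable]: "g k \<in> borel_measurable ?\<nu>" for k
    unfolding g_def by measurable
  have g_eq: "g k t = (if nat \<lceil>real (Suc k) * t\<rceil> - 1 < Suc k * Suc k
      then ennreal (h (ennreal (real (nat \<lceil>real (Suc k) * t\<rceil>) / real (Suc k)))) else 0)" if t: "0 < t" for k t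
  proof -
    have "0 < \<lceil>real (Suc k) * t\<rceil>" using t by (simp del: of_nat_Suc)
    then have "Suc (nat \<lceil>real (Suc k) * t\<rceil> - 1) = nat \<lceil>real (Suc k) * t\<rceil>" by linarith
    then show ?thesis
      unfolding g_def indicator_grid_Ioc[OF t zero_less_Suc]
      by (simp add: if_distrib[where f = "\<lambda>y. _ * y"] sum.delta' del: of_nat_Suc mult_Suc mult_Suc_right cong: if_cong)
  qed
  have g_nonpos: "g k t = 0" if "t \<le> 0" for k t
    unfolding g_def
  proof (intro sum.neutral ballI)
    fix i
    have "\<not> real i / real (Suc k) < t" using that by (meson divide_nonneg_nonneg of_nat_0_le_iff not_less order_trans)
    then show "ennreal (h (?s k i)) * indicator {real i / real (Suc k)<..real (Suc i) / real (Suc k)} t = 0"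
      by (simp del: of_nat_Suc)
  qed
  have g_bound: "g k t \<le> ennreal B" for k t
    using g_eq[of t k] g_nonpos[of t k] h(4) by (cases "0 < t") (auto intro: ennreal_leI)
  have g_lim: "(\<lambda>k. g k t) \<longlonglongrightarrow> ennreal (h (ennreal t)) * indicator {0..} t" if "t \<noteq> 0" for t
  proof (cases "0 < t")
    case False
    then show ?thesis using g_nonpos[of t] that by simp
  next
    case True
    have "(\<lambda>k. ennreal (h (ennreal (real (nat \<lceil>real (Suc k) * t\<rceil>) / real (Suc k))))) \<longlonglongrightarrow> ennreal (h (ennreal t))"
      using grid_ceiling_tendsto[of t] True
      by (intro tendsto_ennrealI right_cont_tendsto[OF h(1)]) (auto intro: ennreal_leI simp del: of_nat_Suc)
    moreover have "eventually (\<lambda>k. ennreal (h (ennreal (real (nat \<lceil>real (Suc k) * t\<rceil>) / real (Suc k)))) = g k t) sequentially"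
    proof -
      obtain N where N: "t < real N" using reals_Archimedean2 by blast
      show ?thesis using eventually_ge_at_top[of N]
      proof eventually_elim
        case (elim k)
        have "real (Suc k) * t \<le> real (Suc k) * real (Suc k)"
          using N elim by (intro mult_left_mono) auto
        then have "nat \<lceil>real (Suc k) * t\<rceil> \<le> Suc k * Suc k"
          by (simp add: nat_le_iff ceiling_le_iff del: of_nat_Suc mult_Suc mult_Suc_right)
        moreover have "0 < Suc k * Suc k" by simp
        ultimately have "nat \<lceil>real (Suc k) * t\<rceil> - 1 < Suc k * Suc k" by linarith
        then show ?case using g_eq[OF True, of k] by (simp del: of_nat_Suc mult_Suc mult_Suc_right)
      qed
    qed
    ultimately show ?thesis using True by (auto intro: Lim_transform_eventually)
  qed
  \<comment> \<open>At t = 0 the approximations vanish while the limit should be \<open>h 0\<close>;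
    a continuous clock puts no mass there.\<close>
  have null0: "AE t in ?\<nu>. t \<noteq> 0"
  proof -
    have "emeasure ?\<nu> {0} \<le> emeasure ?\<nu> {-1<..0}" by (intro emeasure_mono) auto
    also have "\<dots> = 0" by (subst emeasure_dist_fun_Ioc) (auto simp: dist_fun_nonpos)
    finally show ?thesis by (intro AE_I[of _ _ "{0}"]) auto
  qed
  have "(\<lambda>k. \<integral>\<^sup>+t. g k t \<partial>?\<nu>) \<longlonglongrightarrow> (\<integral>\<^sup>+t. ennreal (h (ennreal t)) * indicator {0..} t \<partial>?\<nu>)"
  proof (rule nn_integral_dominated_convergence[where w = "\<lambda>_. ennreal B"])
    \<comment> \<open>Pointwise convergence may fail at 0 only, so measurability is obtained for the
      modification \<open>q\<close> and carried over by changing a single value.\<close>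
    define q where "q t = (if t = 0 then 0 else ennreal (h (ennreal t)) * indicator {0..} t)" for t :: real
    have [measurable]: "q \<in> borel_measurable borel"
    proof (rule borel_measurable_LIMSEQ_order)
      fix t :: real
      show "(\<lambda>k. g k t) \<longlonglongrightarrow> q t"
        using g_lim[of t] g_nonpos[of t] by (cases "t = 0") (auto simp: q_def)
      show "(\<lambda>t. g k t) \<in> borel_measurable borel" for k
        unfolding g_def by measurable
    qed
    have "(\<lambda>t. if t = 0 then ennreal (h 0) else q t) \<in> borel_measurable borel"
      by measurable
    also have "(\<lambda>t. if t = 0 then ennreal (h 0) else q t) = (\<lambda>t. ennreal (h (ennreal t)) * indicator {0..} t)"
      by (auto simp: q_def)
    finally show "(\<lambda>t. ennreal (h (ennreal t)) * indicator {0..} t) \<in> borel_measurable ?\<nu>" by simp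
    show "(\<integral>\<^sup>+ t. ennreal B \<partial>?\<nu>) < \<infinity>"
      using emeasure_dist_fun_UNIV by (simp add: ennreal_mult_less_top)
    show "AE t in ?\<nu>. (\<lambda>k. g k t) \<longlonglongrightarrow> ennreal (h (ennreal t)) * indicator {0..} t"
      using null0 by eventually_elim (rule g_lim)
  qed (use g_bound in auto)
  moreover have "(\<integral>\<^sup>+t. g k t \<partial>?\<nu>) = (\<integral>\<^sup>+r\<in>{0..}. ennreal (grid_step h a (Suc k) r) \<partial>lborel)" for k
  proof -
    let ?b = "\<lambda>i. dist_fun (real i / real (Suc k))"
    have b_mono: "?b i \<le> ?b (Suc i)" for i
      by (intro dist_fun_mono divide_right_mono) auto
    have "(\<integral>\<^sup>+t. g k t \<partial>?\<nu>) = (\<Sum>i<Suc k * Suc k. ennreal (h (?s k i)) * ennreal (?b (Suc i) - ?b i))"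
      unfolding g_def
    proof (subst nn_integral_sum)
      show "(\<Sum>i<Suc k * Suc k. \<integral>\<^sup>+ t. ennreal (h (?s k i)) * indicator {real i / real (Suc k)<..real (Suc i) / real (Suc k)} t \<partial>?\<nu>)
        = (\<Sum>i<Suc k * Suc k. ennreal (h (?s k i)) * ennreal (?b (Suc i) - ?b i))"
      proof (intro sum.cong refl)
        fix i
        have "real i / real (Suc k) \<le> real (Suc i) / real (Suc k)" by (intro divide_right_mono) auto
        from emeasure_dist_fun_Ioc[OF this]
        show "(\<integral>\<^sup>+ t. ennreal (h (?s k i)) * indicator {real i / real (Suc k)<..real (Suc i) / real (Suc k)} t \<partial>?\<nu>)
          = ennreal (h (?s k i)) * ennreal (?b (Suc i) - ?b i)"
          by (subst nn_integral_cmult_indicator) (auto simp del: of_nat_Suc)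
      qed
    qed auto
    also have "\<dots> = (\<Sum>i<Suc k * Suc k. \<integral>\<^sup>+r. ennreal (h (?s k i)) * indicator {?b i..<?b (Suc i)} r \<partial>lborel)"
      using b_mono by (intro sum.cong refl, subst nn_integral_cmult_indicator) auto
    also have "\<dots> = (\<integral>\<^sup>+r. (\<Sum>i<Suc k * Suc k. ennreal (h (?s k i)) * indicator {?b i..<?b (Suc i)} r) \<partial>lborel)"
      by (subst nn_integral_sum) auto
    also have "\<dots> = (\<integral>\<^sup>+r\<in>{0..}. ennreal (grid_step h a (Suc k) r) \<partial>lborel)"
    proof (intro nn_integral_cong)
      fix r :: real
      show "(\<Sum>i<Suc k * Suc k. ennreal (h (?s k i)) * indicator {?b i..<?b (Suc i)} r)
        = ennreal (grid_step h a (Suc k) r) * indicator {0..} r"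
      proof (cases "0 \<le> r")
        case True
        have "ennreal (grid_step h a (Suc k) r) = (\<Sum>i<Suc k * Suc k. ennreal (h (?s k i) * indicator {?b i..<?b (Suc i)} r))"
          unfolding grid_step_def dist_fun_def using h(3)
          by (subst sum_ennreal[symmetric]) (auto simp del: of_nat_Suc)
        then show ?thesis using True h(3)
          by (simp add: ennreal_mult ennreal_indicator del: of_nat_Suc mult_Suc mult_Suc_right)
      next
        case False
        then have "indicator {?b i..<?b (Suc i)} r = (0::ennreal)" for i
          using dist_fun_nonneg[of "real i / real (Suc k)"] by (auto simp: indicator_def)
        then show ?thesis using False by simp
      qed
    qed
    finally show ?thesis .
  qed
  moreover have "(\<lambda>k. \<integral>\<^sup>+r\<in>{0..}. ennreal (grid_step h a (Suc k) r) \<partial>lborel)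
      \<longlonglongrightarrow> (\<integral>\<^sup>+r\<in>{0..}. ennreal (h (time_inverse a (ennreal r))) \<partial>lborel)"
  proof (rule nn_integral_dominated_convergence[where w = "\<lambda>r. ennreal (B * indicator {0..<enn2real (a \<infinity>)} r)"])
    have [measurable]: "(\<lambda>r. indicator {0..} r * h (time_inverse a (ennreal r))) \<in> borel_measurable borel"
      by (rule borel_measurable_time_change[OF h(1,2)])
    have "(\<lambda>r. ennreal (indicator {0..} r * h (time_inverse a (ennreal r)))) \<in> borel_measurable lborel"
      by measurable
    then show "(\<lambda>r. ennreal (h (time_inverse a (ennreal r))) * indicator {0..} r) \<in> borel_measurable lborel"
      using h(3) by (simp add: ennreal_mult ennreal_indicator mult.commute)
    show "AE r in lborel. ennreal (grid_step h a (Suc k) r) * indicator {0..} r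
        \<le> ennreal (B * indicator {0..<enn2real (a \<infinity>)} r)" for k
    proof (rule AE_I2)
      fix r :: real
      show "ennreal (grid_step h a (Suc k) r) * indicator {0..} r
        \<le> ennreal (B * indicator {0..<enn2real (a \<infinity>)} r)"
        using grid_step_bound[of r h B "Suc k"] hB
        by (cases "0 \<le> r") (auto intro!: ennreal_leI simp: abs_le_iff)
    qed
    show "AE r in lborel. (\<lambda>k. ennreal (grid_step h a (Suc k) r) * indicator {0..} r)
        \<longlonglongrightarrow> ennreal (h (time_inverse a (ennreal r))) * indicator {0..} r"
    proof (rule AE_I2)
      fix r :: real
      show "(\<lambda>k. ennreal (grid_step h a (Suc k) r) * indicator {0..} r)
        \<longlonglongrightarrow> ennreal (h (time_inverse a (ennreal r))) * indicator {0..} r"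
        using LIMSEQ_Suc[OF grid_step_tendsto[OF h(1,2), of r]]
        by (cases "0 \<le> r") (auto intro: tendsto_ennrealI)
    qed
    show "(\<integral>\<^sup>+ r. ennreal (B * indicator {0..<enn2real (a \<infinity>)} r) \<partial>lborel) < \<infinity>"
      using B0 by (simp add: ennreal_mult ennreal_indicator nn_integral_cmult_indicator ennreal_mult_less_top)
  qed auto
  ultimately show ?thesis by (simp add: LIMSEQ_unique)
qed

end

section \<open>Paths with a cemetery, their clocks and their shifts\<close>

locale clock_path = clock a for a +
  fixes x :: "ennreal \<Rightarrow> 'a::t2_space option"
  assumes absorbing: "x s = None \<Longrightarrow> s \<le> t \<Longrightarrow> x t = None"
    and x_infinity: "x \<infinity> = None"
    and x_right_cont: "t < \<infinity> \<Longrightarrow> limitin pt_topology x (x t) (at_right t)"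
    and clock_dead: "x t = None \<Longrightarrow> a t = a \<infinity>"
begin

lemma right_cont_ext:
  fixes f :: "'a \<Rightarrow> real"
  assumes f: "continuous_on UNIV f"
  shows "right_cont (\<lambda>t. ext f (x t))"
  unfolding right_cont_def continuous_within
proof (intro allI impI)
  fix t :: ennreal assume t: "t < \<infinity>"
  show "((\<lambda>t. ext f (x t)) \<longlongrightarrow> ext f (x t)) (at_right t)"
  proof (cases "x t")
    case None
    have "eventually (\<lambda>s. ext f (x t) = ext f (x s)) (at_right t)"
      unfolding eventually_at_filter using absorbing[OF None] None
      by (intro always_eventually) auto
    then show ?thesis by (rule Lim_transform_eventually[OF tendsto_const])
  next
    case (Some y)
    show ?thesis
    proof (rule topological_tendstoI)
      fix S assume S: "open S" "ext f (x t) \<in> S"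
      then have "open (f -` S)" using f open_vimage by blast
      then have "openin pt_topology (Some ` (f -` S))" by simp
      moreover have "x t \<in> Some ` (f -` S)" using S Some by (auto simp: ext_def)
      ultimately have "eventually (\<lambda>s. x s \<in> Some ` (f -` S)) (at_right t)"
        using x_right_cont[OF t] unfolding limitin_def by blast
      then show "eventually (\<lambda>s. ext f (x s) \<in> S) (at_right t)"
        by eventually_elim (auto simp: ext_def)
    qed
  qed
qed

lemma ext_infinity: "ext f (x \<infinity>) = 0"
  by (simp add: ext_def x_infinity[simplified])

lemma alive_time_inverse: "r < a \<infinity> \<Longrightarrow> x (time_inverse a r) \<noteq> None"
  using clock_dead[of "time_inverse a r"] clock_time_inverse_le[of r] by (metis leD)

lemma ext_abs_le: "(\<And>y. \<bar>f y\<bar> \<le> B) \<Longrightarrow> \<bar>ext f z\<bar> \<le> (B::real)"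
  using order_trans[OF abs_ge_zero, of "f _" B] by (cases z) (auto simp: ext_def)

text \<open>Truncating the clock at \<open>k\<close> makes the inverse infinite from operational
  time \<open>k\<close> on and leaves it unchanged before. The finite case applies to each
  truncation, and monotone convergence removes it.\<close>

lemma stieltjes_integral_eq:
  fixes f :: "'a \<Rightarrow> real"
  assumes f: "continuous_on UNIV f" "\<And>y. 0 \<le> f y" "\<And>y. f y \<le> B"
  shows "stieltjes_integral (\<lambda>t. ext (\<lambda>y. ennreal (f y)) (x (ennreal t))) a
    = (\<integral>\<^sup>+r\<in>{0..}. ennreal (ext f (x (time_inverse a (ennreal r)))) \<partial>lborel)"
proof -
  define h where "h t = ext f (x t)" for t
  have h: "right_cont h" "h \<infinity> = 0"
    unfolding h_def[abs_def] by (rule right_cont_ext[OF f(1)], rule ext_infinity)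
  have h0: "0 \<le> h t" for t using f(2) by (simp add: h_def ext_def split: option.split)
  have hB: "h t \<le> B" for t using f(2,3) order_trans[OF f(2) f(3)] by (cases "x t") (auto simp: h_def ext_def)
  have ext_eq: "ext (\<lambda>y. ennreal (f y)) z = ennreal (ext f z)" for z
    by (simp add: ext_def split: option.split)
  let ?a = "\<lambda>k s. min (a s) (of_nat k)"
  have inv: "time_inverse (?a k) r = (if r < of_nat k then time_inverse a r else \<infinity>)" for k r
    by (auto simp: time_inverse_def)
  have "stieltjes_integral (\<lambda>t. ext (\<lambda>y. ennreal (f y)) (x (ennreal t))) a
      = (SUP k::nat. \<integral>\<^sup>+t\<in>{0..}. ennreal (h (ennreal t)) \<partial>interval_measure (finite_clock.dist_fun (?a k)))"
    unfolding stieltjes_integral_def ext_eq h_def finite_clock.dist_fun_def[OF finite_clock_min] ..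
  also have "\<dots> = (SUP k::nat. \<integral>\<^sup>+r\<in>{0..}. ennreal (h (time_inverse (?a k) (ennreal r))) \<partial>lborel)"
    by (intro SUP_cong refl finite_clock.nn_integral_interval_measure[OF finite_clock_min h h0 hB])
  also have "\<dots> = (\<integral>\<^sup>+r. (SUP k::nat. ennreal (h (time_inverse (?a k) (ennreal r))) * indicator {0..} r) \<partial>lborel)"
  proof (rule nn_integral_monotone_convergence_SUP[symmetric])
    show "incseq (\<lambda>k r. ennreal (h (time_inverse (?a k) (ennreal r))) * indicator {0..} r)"
    proof (intro incseq_SucI le_funI)
      fix k and r :: real
      have "ennreal (h (time_inverse (?a k) (ennreal r))) \<le> ennreal (h (time_inverse (?a (Suc k)) (ennreal r)))"
      proof (cases "ennreal r < of_nat k")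
        case True
        also have "of_nat k \<le> (of_nat (Suc k) :: ennreal)" by (intro of_nat_mono) simp
        finally show ?thesis using True by (simp only: inv if_True)
      next
        case False
        then show ?thesis by (simp add: inv h(2)[simplified])
      qed
      then show "ennreal (h (time_inverse (?a k) (ennreal r))) * indicator {0..} r
          \<le> ennreal (h (time_inverse (?a (Suc k)) (ennreal r))) * indicator {0..} r"
        by (rule mult_right_mono) simp
    qed
    fix k
    interpret m: finite_clock "?a k" by (rule finite_clock_min)
    have [measurable]: "(\<lambda>r. indicator {0..} r * h (time_inverse (?a k) (ennreal r))) \<in> borel_measurable borel"
      by (rule m.borel_measurable_time_change[OF h])
    have "(\<lambda>r. ennreal (indicator {0..} r * h (time_inverse (?a k) (ennreal r)))) \<in> borel_measurable lborel"
      by measurable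
    then show "(\<lambda>r. ennreal (h (time_inverse (?a k) (ennreal r))) * indicator {0..} r) \<in> borel_measurable lborel"
      using h0 by (simp add: ennreal_mult ennreal_indicator mult.commute)
  qed
  also have "\<dots> = (\<integral>\<^sup>+r\<in>{0..}. ennreal (h (time_inverse a (ennreal r))) \<partial>lborel)"
  proof (intro nn_integral_cong)
    fix r :: real
    have "(SUP k::nat. ennreal (h (time_inverse (?a k) (ennreal r)))) = ennreal (h (time_inverse a (ennreal r)))"
    proof (rule antisym)
      show "(SUP k::nat. ennreal (h (time_inverse (?a k) (ennreal r)))) \<le> ennreal (h (time_inverse a (ennreal r)))"
        unfolding inv using h h0 by (intro SUP_least) auto
      obtain k where "ennreal r < of_nat k"
        using ennreal_less_top[of r] ennreal_Ex_less_of_nat by blast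
      then show "ennreal (h (time_inverse a (ennreal r))) \<le> (SUP k::nat. ennreal (h (time_inverse (?a k) (ennreal r))))"
        by (intro SUP_upper2[of k]) (auto simp: inv)
    qed
    then show "(SUP k::nat. ennreal (h (time_inverse (?a k) (ennreal r))) * indicator {0..} r)
        = ennreal (h (time_inverse a (ennreal r))) * indicator {0..} r"
      by (cases "0 \<le> r") auto
  qed
  finally show ?thesis by (simp add: h_def)
qed

text \<open>The path is alive at inverse times below the total clock and dead from there on, so the
  integrand over operational time is an indicator. An infinite total clock is included, since almost
  sure finiteness of the clock is itself deduced from this identity.\<close>

lemma stieltjes_integral_one: "stieltjes_integral (\<lambda>t. ext (\<lambda>_. 1) (x (ennreal t))) a = a \<infinity>"
proof -
  have "stieltjes_integral (\<lambda>t. ext (\<lambda>_. 1) (x (ennreal t))) a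
      = (\<integral>\<^sup>+r\<in>{0..}. ennreal (ext (\<lambda>_. 1) (x (time_inverse a (ennreal r)))) \<partial>lborel)"
    using stieltjes_integral_eq[of "\<lambda>_. 1" 1] by simp
  also have "\<dots> = (\<integral>\<^sup>+r. indicator {r. 0 \<le> r \<and> ennreal r < a \<infinity>} r \<partial>lborel)"
  proof (intro nn_integral_cong)
    fix r :: real
    show "ennreal (ext (\<lambda>_. 1) (x (time_inverse a (ennreal r)))) * indicator {0..} r
        = indicator {r. 0 \<le> r \<and> ennreal r < a \<infinity>} r"
    proof (cases "ennreal r < a \<infinity>")
      case True
      then show ?thesis using alive_time_inverse[OF True]
        by (auto simp: ext_def indicator_def split: option.split)
    next
      case False
      then show ?thesis using time_inverse_eq_top[of "ennreal r"] x_infinity by (simp add: ext_def not_less)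
    qed
  qed
  also have "\<dots> = emeasure lborel {r::real. 0 \<le> r \<and> ennreal r < a \<infinity>}"
    by (intro nn_integral_indicator) simp
  also have "\<dots> = a \<infinity>"
  proof (cases "a \<infinity>")
    case (real L)
    then have "{r::real. 0 \<le> r \<and> ennreal r < a \<infinity>} = {0..<L}"
      by (auto simp: ennreal_less_iff)
    then show ?thesis using real by simp
  next
    case top
    have "(of_nat n :: ennreal) \<le> emeasure lborel {0::real..}" for n
    proof -
      have "emeasure lborel {0..real n} \<le> emeasure lborel {0::real..}" by (intro emeasure_mono) auto
      then show ?thesis by (simp add: ennreal_of_nat_eq_real_of_nat)
    qed
    then have "emeasure lborel {0::real..} = \<top>"
      using ennreal_Ex_less_of_nat[of "emeasure lborel {0::real..}"] by (meson leD top.not_eq_extremum)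
    moreover have "{r::real. 0 \<le> r \<and> ennreal r < a \<infinity>} = {0..}" using top by auto
    ultimately show ?thesis using top by simp
  qed
  finally show ?thesis .
qed

end

locale finite_clock_path = clock_path + finite_clock
begin

lemma finite_clock_path_shift:
  assumes t: "t < \<infinity>"
  shows "finite_clock_path (\<lambda>s. a (t + s) - a t) (\<lambda>s. x (t + s))"
proof
  show "mono (\<lambda>s. a (t + s) - a t)"
    by (intro monoI ennreal_minus_mono monoD[OF a_mono] add_left_mono) auto
  show "continuous_on UNIV (\<lambda>s. a (t + s) - a t)"
    using clock_finite less_top
    by (intro continuous_on_diff_ennreal continuous_on_compose2[OF a_cont] continuous_intros) auto
  show "a (t + \<infinity>) - a t < \<infinity>"
    using clock_finite[of "t + \<infinity>"] by (simp add: diff_le_self_ennreal[THEN order_le_less_trans])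
  show "x (t + s) = None \<Longrightarrow> s \<le> s' \<Longrightarrow> x (t + s') = None" for s s'
    by (erule absorbing) (rule add_left_mono)
  show "x (t + s) = None \<Longrightarrow> a (t + s) - a t = a (t + \<infinity>) - a t" for s
    using clock_dead[of "t + s"] by simp
  show "limitin pt_topology (\<lambda>s. x (t + s)) (x (t + s)) (at_right s)" if s: "s < \<infinity>" for s
  proof -
    have "filterlim (\<lambda>s. t + s) (at_right (t + s)) (at_right s)"
      unfolding filterlim_at
    proof
      show "\<forall>\<^sub>F x in at_right s. t + x \<in> {t + s<..} \<and> t + x \<noteq> t + s"
        unfolding eventually_at_filter using t
        by (intro always_eventually) (auto simp: ennreal_add_left_cancel_less less_top)
      show "((+) t \<longlongrightarrow> t + s) (at_right s)"
        by (intro tendsto_intros)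
    qed
    moreover have "limitin pt_topology x (x (t + s)) (at_right (t + s))"
      using t s by (intro x_right_cont) (simp add: less_top)
    ultimately show ?thesis
      unfolding limitin_def by (auto intro: eventually_compose_filterlim)
  qed
qed (use x_infinity clock_finite[of t] in \<open>auto simp: less_top\<close>)

text \<open>The inverse time at \<open>a t + r\<close> is \<open>t\<close> plus the inverse time of
  the shifted clock at \<open>r\<close>: both have the same strict upper bounds, all of the form t +
  s, because before \<open>t\<close> the clock does not exceed \<open>a t\<close>.\<close>

lemma time_inverse_shift:
  assumes t: "t < \<infinity>"
  shows "x (t + time_inverse (\<lambda>s. a (t + s) - a t) r) = x (time_inverse a (a t + r))"
proof -
  interpret s: finite_clock_path "\<lambda>s. a (t + s) - a t" "\<lambda>s. x (t + s)"
    by (rule finite_clock_path_shift[OF t])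
  have "time_inverse a (a t + r) = t + time_inverse (\<lambda>s. a (t + s) - a t) r"
  proof (rule antisym; rule dense_ge)
    fix y
    let ?\<sigma> = "time_inverse (\<lambda>s. a (t + s) - a t) r"
    \<comment> \<open>The finite reading \<open>a t\<close> may be moved across an inequality in
      \<open>ennreal\<close>.\<close>
    have iff: "a t + r < a (t + s) \<longleftrightarrow> r < a (t + s) - a t" for s
      using clock_finite[of t] less_diff_eq_ennreal[of "a (t + s)" "a t" r]
      by (simp add: add.commute)
    { assume y: "t + ?\<sigma> < y"
      moreover have "t \<le> t + ?\<sigma>" by simp
      ultimately have "t \<le> y" by (meson less_imp_le order_trans)
      then obtain s where s: "y = t + s" using le_iff_add by blast
      with y have "?\<sigma> < s" using t by (simp add: ennreal_add_left_cancel_less less_top)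
      then have "a t + r < a (t + s)" by (simp add: s.time_inverse_less_iff iff)
      then show "time_inverse a (a t + r) \<le> y" unfolding s by (simp add: time_inverse_less_iff[symmetric] less_imp_le) }
    { assume y: "time_inverse a (a t + r) < y"
      then have r: "a t + r < a y" by (simp add: time_inverse_less_iff)
      have "t \<le> y"
      proof (rule ccontr)
        assume "\<not> t \<le> y"
        then have "a y \<le> a t" by (intro monoD[OF a_mono]) auto
        also have "a t \<le> a t + r" by simp
        finally show False using r by simp
      qed
      then obtain s where s: "y = t + s" using le_iff_add by blast
      with r have "?\<sigma> < s" by (simp add: s.time_inverse_less_iff iff)
      then show "t + ?\<sigma> \<le> y" unfolding s by (intro add_left_mono) simp }
  qed
  then show ?thesis by simp
qed

end

section \<open>Discounted integrals of a time-changed path\<close>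

text \<open>The future of \<open>D\<close>, discounted back to operational time \<open>q\<close>.
  When \<open>D\<close> is the time-changed path and \<open>q\<close> the clock reading at a real
  time, its conditional mean given the past is the resolvent at the current position.\<close>

definition discounted :: "real \<Rightarrow> (real \<Rightarrow> real) \<Rightarrow> real \<Rightarrow> real" where
  "discounted \<alpha> D q = (LINT r:{q..}|lborel. exp (- \<alpha> * (r - q)) * D r)"

lemma discounted_shift: "discounted \<alpha> D q = (LINT r:{0..}|lborel. exp (- \<alpha> * r) * D (q + r))"
  unfolding discounted_def set_lebesgue_integral_def
  by (subst lborel_integral_real_affine[where c = 1 and t = q])
     (auto intro!: Bochner_Integration.integral_cong simp: indicator_def)

locale bounded_support_fun =
  fixes D :: "real \<Rightarrow> real" and B L :: real
  assumes D_meas [measurable]: "D \<in> borel_measurable borel"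
    and D_bound: "\<bar>D r\<bar> \<le> B"
    and D_supp: "r < 0 \<or> L \<le> r \<Longrightarrow> D r = 0"
begin

lemma B_nonneg: "0 \<le> B" using order_trans[OF abs_ge_zero D_bound] .

lemma discounted_eq_0: "L \<le> q \<Longrightarrow> discounted \<alpha> D q = 0"
  unfolding discounted_def set_lebesgue_integral_def
  by (intro integral_eq_zero_AE AE_I2) (auto simp: indicator_def D_supp)

lemma discounted_bound:
  assumes "0 < \<alpha>"
  shows "\<bar>discounted \<alpha> D q\<bar> \<le> B / \<alpha>"
proof -
  have "\<bar>discounted \<alpha> D q\<bar> \<le> (LINT r:{0..}|lborel. B * exp (- \<alpha> * r))"
    unfolding discounted_shift set_lebesgue_integral_def real_norm_def[symmetric]
  proof (rule Bochner_Integration.integral_norm_bound_integral)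
    show i: "integrable lborel (\<lambda>r. indicator {0..} r *\<^sub>R (B * exp (- \<alpha> * r)))"
      using set_integrable_mult_right[of B lborel "{0..}", OF set_integrable_exp_minus[OF assms]]
      by (simp add: set_integrable_def)
    show b: "norm (indicator {0..} r *\<^sub>R (exp (- \<alpha> * r) * D (q + r))) \<le> indicator {0..} r *\<^sub>R (B * exp (- \<alpha> * r))" for r
      using D_bound[of "q + r"] by (auto simp: indicator_def abs_mult)
    show "integrable lborel (\<lambda>r. indicator {0..} r *\<^sub>R (exp (- \<alpha> * r) * D (q + r)))"
      by (rule Bochner_Integration.integrable_bound[OF i])
         (use b in \<open>auto intro!: AE_I2 intro: order_trans[OF _ abs_ge_self]\<close>)
  qed
  also have "\<dots> = B / \<alpha>" using set_integral_exp_minus[OF assms] by simp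
  finally show ?thesis .
qed

lemma discounted_cont:
  assumes "0 < \<alpha>"
  shows "continuous_on UNIV (discounted \<alpha> D)"
  unfolding continuous_on_eq_continuous_at[OF open_UNIV]
proof
  fix q :: real
  show "isCont (discounted \<alpha> D) q"
    unfolding continuous_at_sequentially comp_def
  proof (intro allI impI)
    fix s :: "nat \<Rightarrow> real" assume s: "s \<longlonglongrightarrow> q"
    \<comment> \<open>Once the first \<open>N\<close> terms are dropped, the lower limits stay below
      |q| + 1; for r >= 0 the exponent is then at most
      \<open>\<alpha> * (\<bar>q\<bar> + 1)\<close>.\<close>
    define C where "C = B * exp (\<alpha> * (\<bar>q\<bar> + 1))"
    have "eventually (\<lambda>n. dist (s n) q < 1) sequentially" using s tendstoD[of s q sequentially 1] by simp
    then obtain N where N: "\<And>n. N \<le> n \<Longrightarrow> \<bar>s n - q\<bar> < 1"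
      by (auto simp: eventually_sequentially dist_real_def)
    have "(\<lambda>n. LINT r:{s (n + N)..}|lborel. exp (- \<alpha> * (r - s (n + N))) * D r)
        \<longlonglongrightarrow> (LINT r:{q..}|lborel. exp (- \<alpha> * (r - q)) * D r)"
      unfolding set_lebesgue_integral_def
    proof (rule integral_dominated_convergence[where w = "\<lambda>r. C * indicator {0..<L} r"])
      show "integrable lborel (\<lambda>r. C * indicator {0..<L} r)"
        by (intro integrable_mult_right integrable_real_indicator)
           (use emeasure_bounded_finite[of "{0..<L}"] in auto)
      show "AE r in lborel. (\<lambda>n. indicator {s (n + N)..} r *\<^sub>R (exp (- \<alpha> * (r - s (n + N))) * D r))
          \<longlonglongrightarrow> indicator {q..} r *\<^sub>R (exp (- \<alpha> * (r - q)) * D r)"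
        using AE_lborel_singleton[of q]
      proof eventually_elim
        fix r assume "r \<noteq> q"
        have sN: "(\<lambda>n. s (n + N)) \<longlonglongrightarrow> q" using s by (rule LIMSEQ_ignore_initial_segment)
        have "eventually (\<lambda>n. indicator {q..} r = (indicator {s (n + N)..} r :: real)) sequentially"
        proof (cases "r < q")
          case True
          from order_tendstoD(1)[OF sN this] show ?thesis
            by eventually_elim (use True in \<open>auto simp: indicator_def\<close>)
        next
          case False
          with \<open>r \<noteq> q\<close> have "q < r" by simp
          from order_tendstoD(2)[OF sN this] show ?thesis
            by eventually_elim (use \<open>q < r\<close> in \<open>auto simp: indicator_def\<close>)
        qed
        then have "(\<lambda>n. indicator {s (n + N)..} r :: real) \<longlonglongrightarrow> indicator {q..} r"
          by (rule Lim_transform_eventually[OF tendsto_const])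
        then show "(\<lambda>n. indicator {s (n + N)..} r *\<^sub>R (exp (- \<alpha> * (r - s (n + N))) * D r))
          \<longlonglongrightarrow> indicator {q..} r *\<^sub>R (exp (- \<alpha> * (r - q)) * D r)"
          by (intro tendsto_intros sN)
      qed
      fix n
      show "AE r in lborel. norm (indicator {s (n + N)..} r *\<^sub>R (exp (- \<alpha> * (r - s (n + N))) * D r)) \<le> C * indicator {0..<L} r"
      proof (rule AE_I2)
        fix r :: real
        show "norm (indicator {s (n + N)..} r *\<^sub>R (exp (- \<alpha> * (r - s (n + N))) * D r)) \<le> C * indicator {0..<L} r"
        proof (cases "0 \<le> r \<and> r < L")
          case True
          have "- \<alpha> * (r - s (n + N)) \<le> \<alpha> * (\<bar>q\<bar> + 1)"
          proof -
            have "s (n + N) - r \<le> \<bar>q\<bar> + 1" using N[OF le_add2, of n] True by linarith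
            from mult_left_mono[OF this, of \<alpha>] assms show ?thesis by (simp add: algebra_simps)
          qed
          then have "\<bar>exp (- \<alpha> * (r - s (n + N))) * D r\<bar> \<le> exp (\<alpha> * (\<bar>q\<bar> + 1)) * B"
            using D_bound[of r] by (simp only: abs_mult abs_exp_cancel) (intro mult_mono, auto)
          moreover have "\<bar>indicator {s (n + N)..} r * (exp (- \<alpha> * (r - s (n + N))) * D r)\<bar> \<le> \<bar>exp (- \<alpha> * (r - s (n + N))) * D r\<bar>"
            by (auto simp: indicator_def)
          ultimately show ?thesis using True by (simp add: C_def mult.commute)
        next
          case False
          then have "D r = 0" by (intro D_supp) auto
          then show ?thesis using False by simp
        qed
      qed
    qed measurable
    then have "(\<lambda>n. discounted \<alpha> D (s (n + N))) \<longlonglongrightarrow> discounted \<alpha> D q"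
      by (simp add: discounted_def)
    then show "(\<lambda>n. discounted \<alpha> D (s n)) \<longlonglongrightarrow> discounted \<alpha> D q"
      by (rule LIMSEQ_offset)
  qed
qed

lemma integral_exp_diff:
  fixes r :: real
  assumes "0 \<le> r"
  shows "(\<alpha> - \<beta>) * (LINT q:{0..r}|lborel. exp (- \<beta> * q) * exp (- \<alpha> * (r - q))) = exp (- \<beta> * r) - exp (- \<alpha> * r)"
proof -
  have "(LINT q:{0..r}|lborel. (\<alpha> - \<beta>) * (exp (- \<beta> * q) * exp (- \<alpha> * (r - q))))
      = exp (- \<beta> * r) * exp (- \<alpha> * (r - r)) - exp (- \<beta> * 0) * exp (- \<alpha> * (r - 0))"
    unfolding set_lebesgue_integral_def real_scaleR_def
  proof (subst mult.commute, rule integral_FTC_Icc_real[OF assms])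
    fix q
    show "DERIV (\<lambda>q. exp (- \<beta> * q) * exp (- \<alpha> * (r - q))) q :> (\<alpha> - \<beta>) * (exp (- \<beta> * q) * exp (- \<alpha> * (r - q)))"
      by (auto intro!: derivative_eq_intros simp: algebra_simps)
    show "isCont (\<lambda>q. (\<alpha> - \<beta>) * (exp (- \<beta> * q) * exp (- \<alpha> * (r - q)))) q"
      by (intro continuous_intros)
  qed
  then show ?thesis by simp
qed

text \<open>The resolvent equation of a single path: Fubini on the triangle 0 <= q <= r and an
  elementary exponential integral. The bounded support of \<open>D\<close> supplies integrability
  down to \<beta> = 0, and the factor \<open>\<alpha> - \<beta>\<close> stays on the left so that
  equal parameters are covered.\<close>

lemma discounted_laplace:
  assumes \<alpha>: "0 < \<alpha>" and \<beta>: "0 \<le> \<beta>"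
  shows "(\<alpha> - \<beta>) * (LINT q:{0..}|lborel. exp (- \<beta> * q) * discounted \<alpha> D q)
    = (LINT r:{0..}|lborel. (exp (- \<beta> * r) - exp (- \<alpha> * r)) * D r)"
proof -
  define g where "g q r = indicator {0..r} q * (exp (- \<beta> * q) * exp (- \<alpha> * (r - q)) * D r)" for q r :: real
  have [measurable]: "(\<lambda>(q, r). g q r) \<in> borel_measurable (lborel \<Otimes>\<^sub>M lborel)"
  proof -
    have "(\<lambda>x. if 0 \<le> fst x \<and> fst x \<le> snd x then exp (- \<beta> * fst x) * exp (- \<alpha> * (snd x - fst x)) * D (snd x) else 0)
      \<in> borel_measurable (lborel \<Otimes>\<^sub>M lborel)"
      by measurable
    also have "(\<lambda>x. if 0 \<le> fst x \<and> fst x \<le> snd x then exp (- \<beta> * fst x) * exp (- \<alpha> * (snd x - fst x)) * D (snd x) else 0)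
      = (\<lambda>(q, r). g q r)"
      by (auto simp: g_def indicator_def fun_eq_iff)
    finally show ?thesis .
  qed
  have g_bound: "\<bar>g q r\<bar> \<le> B * indicator ({0..L} \<times> {0..L}) (q, r)" for q r
  proof (cases "0 \<le> q \<and> q \<le> r \<and> r < L")
    case True
    then have "exp (- \<beta> * q) * exp (- \<alpha> * (r - q)) \<le> 1 * 1"
      using \<alpha> \<beta> by (intro mult_mono) auto
    then have "\<bar>exp (- \<beta> * q) * exp (- \<alpha> * (r - q)) * D r\<bar> \<le> 1 * B"
      using D_bound[of r] by (simp only: abs_mult abs_exp_cancel) (intro mult_mono, auto)
    then show ?thesis using True by (simp add: g_def)
  next
    case False
    then show ?thesis using D_supp[of r] B_nonneg by (auto simp: g_def indicator_def)
  qed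
  have int: "integrable (lborel \<Otimes>\<^sub>M lborel) (\<lambda>(q, r). g q r)"
  proof (rule Bochner_Integration.integrable_bound)
    have "emeasure (lborel \<Otimes>\<^sub>M lborel) ({0..L} \<times> {0..L}) < \<infinity>"
      by (subst lborel.emeasure_pair_measure_Times) (auto simp: ennreal_mult_less_top emeasure_lborel_Icc_eq)
    then show "integrable (lborel \<Otimes>\<^sub>M lborel) (\<lambda>x. B * indicator ({0..L} \<times> {0..L}) x)"
      by (intro integrable_mult_right integrable_real_indicator) auto
  qed (use g_bound in \<open>auto intro!: AE_I2 intro: order_trans[OF _ abs_ge_self]\<close>)
  have "(LINT q:{0..}|lborel. exp (- \<beta> * q) * discounted \<alpha> D q) = (LINT q|lborel. LINT r|lborel. g q r)"
    unfolding set_lebesgue_integral_def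
  proof (intro Bochner_Integration.integral_cong refl)
    fix q :: real
    show "indicator {0..} q *\<^sub>R (exp (- \<beta> * q) * discounted \<alpha> D q) = (LINT r|lborel. g q r)"
    proof -
      have "g q r = (indicator {0..} q * exp (- \<beta> * q)) * (indicator {q..} r *\<^sub>R (exp (- \<alpha> * (r - q)) * D r))" for r
        by (auto simp: g_def indicator_def)
      then show ?thesis by (simp add: discounted_def set_lebesgue_integral_def)
    qed
  qed
  also have "\<dots> = (LINT r|lborel. LINT q|lborel. g q r)"
    by (rule lborel_pair.Fubini_integral[OF int, symmetric])
  also have "(\<alpha> - \<beta>) * \<dots> = (LINT r|lborel. (\<alpha> - \<beta>) * (LINT q|lborel. g q r))" by simp
  also have "\<dots> = (LINT r:{0..}|lborel. (exp (- \<beta> * r) - exp (- \<alpha> * r)) * D r)"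
    unfolding set_lebesgue_integral_def
  proof (intro Bochner_Integration.integral_cong refl)
    fix r :: real
    have "(LINT q|lborel. g q r) = (LINT q:{0..r}|lborel. exp (- \<beta> * q) * exp (- \<alpha> * (r - q))) * D r"
      unfolding g_def set_lebesgue_integral_def by (simp add: mult.assoc[symmetric])
    then show "(\<alpha> - \<beta>) * (LINT q|lborel. g q r) = indicator {0..} r *\<^sub>R ((exp (- \<beta> * r) - exp (- \<alpha> * r)) * D r)"
      using integral_exp_diff[of r \<alpha> \<beta>] D_supp[of r] by (cases "0 \<le> r") (auto simp: mult.assoc[symmetric])
  qed
  finally show ?thesis .
qed

end

context finite_clock_path
begin

definition time_changed :: "('a \<Rightarrow> real) \<Rightarrow> real \<Rightarrow> real" where
  "time_changed f r = indicator {0..} r * ext f (x (time_inverse a (ennreal r)))"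

lemma time_changed_support:
  assumes f: "continuous_on UNIV f" "\<And>y. \<bar>f y\<bar> \<le> B"
  shows "bounded_support_fun (time_changed f) B (enn2real (a \<infinity>))"
proof
  show "time_changed f \<in> borel_measurable borel"
    unfolding time_changed_def[abs_def]
    by (rule borel_measurable_time_change[OF right_cont_ext[OF f(1)] ext_infinity])
  show "\<bar>time_changed f r\<bar> \<le> B" for r
    using ext_abs_le[of f B, OF f(2)] order_trans[OF abs_ge_zero f(2)]
    by (auto simp: time_changed_def indicator_def)
  show "time_changed f r = 0" if "r < 0 \<or> enn2real (a \<infinity>) \<le> r" for r
  proof (cases "0 \<le> r")
    case True
    then show ?thesis
      using time_change_bound[of "\<lambda>t. ext f (x t)" B r, OF ext_infinity ext_abs_le[OF f(2)]] that
      by (auto simp: time_changed_def)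
  qed (simp add: time_changed_def)
qed

text \<open>As a function of real time, \<open>h\<close> is right-continuous, bounded and 0 at
  infinity, so the same grid approximation applies to it as to the path itself. At inverse times it
  returns \<open>discounted\<close>, because the clock undoes its inverse below the total clock and
  both sides vanish above.\<close>

lemma
  assumes f: "continuous_on UNIV f" "\<And>y. \<bar>f y\<bar> \<le> B" and \<alpha>: "0 < \<alpha>"
  defines "h \<equiv> \<lambda>t. discounted \<alpha> (time_changed f) (enn2real (a t))"
  shows right_cont_discounted: "right_cont h"
    and discounted_infinity: "h \<infinity> = 0"
    and discounted_clock_bound: "\<bar>h t\<bar> \<le> B / \<alpha>"
    and discounted_resolvent: "0 \<le> \<beta> \<Longrightarrow> (\<alpha> - \<beta>) * (LINT q:{0..}|lborel. exp (- \<beta> * q) * h (time_inverse a (ennreal q)))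
      = (LINT r:{0..}|lborel. (exp (- \<beta> * r) - exp (- \<alpha> * r)) * ext f (x (time_inverse a (ennreal r))))"
    and discounted_path_shift: "t < \<infinity> \<Longrightarrow>
      (LINT r:{0..}|lborel. exp (- \<alpha> * r) * ext f (x (t + time_inverse (\<lambda>s. a (t + s) - a t) (ennreal r)))) = h t"
proof -
  interpret D: bounded_support_fun "time_changed f" B "enn2real (a \<infinity>)"
    by (rule time_changed_support[OF f])
  show "right_cont h"
    unfolding right_cont_def h_def
  proof (intro allI impI)
    fix t :: ennreal
    have "(a \<longlongrightarrow> a t) (at_right t)"
      using a_cont by (auto simp: continuous_on_eq_continuous_at continuous_at_imp_continuous_within continuous_within[symmetric])
    then have "((\<lambda>s. enn2real (a s)) \<longlongrightarrow> enn2real (a t)) (at_right t)"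
      using clock_eq[of t] by (intro tendsto_enn2real) auto
    then show "continuous (at_right t) (\<lambda>t. discounted \<alpha> (time_changed f) (enn2real (a t)))"
      unfolding continuous_within
      using D.discounted_cont[OF \<alpha>] by (auto intro: continuous_on_tendsto_compose)
  qed
  show h_inf: "h \<infinity> = 0" unfolding h_def by (rule D.discounted_eq_0) simp
  show "\<bar>h t\<bar> \<le> B / \<alpha>" for t unfolding h_def by (rule D.discounted_bound[OF \<alpha>])
  have h_inv: "h (time_inverse a (ennreal q)) = discounted \<alpha> (time_changed f) q" if "0 \<le> q" for q
    using that
  proof (cases q rule: time_inverse_cases)
    case dead
    then show ?thesis using h_inf D.discounted_eq_0 by simp
  next
    case (alive t)
    then have "ennreal q < a \<infinity>" using that
      by (subst clock_eq) (simp add: ennreal_less_iff del: ennreal_enn2real_if)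
    then show ?thesis using clock_time_inverse that by (simp add: h_def)
  qed
  show "(\<alpha> - \<beta>) * (LINT q:{0..}|lborel. exp (- \<beta> * q) * h (time_inverse a (ennreal q)))
      = (LINT r:{0..}|lborel. (exp (- \<beta> * r) - exp (- \<alpha> * r)) * ext f (x (time_inverse a (ennreal r))))"
    if \<beta>: "0 \<le> \<beta>"
  proof -
    have "(LINT q:{0..}|lborel. exp (- \<beta> * q) * h (time_inverse a (ennreal q)))
        = (LINT q:{0..}|lborel. exp (- \<beta> * q) * discounted \<alpha> (time_changed f) q)"
      by (intro set_lebesgue_integral_cong) (auto simp: h_inv)
    moreover have "(LINT r:{0..}|lborel. (exp (- \<beta> * r) - exp (- \<alpha> * r)) * ext f (x (time_inverse a (ennreal r))))
        = (LINT r:{0..}|lborel. (exp (- \<beta> * r) - exp (- \<alpha> * r)) * time_changed f r)"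
      by (intro set_lebesgue_integral_cong) (auto simp: time_changed_def)
    ultimately show ?thesis using D.discounted_laplace[OF \<alpha> \<beta>] by simp
  qed
  show "(LINT r:{0..}|lborel. exp (- \<alpha> * r) * ext f (x (t + time_inverse (\<lambda>s. a (t + s) - a t) (ennreal r)))) = h t"
    if t: "t < \<infinity>"
    unfolding h_def discounted_shift
  proof (intro set_lebesgue_integral_cong allI impI)
    fix r :: real assume "r \<in> {0..}"
    then have "a t + ennreal r = ennreal (enn2real (a t) + r)"
      by (subst clock_eq) (simp add: ennreal_plus del: ennreal_enn2real_if)
    with \<open>r \<in> {0..}\<close> show "exp (- \<alpha> * r) * ext f (x (t + time_inverse (\<lambda>s. a (t + s) - a t) (ennreal r)))
        = exp (- \<alpha> * r) * time_changed f (enn2real (a t) + r)"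
      by (simp add: time_inverse_shift[OF t] time_changed_def)
  qed simp
qed

end

section \<open>The Markov property for functionals of the path\<close>

lemma space_pt_borel [simp]: "space pt_borel = UNIV"
  by (simp add: pt_borel_def)

lemma sets_pt_borel_open: "openin pt_topology U \<Longrightarrow> U \<in> sets pt_borel"
  by (auto simp: pt_borel_def)

lemma image_Some_pt_borel:
  assumes "D \<in> sets (borel :: 'a::topological_space measure)"
  shows "Some ` D \<in> sets pt_borel"
proof -
  have UNIV: "Some ` (UNIV :: 'a set) \<in> sets pt_borel"
    by (intro sets_pt_borel_open) simp
  have "D \<in> sigma_sets UNIV {S. open S}"
    using assms by (simp add: borel_def)
  then show ?thesis
  proof induction
    case (Basic a)
    then show ?case by (intro sets_pt_borel_open) simp
  next
    case (Compl a)
    have "Some ` (UNIV - a) = Some ` UNIV - Some ` a" by auto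
    then show ?case using UNIV Compl by auto
  next
    case (Union a)
    then show ?case unfolding image_UN by (intro sets.countable_UN) auto
  qed auto
qed

lemma None_pt_borel: "{None} \<in> sets (pt_borel :: 'a::topological_space option measure)"
proof -
  have "UNIV - Some ` (UNIV :: 'a set) \<in> sets pt_borel"
    using image_Some_pt_borel[of "UNIV :: 'a set"] sets.compl_sets[of "Some ` UNIV" pt_borel] by simp
  also have "UNIV - Some ` (UNIV :: 'a set) = {None}" by (auto simp: notin_range_Some)
  finally show ?thesis .
qed

text \<open>Images of Borel sets under \<open>Some\<close> and the singleton of the cemetery are
  measurable, so a map may be tested on the two pieces separately.\<close>

lemma measurable_pt_borelI:
  fixes g :: "'a::topological_space option \<Rightarrow> 'b"
  assumes "(\<lambda>x. g (Some x)) \<in> borel \<rightarrow>\<^sub>M N" and "g None \<in> space N"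
  shows "g \<in> pt_borel \<rightarrow>\<^sub>M N"
proof (rule measurableI)
  show "g z \<in> space N" for z
    using assms measurable_space[OF assms(1)] by (cases z) auto
  fix S assume S: "S \<in> sets N"
  have "Some ` ((\<lambda>x. g (Some x)) -` S) \<in> sets pt_borel"
    using measurable_sets[OF assms(1) S] by (intro image_Some_pt_borel) auto
  moreover have "g -` S = Some ` ((\<lambda>x. g (Some x)) -` S) \<union> (if g None \<in> S then {None} else {})"
  proof (rule set_eqI)
    fix z show "z \<in> g -` S \<longleftrightarrow> z \<in> Some ` ((\<lambda>x. g (Some x)) -` S) \<union> (if g None \<in> S then {None} else {})"
      by (cases z) auto
  qed
  ultimately show "g -` S \<inter> space pt_borel \<in> sets pt_borel"
    using None_pt_borel by (simp only: space_pt_borel Int_UNIV_right) (intro sets.Un, auto)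
qed

lemma measurable_ext [measurable]:
  fixes f :: "'a::topological_space \<Rightarrow> 'b::{topological_space, zero}"
  assumes "f \<in> borel_measurable borel"
  shows "ext f \<in> borel_measurable pt_borel"
  using assms by (intro measurable_pt_borelI) (auto simp: ext_def)

text \<open>Open neighbourhoods of the cemetery pull back to complements of compact sets, which are
  open because the space is Hausdorff.\<close>

lemma measurable_Some_pt_borel: "Some \<in> borel \<rightarrow>\<^sub>M (pt_borel :: 'a::t2_space option measure)"
  unfolding pt_borel_def
proof (rule measurable_measure_of)
  fix U :: "'a option set" assume "U \<in> {U. openin pt_topology U}"
  then consider W where "open W" "U = Some ` W" | C where "compact C" "U = insert None (Some ` (UNIV - C))"
    by (auto simp: openin_Alexandroff_compactification)
  then have "open (Some -` U)"
  proof cases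
    case 1
    then have "Some -` U = W" by auto
    with 1 show ?thesis by simp
  next
    case 2
    then have "Some -` U = - C" by auto
    with 2 show ?thesis by (simp add: open_Compl compact_imp_closed)
  qed
  then show "Some -` U \<inter> space borel \<in> sets borel" by auto
qed auto

section \<open>The simple Markov property on the natural sigma-algebra\<close>

locale markov_process_t2 = markov_process \<Omega> M P X \<theta>
  for \<Omega> :: "'w set" and M
    and P :: "'a::t2_space option \<Rightarrow> 'w measure" and X and \<theta>
begin

lemma space_P: "space (P z) = \<Omega>"
  using sets_eq_imp_space_eq[OF sets_P] space_F by simp

lemma emeasure_P_UNIV: "emeasure (P z) \<Omega> = 1"
  using prob_space.emeasure_space_1[OF prob_space_P] by (simp add: space_P)

abbreviation "natural_infinity \<equiv> natural_filtration \<Omega> X \<infinity>"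

lemma space_natural: "space (natural_filtration \<Omega> X t) = \<Omega>"
  unfolding natural_filtration_def by (subst space_measure_of_conv) simp

lemma sets_natural: "sets (natural_filtration \<Omega> X t)
    = sigma_sets \<Omega> {X s -` B \<inter> \<Omega> | s B. s \<le> t \<and> B \<in> sets pt_borel}"
  unfolding natural_filtration_def by (rule sets_measure_of) auto

lemma sets_M_P: "S \<in> sets (M t) \<Longrightarrow> S \<in> sets (P z)"
  using sets_F_mono[of t \<infinity>] sets_P by auto

lemma measurable_M_P: "f \<in> M t \<rightarrow>\<^sub>M N \<Longrightarrow> f \<in> P z \<rightarrow>\<^sub>M N"
  using sets_F_mono[of t \<infinity>] sets_P space_P space_F by (auto simp: measurable_def)

lemma X_measurable: "X t \<in> P z \<rightarrow>\<^sub>M pt_borel"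
  by (rule measurable_M_P[OF adapted])

lemma vimage_X: "B \<in> sets pt_borel \<Longrightarrow> {\<omega> \<in> \<Omega>. X t \<omega> \<in> B} \<in> sets (M t)"
  using measurable_sets[OF adapted, of B t] by (simp add: space_F vimage_def Int_def conj_commute)

lemma natural_subset_M: "sets (natural_filtration \<Omega> X t) \<subseteq> sets (M t)"
  unfolding sets_natural
proof (rule sets.sigma_sets_subset[of _ "M t", unfolded space_F], safe)
  fix s and B :: "'a option set" assume "s \<le> t" "B \<in> sets pt_borel"
  then have "{\<omega> \<in> \<Omega>. X s \<omega> \<in> B} \<in> sets (M t)" using vimage_X sets_F_mono by blast
  then show "X s -` B \<inter> \<Omega> \<in> sets (M t)" by (simp add: vimage_def Int_def conj_commute)
qed

lemma measurable_natural_P: "f \<in> natural_infinity \<rightarrow>\<^sub>M N \<Longrightarrow> f \<in> P z \<rightarrow>\<^sub>M N"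
  using natural_subset_M[of \<infinity>] sets_P[of z] by (auto simp: measurable_def space_P space_natural)

text \<open>The shift is given only as a map of \<open>\<Omega>\<close>. Its measurability is forced
  by \<open>homogeneous\<close>: generators of the natural sigma-algebra pull back to
  generators.\<close>

lemma shift_measurable: "\<theta> t \<in> natural_infinity \<rightarrow>\<^sub>M natural_infinity"
  unfolding natural_filtration_def[of _ _ \<infinity>]
proof (rule measurable_measure_of)
  show "\<theta> t \<in> space (sigma \<Omega> {X s -` B \<inter> \<Omega> |s B. s \<le> \<infinity> \<and> B \<in> sets pt_borel}) \<rightarrow> \<Omega>"
    using shift_closed space_natural[of \<infinity>] by (auto simp: natural_filtration_def)
  fix S assume "S \<in> {X s -` B \<inter> \<Omega> |s B. s \<le> \<infinity> \<and> B \<in> sets pt_borel}"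
  then obtain s B where S: "S = X s -` B \<inter> \<Omega>" "B \<in> sets pt_borel" by blast
  have "\<theta> t -` S \<inter> \<Omega> = X (s + t) -` B \<inter> \<Omega>"
    using shift_closed homogeneous by (auto simp: S)
  also have "\<dots> \<in> sets natural_infinity"
    unfolding sets_natural using S by (intro sigma_sets.Basic) auto
  finally show "\<theta> t -` S \<inter> space (sigma \<Omega> {X s -` B \<inter> \<Omega> |s B. s \<le> \<infinity> \<and> B \<in> sets pt_borel})
      \<in> sets (sigma \<Omega> {X s -` B \<inter> \<Omega> |s B. s \<le> \<infinity> \<and> B \<in> sets pt_borel})"
    using space_natural[of \<infinity>] by (simp add: natural_filtration_def)
qed auto

lemma shift_measurable_P: "\<theta> t \<in> P z \<rightarrow>\<^sub>M natural_infinity"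
  by (rule measurable_natural_P[OF shift_measurable])

text \<open>The axiom \<open>kernel\<close> speaks of events away from the cemetery. A set
  containing \<open>None\<close> is handled through its complement and total mass 1.\<close>

lemma kernel_pt:
  assumes B: "B \<in> sets pt_borel"
  shows "(\<lambda>z. emeasure (P z) {\<omega>\<in>\<Omega>. X t \<omega> \<in> B}) \<in> borel_measurable pt_borel"
proof (rule measurable_pt_borelI)
  have SB: "Some -` B \<in> sets borel" "Some -` (UNIV - B) \<in> sets borel"
    using measurable_sets[OF measurable_Some_pt_borel B]
      measurable_sets[OF measurable_Some_pt_borel, of "UNIV - B"] sets.compl_sets[OF B] by auto
  show "(\<lambda>x. emeasure (P (Some x)) {\<omega> \<in> \<Omega>. X t \<omega> \<in> B}) \<in> borel_measurable borel"
  proof (cases "None \<in> B")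
    case False
    then have "z \<in> B \<longleftrightarrow> z \<in> Some ` (Some -` B)" for z by (cases z) auto
    then have "B = Some ` (Some -` B)" by blast
    then show ?thesis using kernel[OF SB(1), of t] by simp
  next
    case True
    then have "z \<in> UNIV - B \<longleftrightarrow> z \<in> Some ` (Some -` (UNIV - B))" for z by (cases z) auto
    then have *: "UNIV - B = Some ` (Some -` (UNIV - B))" by blast
    have "emeasure (P (Some x)) {\<omega> \<in> \<Omega>. X t \<omega> \<in> B} = 1 - emeasure (P (Some x)) {\<omega> \<in> \<Omega>. X t \<omega> \<in> UNIV - B}" for x
    proof -
      have "{\<omega> \<in> \<Omega>. X t \<omega> \<in> B} = \<Omega> - {\<omega> \<in> \<Omega>. X t \<omega> \<in> UNIV - B}" by auto
      moreover have "{\<omega> \<in> \<Omega>. X t \<omega> \<in> UNIV - B} \<in> sets (P (Some x))"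
        using sets.compl_sets[OF B] by (intro sets_M_P[OF vimage_X]) auto
      ultimately show ?thesis
        using emeasure_compl[of "{\<omega> \<in> \<Omega>. X t \<omega> \<in> UNIV - B}" "P (Some x)"]
          finite_measure.emeasure_finite[OF prob_space.finite_measure[OF prob_space_P]]
        by (simp add: space_P emeasure_P_UNIV)
    qed
    moreover have "(\<lambda>x. 1 - emeasure (P (Some x)) {\<omega> \<in> \<Omega>. X t \<omega> \<in> UNIV - B}) \<in> borel_measurable borel"
      using kernel[OF SB(2), of t] unfolding *[symmetric] by measurable
    ultimately show ?thesis by simp
  qed
qed simp

text \<open>Measurability of the mean in the starting point is bundled with the Markov identity,
  because the inner integral has to stay measurable in every closure step. Values in
  \<open>ennreal\<close> postpone all questions of integrability.\<close>

definition markov_fun :: "('w \<Rightarrow> ennreal) \<Rightarrow> bool" where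
  "markov_fun F \<longleftrightarrow> (\<lambda>z. \<integral>\<^sup>+\<omega>. F \<omega> \<partial>P z) \<in> borel_measurable pt_borel \<and>
    (\<forall>z t. \<forall>\<Lambda>\<in>sets (M t). (\<integral>\<^sup>+\<omega>\<in>\<Lambda>. F (\<theta> t \<omega>) \<partial>P z) = (\<integral>\<^sup>+\<omega>\<in>\<Lambda>. (\<integral>\<^sup>+\<omega>'. F \<omega>' \<partial>P (X t \<omega>)) \<partial>P z))"

lemma markov_fun_cong:
  assumes "\<And>\<omega>. \<omega> \<in> \<Omega> \<Longrightarrow> F \<omega> = G \<omega>"
  shows "markov_fun F \<longleftrightarrow> markov_fun G"
proof -
  have "(\<integral>\<^sup>+\<omega>. F \<omega> \<partial>P z) = (\<integral>\<^sup>+\<omega>. G \<omega> \<partial>P z)" for z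
    using assms by (intro nn_integral_cong) (simp add: space_P)
  moreover have "(\<integral>\<^sup>+\<omega>\<in>\<Lambda>. F (\<theta> t \<omega>) \<partial>P z) = (\<integral>\<^sup>+\<omega>\<in>\<Lambda>. G (\<theta> t \<omega>) \<partial>P z)" for z t \<Lambda>
    using assms shift_closed by (intro nn_integral_cong) (simp add: space_P)
  ultimately show ?thesis by (simp add: markov_fun_def)
qed

text \<open>The sub-sigma-algebra \<open>N\<close> is a parameter because the closure argument is
  run twice: for functions of a single coordinate and for the whole natural sigma-algebra.\<close>

lemma markov_fun_induct:
  assumes N: "space N = \<Omega>" "sets N \<subseteq> sets natural_infinity"
    and ind: "\<And>H. H \<in> sets N \<Longrightarrow> markov_fun (indicator H)"
    and F: "F \<in> borel_measurable N"
  shows "markov_fun F"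
  using F
proof (induction rule: borel_measurable_induct)
  have meas: "u \<in> borel_measurable (P z)" "(\<lambda>\<omega>. u (\<theta> t \<omega>)) \<in> borel_measurable (P z)"
    if "u \<in> borel_measurable N" for u :: "'w \<Rightarrow> ennreal" and z t
  proof -
    have u: "u \<in> borel_measurable natural_infinity"
      using that N by (auto simp: measurable_def space_natural)
    show "u \<in> borel_measurable (P z)" by (rule measurable_natural_P[OF u])
    show "(\<lambda>\<omega>. u (\<theta> t \<omega>)) \<in> borel_measurable (P z)"
      using measurable_compose[OF shift_measurable_P u] .
  qed
  have inner: "(\<lambda>\<omega>. \<integral>\<^sup>+\<omega>'. u \<omega>' \<partial>P (X t \<omega>)) \<in> borel_measurable (P z)" if "markov_fun u" for u z t
    using that measurable_compose[OF X_measurable] by (auto simp: markov_fun_def)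
  {
    case (cong f g)
    then show ?case using markov_fun_cong[of f g] N by simp
  next
    case (set A)
    then show ?case by (rule ind)
  next
    case (mult u c)
    show ?case
      unfolding markov_fun_def
    proof (intro conjI allI ballI)
      have "(\<lambda>z. c * (\<integral>\<^sup>+\<omega>. u \<omega> \<partial>P z)) \<in> borel_measurable pt_borel"
        using mult by (auto simp: markov_fun_def)
      then show "(\<lambda>z. \<integral>\<^sup>+\<omega>. c * u \<omega> \<partial>P z) \<in> borel_measurable pt_borel"
        by (simp add: nn_integral_cmult meas[OF mult(2)])
      fix z t \<Lambda> assume \<Lambda>: "\<Lambda> \<in> sets (M t)"
      note [measurable] = sets_M_P[OF \<Lambda>] meas[OF mult(2)] inner[OF mult.IH]
      show "(\<integral>\<^sup>+\<omega>\<in>\<Lambda>. c * u (\<theta> t \<omega>) \<partial>P z) = (\<integral>\<^sup>+\<omega>\<in>\<Lambda>. (\<integral>\<^sup>+\<omega>'. c * u \<omega>' \<partial>P (X t \<omega>)) \<partial>P z)"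
        using mult.IH \<Lambda> by (simp add: nn_integral_cmult mult.assoc markov_fun_def)
    qed
  next
    case (add u v)
    show ?case
      unfolding markov_fun_def
    proof (intro conjI allI ballI)
      have "(\<lambda>z. (\<integral>\<^sup>+\<omega>. v \<omega> \<partial>P z) + (\<integral>\<^sup>+\<omega>. u \<omega> \<partial>P z)) \<in> borel_measurable pt_borel"
        using add.IH by (auto simp: markov_fun_def)
      then show "(\<lambda>z. \<integral>\<^sup>+\<omega>. v \<omega> + u \<omega> \<partial>P z) \<in> borel_measurable pt_borel"
        by (simp add: nn_integral_add meas[OF add(1)] meas[OF add(3)])
      fix z t \<Lambda> assume \<Lambda>: "\<Lambda> \<in> sets (M t)"
      note [measurable] = sets_M_P[OF \<Lambda>] meas[OF add(1)] meas[OF add(3)] inner[OF add.IH(1)] inner[OF add.IH(2)]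
      show "(\<integral>\<^sup>+\<omega>\<in>\<Lambda>. (v (\<theta> t \<omega>) + u (\<theta> t \<omega>)) \<partial>P z) = (\<integral>\<^sup>+\<omega>\<in>\<Lambda>. (\<integral>\<^sup>+\<omega>'. v \<omega>' + u \<omega>' \<partial>P (X t \<omega>)) \<partial>P z)"
        using add.IH \<Lambda> by (simp add: nn_integral_add distrib_right markov_fun_def)
    qed
  next
    case (seq U)
    have SUP: "(\<integral>\<^sup>+\<omega>. (SUP i. U i \<omega>) \<partial>P z) = (SUP i. \<integral>\<^sup>+\<omega>. U i \<omega> \<partial>P z)" for z
      using seq by (intro nn_integral_monotone_convergence_SUP meas) auto
    have SUP_fun: "(SUP i. U i) = (\<lambda>\<omega>. SUP i. U i \<omega>)" by (auto simp: image_comp)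
    show ?case
      unfolding markov_fun_def SUP_fun SUP
    proof (intro conjI allI ballI)
      show "(\<lambda>z. SUP i. \<integral>\<^sup>+\<omega>. U i \<omega> \<partial>P z) \<in> borel_measurable pt_borel"
        using seq.IH unfolding markov_fun_def by (intro borel_measurable_SUP) auto
      fix z t \<Lambda> assume \<Lambda>: "\<Lambda> \<in> sets (M t)"
      note [measurable] = sets_M_P[OF \<Lambda>] meas[OF seq(1)] inner[OF seq.IH]
      have inc: "incseq (\<lambda>i \<omega>. U i (\<theta> t \<omega>) * indicator \<Lambda> \<omega>)"
        using seq by (auto simp: incseq_def le_fun_def indicator_def)
      have inc2: "incseq (\<lambda>i \<omega>. (\<integral>\<^sup>+\<omega>'. U i \<omega>' \<partial>P (X t \<omega>)) * indicator \<Lambda> \<omega>)"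
        using seq by (auto simp: incseq_def le_fun_def indicator_def intro!: nn_integral_mono)
      have "(\<integral>\<^sup>+\<omega>\<in>\<Lambda>. (SUP i. U i (\<theta> t \<omega>)) \<partial>P z) = (SUP i. \<integral>\<^sup>+\<omega>\<in>\<Lambda>. U i (\<theta> t \<omega>) \<partial>P z)"
        by (subst nn_integral_monotone_convergence_SUP[OF inc, symmetric])
           (auto simp: SUP_mult_right_ennreal intro!: borel_measurable_times)
      also have "\<dots> = (SUP i. \<integral>\<^sup>+\<omega>\<in>\<Lambda>. (\<integral>\<^sup>+\<omega>'. U i \<omega>' \<partial>P (X t \<omega>)) \<partial>P z)"
        using seq.IH \<Lambda> by (simp add: markov_fun_def)
      also have "\<dots> = (\<integral>\<^sup>+\<omega>\<in>\<Lambda>. (SUP i. \<integral>\<^sup>+\<omega>'. U i \<omega>' \<partial>P (X t \<omega>)) \<partial>P z)"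
        by (subst nn_integral_monotone_convergence_SUP[OF inc2, symmetric])
           (auto simp: SUP_mult_right_ennreal intro!: borel_measurable_times)
      finally show "(\<integral>\<^sup>+\<omega>\<in>\<Lambda>. (SUP i. U i (\<theta> t \<omega>)) \<partial>P z)
        = (\<integral>\<^sup>+\<omega>\<in>\<Lambda>. (SUP i. \<integral>\<^sup>+\<omega>'. U i \<omega>' \<partial>P (X t \<omega>)) \<partial>P z)" .
    qed
  }
qed

end

context markov_process_t2 begin

lemma nn_integral_shift_event:
  assumes H: "H \<in> sets natural_infinity" and \<Lambda>: "\<Lambda> \<in> sets (M t)"
  shows "(\<integral>\<^sup>+\<omega>\<in>\<Lambda>. indicator H (\<theta> t \<omega>) \<partial>P z) = emeasure (P z) (\<Lambda> \<inter> {\<omega> \<in> \<Omega>. \<theta> t \<omega> \<in> H})"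
    and "\<Lambda> \<inter> {\<omega> \<in> \<Omega>. \<theta> t \<omega> \<in> H} \<in> sets (P z)"
proof -
  have "{\<omega> \<in> \<Omega>. \<theta> t \<omega> \<in> H} \<in> sets (P z)"
    using measurable_sets[OF shift_measurable_P H, of t z] by (simp add: space_P vimage_def Int_def conj_commute)
  then show S: "\<Lambda> \<inter> {\<omega> \<in> \<Omega>. \<theta> t \<omega> \<in> H} \<in> sets (P z)"
    using sets_M_P[OF \<Lambda>] by blast
  have "(\<integral>\<^sup>+\<omega>\<in>\<Lambda>. indicator H (\<theta> t \<omega>) \<partial>P z) = (\<integral>\<^sup>+\<omega>. indicator (\<Lambda> \<inter> {\<omega> \<in> \<Omega>. \<theta> t \<omega> \<in> H}) \<omega> \<partial>P z)"
    by (intro nn_integral_cong) (auto simp: space_P indicator_def)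
  then show "(\<integral>\<^sup>+\<omega>\<in>\<Lambda>. indicator H (\<theta> t \<omega>) \<partial>P z) = emeasure (P z) (\<Lambda> \<inter> {\<omega> \<in> \<Omega>. \<theta> t \<omega> \<in> H})"
    using S by simp
qed

lemma natural_sets_P: "H \<in> sets natural_infinity \<Longrightarrow> H \<in> sets (P z)"
  using natural_subset_M[of \<infinity>] sets_P by auto

lemma markov_fun_indicator:
  assumes H: "H \<in> sets natural_infinity"
  shows "markov_fun (indicator H) \<longleftrightarrow> (\<lambda>z. emeasure (P z) H) \<in> borel_measurable pt_borel \<and>
    (\<forall>z t. \<forall>\<Lambda>\<in>sets (M t). emeasure (P z) (\<Lambda> \<inter> {\<omega> \<in> \<Omega>. \<theta> t \<omega> \<in> H})
      = (\<integral>\<^sup>+\<omega>\<in>\<Lambda>. emeasure (P (X t \<omega>)) H \<partial>P z))"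
  unfolding markov_fun_def
  using nn_integral_shift_event(1)[OF H] natural_sets_P[OF H]
  by simp

lemma vimage_X_natural: "B \<in> sets pt_borel \<Longrightarrow> {\<omega> \<in> \<Omega>. X t \<omega> \<in> B} \<in> sets natural_infinity"
  unfolding sets_natural by (intro sigma_sets.Basic) (auto intro!: exI[of _ t] exI[of _ B])

lemma markov_fun_X:
  assumes B: "B \<in> sets pt_borel"
  shows "markov_fun (indicator {\<omega> \<in> \<Omega>. X s \<omega> \<in> B})"
  unfolding markov_fun_indicator[OF vimage_X_natural[OF B]]
proof (intro conjI allI ballI)
  fix z t \<Lambda> assume \<Lambda>: "\<Lambda> \<in> sets (M t)"
  have "{\<omega> \<in> \<Omega>. \<theta> t \<omega> \<in> {\<omega> \<in> \<Omega>. X s \<omega> \<in> B}} = {\<omega> \<in> \<Omega>. X (t + s) \<omega> \<in> B}"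
    using shift_closed homogeneous by (auto simp: add.commute)
  then show "emeasure (P z) (\<Lambda> \<inter> {\<omega> \<in> \<Omega>. \<theta> t \<omega> \<in> {\<omega> \<in> \<Omega>. X s \<omega> \<in> B}})
      = (\<integral>\<^sup>+\<omega>\<in>\<Lambda>. emeasure (P (X t \<omega>)) {\<omega> \<in> \<Omega>. X s \<omega> \<in> B} \<partial>P z)"
    using markov[OF \<Lambda> B, of z s] by simp
qed (rule kernel_pt[OF B])

lemma markov_fun_X_fun:
  assumes g: "g \<in> borel_measurable pt_borel"
  shows "markov_fun (\<lambda>\<omega>. g (X s \<omega>))"
proof (rule markov_fun_induct)
  let ?N = "vimage_algebra \<Omega> (X s) pt_borel"
  show "sets ?N \<subseteq> sets natural_infinity"
    unfolding sets_vimage_algebra2[of "X s" \<Omega> pt_borel, simplified]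
    using vimage_X_natural[of _ s] by (auto simp: vimage_def Int_def conj_commute)
  show "markov_fun (indicator H)" if "H \<in> sets ?N" for H
    using that markov_fun_X[of _ s] unfolding sets_vimage_algebra2[of "X s" \<Omega> pt_borel, simplified]
    by (auto simp: vimage_def Int_def conj_commute)
  show "(\<lambda>\<omega>. g (X s \<omega>)) \<in> borel_measurable ?N"
    by (rule measurable_compose[OF measurable_vimage_algebra1 g]) auto
qed simp

definition cylinder :: "ennreal set \<Rightarrow> (ennreal \<Rightarrow> 'a option set) \<Rightarrow> 'w set" where
  "cylinder I B = {\<omega> \<in> \<Omega>. \<forall>s\<in>I. X s \<omega> \<in> B s}"

lemma cylinder_natural:
  assumes "finite I" "\<And>s. B s \<in> sets pt_borel"
  shows "cylinder I B \<in> sets natural_infinity"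
  using assms(1)
proof induction
  case empty
  then show ?case using sets.top[of natural_infinity] by (simp add: cylinder_def space_natural)
next
  case (insert s I)
  have "cylinder (insert s I) B = {\<omega> \<in> \<Omega>. X s \<omega> \<in> B s} \<inter> cylinder I B"
    by (auto simp: cylinder_def)
  then show ?case using insert vimage_X_natural[OF assms(2)] by auto
qed

text \<open>Induction on the number of times: split off the first one and shift the others.\<close>

lemma markov_fun_cylinder:
  assumes "finite I" "\<And>s. B s \<in> sets pt_borel"
  shows "markov_fun (indicator (cylinder I B))"
  using assms
proof (induction "card I" arbitrary: I B)
  case 0
  then have "markov_fun (indicator (cylinder I B)) \<longleftrightarrow> markov_fun (\<lambda>_. 1)"
    by (intro markov_fun_cong) (auto simp: cylinder_def)
  also have "markov_fun (\<lambda>_. 1)"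
    using prob_space.emeasure_space_1[OF prob_space_P] by (simp add: markov_fun_def)
  finally show ?case .
next
  case (Suc n)
  define a where "a = Min I"
  have I: "I \<noteq> {}" using Suc by auto
  have a: "a \<in> I" "\<And>s. s \<in> I \<Longrightarrow> a \<le> s" using Suc I by (auto simp: a_def)
  \<comment> \<open>These are the waiting times after the first one. Adding \<open>a\<close>
    recovers the old times even in \<open>ennreal\<close>, as \<open>a\<close> is the least of
    them.\<close>
  define I' where "I' = (\<lambda>s. s - a) ` (I - {a})"
  define H where "H = cylinder I' (\<lambda>r. B (a + r))"
  have inj: "inj_on (\<lambda>s. s - a) (I - {a})"
  proof (rule inj_onI)
    fix s t assume "s \<in> I - {a}" "t \<in> I - {a}" "s - a = t - a"
    then have "a + (s - a) = a + (t - a)" "a \<le> s" "a \<le> t" using a by auto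
    then show "s = t" by (simp add: add_diff_inverse_ennreal)
  qed
  have "card I' = n"
    using Suc a by (simp add: I'_def card_image[OF inj])
  then have H: "markov_fun (indicator H)"
    unfolding H_def using Suc by (intro Suc.hyps(1)) (auto simp: I'_def)
  have H_nat: "H \<in> sets natural_infinity"
    unfolding H_def using Suc by (intro cylinder_natural) (auto simp: I'_def)
  have a_s: "a + (s - a) = s" if "s \<in> I" for s using a(2)[OF that] by (rule add_diff_inverse_ennreal)
  have split: "cylinder I B = {\<omega> \<in> \<Omega>. X a \<omega> \<in> B a} \<inter> {\<omega> \<in> \<Omega>. \<theta> a \<omega> \<in> H}"
  proof -
    have "\<theta> a \<omega> \<in> H \<longleftrightarrow> (\<forall>s\<in>I - {a}. X s \<omega> \<in> B s)" if "\<omega> \<in> \<Omega>" for \<omega>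
    proof -
      have "\<theta> a \<omega> \<in> H \<longleftrightarrow> (\<forall>s\<in>I - {a}. X (a + (s - a)) \<omega> \<in> B (a + (s - a)))"
        using that shift_closed[OF that] homogeneous[OF that]
        by (simp add: H_def I'_def cylinder_def add.commute)
      then show ?thesis by (simp add: a_s)
    qed
    then show ?thesis using a(1) by (auto simp: cylinder_def)
  qed
  \<comment> \<open>\<open>g\<close> compresses all times to one: given the position at the first
    time, the later times contribute the probability of the shifted cylinder.\<close>
  define g where "g z = indicator (B a) z * emeasure (P z) H" for z
  have [measurable]: "g \<in> borel_measurable pt_borel"
    using H Suc(4)[of a] unfolding g_def markov_fun_indicator[OF H_nat] by (intro borel_measurable_times_ennreal) auto
  have eq: "emeasure (P z) (\<Lambda> \<inter> {\<omega> \<in> \<Omega>. \<theta> t \<omega> \<in> cylinder I B}) = (\<integral>\<^sup>+\<omega>\<in>\<Lambda>. g (X a (\<theta> t \<omega>)) \<partial>P z)"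
    if \<Lambda>: "\<Lambda> \<in> sets (M t)" for z t \<Lambda>
  proof -
    have "\<Lambda> \<inter> {\<omega> \<in> \<Omega>. \<theta> t \<omega> \<in> cylinder I B}
        = (\<Lambda> \<inter> {\<omega> \<in> \<Omega>. X (t + a) \<omega> \<in> B a}) \<inter> {\<omega> \<in> \<Omega>. \<theta> (t + a) \<omega> \<in> H}"
    proof -
      have "\<theta> a (\<theta> t \<omega>) \<in> H \<longleftrightarrow> \<theta> (t + a) \<omega> \<in> H" if "\<omega> \<in> \<Omega>" for \<omega>
        using that shift_closed[OF that] homogeneous[OF that] homogeneous[OF shift_closed[OF that]] shift_closed[OF shift_closed[OF that]]
        by (simp add: H_def cylinder_def add.assoc add.commute add.left_commute)
      then show ?thesis unfolding split
        using shift_closed homogeneous by (auto simp: add.commute)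
    qed
    also have "emeasure (P z) \<dots> = (\<integral>\<^sup>+\<omega>\<in>(\<Lambda> \<inter> {\<omega> \<in> \<Omega>. X (t + a) \<omega> \<in> B a}). emeasure (P (X (t + a) \<omega>)) H \<partial>P z)"
    proof -
      \<comment> \<open>The past is enlarged to time t + a, so the first constraint becomes part of
        the conditioning event and the induction hypothesis for \<open>H\<close> applies
        there.\<close>
      have "\<Lambda> \<in> sets (M (t + a))" using \<Lambda> sets_F_mono[of t "t + a"] by auto
      then have "\<Lambda> \<inter> {\<omega> \<in> \<Omega>. X (t + a) \<omega> \<in> B a} \<in> sets (M (t + a))"
        using vimage_X[OF Suc(4)] by blast
      then show ?thesis using H unfolding markov_fun_indicator[OF H_nat] by blast
    qed
    also have "\<dots> = (\<integral>\<^sup>+\<omega>\<in>\<Lambda>. g (X a (\<theta> t \<omega>)) \<partial>P z)"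
      using homogeneous by (intro nn_integral_cong) (auto simp: g_def indicator_def space_P add.commute)
    finally show ?thesis .
  qed
  have g_X: "markov_fun (\<lambda>\<omega>. g (X a \<omega>))" by (rule markov_fun_X_fun) measurable
  have eq_z: "emeasure (P z) (cylinder I B) = (\<integral>\<^sup>+\<omega>. g (X a \<omega>) \<partial>P z)" for z
  proof -
    have "{\<omega> \<in> \<Omega>. X a \<omega> \<in> B a} \<in> sets (M a)" by (rule vimage_X[OF Suc(4)])
    then have "emeasure (P z) (cylinder I B) = (\<integral>\<^sup>+\<omega>\<in>{\<omega> \<in> \<Omega>. X a \<omega> \<in> B a}. emeasure (P (X a \<omega>)) H \<partial>P z)"
      using H unfolding split markov_fun_indicator[OF H_nat] by blast
    also have "\<dots> = (\<integral>\<^sup>+\<omega>. g (X a \<omega>) \<partial>P z)"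
      by (intro nn_integral_cong) (auto simp: g_def indicator_def space_P)
    finally show ?thesis .
  qed
  show ?case
    unfolding markov_fun_indicator[OF cylinder_natural[OF Suc(3) Suc(4)]]
    using g_X eq unfolding markov_fun_def eq_z by simp
qed

lemma natural_cylinders: "sets natural_infinity
  = sigma_sets \<Omega> {cylinder I B | I B. finite I \<and> (\<forall>s. B s \<in> sets pt_borel)}"
  (is "_ = sigma_sets \<Omega> ?G")
proof
  show "sets natural_infinity \<subseteq> sigma_sets \<Omega> ?G"
    unfolding sets_natural
  proof (rule sigma_sets_mono, safe)
    fix s and B :: "'a option set" assume "B \<in> sets pt_borel"
    moreover have "X s -` B \<inter> \<Omega> = cylinder {s} (\<lambda>_. B)" by (auto simp: cylinder_def)
    ultimately show "X s -` B \<inter> \<Omega> \<in> sigma_sets \<Omega> ?G" by (intro sigma_sets.Basic) blast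
  qed
  have "?G \<subseteq> sets natural_infinity" using cylinder_natural by auto
  then show "sigma_sets \<Omega> ?G \<subseteq> sets natural_infinity"
    using sets.sigma_sets_subset[of ?G natural_infinity] by (simp add: space_natural)
qed

text \<open>Cylinders are stable under intersection, so Dynkin's argument applies: complements use
  that the measures are finite with mass 1, disjoint unions use countable additivity.\<close>

lemma markov_fun_natural_set:
  assumes "H \<in> sets natural_infinity"
  shows "markov_fun (indicator H)"
proof -
  let ?G = "{cylinder I B | I B. finite I \<and> (\<forall>s. B s \<in> sets pt_borel)}"
  have "Int_stable ?G"
  proof (rule Int_stableI, clarify)
    fix I J :: "ennreal set" and B C :: "ennreal \<Rightarrow> 'a option set"
    assume *: "finite I" "finite J" "\<forall>s. B s \<in> sets pt_borel" "\<forall>s. C s \<in> sets pt_borel"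
    have "cylinder I B \<inter> cylinder J C = cylinder (I \<union> J)
        (\<lambda>s. (if s \<in> I then B s else UNIV) \<inter> (if s \<in> J then C s else UNIV))"
      by (auto simp: cylinder_def split: if_splits)
    moreover have "(if s \<in> I then B s else UNIV) \<inter> (if s \<in> J then C s else UNIV) \<in> sets pt_borel" for s
      using * sets.top[of "pt_borel :: 'a option measure"] by auto
    ultimately show "\<exists>I' B'. cylinder I B \<inter> cylinder J C = cylinder I' B' \<and> finite I' \<and> (\<forall>s. B' s \<in> sets pt_borel)"
      using * by blast
  qed
  moreover have "?G \<subseteq> Pow \<Omega>" by (auto simp: cylinder_def)
  moreover have "H \<in> sigma_sets \<Omega> ?G" using assms unfolding natural_cylinders .
  ultimately show ?thesis
  proof (induction rule: sigma_sets_induct_disjoint)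
    case (basic A)
    then show ?case using markov_fun_cylinder by auto
  next
    case empty
    then show ?case by (simp add: markov_fun_def)
  next
    case (compl A)
    then have A: "A \<in> sets natural_infinity" unfolding natural_cylinders by blast
    then have cA: "\<Omega> - A \<in> sets natural_infinity" using sets.compl_sets[OF A] by (simp add: space_natural)
    have em: "emeasure (P z) (\<Omega> - A) = 1 - emeasure (P z) A" for z
      using emeasure_compl[OF natural_sets_P[OF A], of z]
        finite_measure.emeasure_finite[OF prob_space.finite_measure[OF prob_space_P]]
      by (simp add: space_P emeasure_P_UNIV)
    have mA: "(\<lambda>z. emeasure (P z) A) \<in> borel_measurable pt_borel"
      using compl.IH by (simp add: markov_fun_indicator[OF A])
    show ?case
      unfolding markov_fun_indicator[OF cA] em
    proof (intro conjI allI ballI)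
      show "(\<lambda>z. 1 - emeasure (P z) A) \<in> borel_measurable pt_borel" using mA by measurable
      fix z t \<Lambda> assume \<Lambda>: "\<Lambda> \<in> sets (M t)"
      note \<Lambda>P [measurable] = sets_M_P[OF \<Lambda>, of z]
      have [measurable]: "(\<lambda>\<omega>. emeasure (P (X t \<omega>)) A) \<in> borel_measurable (P z)"
        by (rule measurable_compose[OF X_measurable mA])
      have le1: "emeasure (P y) A \<le> 1" for y
        by (rule prob_space.emeasure_le_1[OF prob_space_P])
      have IH: "emeasure (P z) (\<Lambda> \<inter> {\<omega> \<in> \<Omega>. \<theta> t \<omega> \<in> A}) = (\<integral>\<^sup>+\<omega>\<in>\<Lambda>. emeasure (P (X t \<omega>)) A \<partial>P z)"
        using compl.IH \<Lambda> by (simp add: markov_fun_indicator[OF A])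
      have fin: "emeasure (P z) S \<noteq> \<infinity>" for S
        using finite_measure.emeasure_finite[OF prob_space.finite_measure[OF prob_space_P]] by simp
      have "\<Lambda> \<inter> {\<omega> \<in> \<Omega>. \<theta> t \<omega> \<in> \<Omega> - A} = \<Lambda> - (\<Lambda> \<inter> {\<omega> \<in> \<Omega>. \<theta> t \<omega> \<in> A})"
        using shift_closed sets.sets_into_space[OF \<Lambda>P] by (auto simp: space_P)
      then have "emeasure (P z) (\<Lambda> \<inter> {\<omega> \<in> \<Omega>. \<theta> t \<omega> \<in> \<Omega> - A})
          = emeasure (P z) \<Lambda> - emeasure (P z) (\<Lambda> \<inter> {\<omega> \<in> \<Omega>. \<theta> t \<omega> \<in> A})"
        using fin nn_integral_shift_event(2)[OF A \<Lambda>] by (simp add: emeasure_Diff)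
      also have "\<dots> = (\<integral>\<^sup>+\<omega>\<in>\<Lambda>. 1 \<partial>P z) - (\<integral>\<^sup>+\<omega>\<in>\<Lambda>. emeasure (P (X t \<omega>)) A \<partial>P z)"
        by (simp add: IH)
      also have "\<dots> = (\<integral>\<^sup>+\<omega>. 1 * indicator \<Lambda> \<omega> - emeasure (P (X t \<omega>)) A * indicator \<Lambda> \<omega> \<partial>P z)"
        using fin[of "\<Lambda> \<inter> {\<omega> \<in> \<Omega>. \<theta> t \<omega> \<in> A}"] le1
        by (intro nn_integral_diff[symmetric]) (auto simp: IH indicator_def intro!: AE_I2)
      also have "\<dots> = (\<integral>\<^sup>+\<omega>\<in>\<Lambda>. (1 - emeasure (P (X t \<omega>)) A) \<partial>P z)"
        by (intro nn_integral_cong) (auto simp: indicator_def)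
      finally show "emeasure (P z) (\<Lambda> \<inter> {\<omega> \<in> \<Omega>. \<theta> t \<omega> \<in> \<Omega> - A}) = (\<integral>\<^sup>+\<omega>\<in>\<Lambda>. (1 - emeasure (P (X t \<omega>)) A) \<partial>P z)" .
    qed
  next
    case (union A)
    then have A: "A i \<in> sets natural_infinity" for i unfolding natural_cylinders by blast
    then have UA: "(\<Union>i. A i) \<in> sets natural_infinity" by auto
    have em: "emeasure (P z) (\<Union>i. A i) = (\<Sum>i. emeasure (P z) (A i))" for z
      using natural_sets_P[OF A] union(1) by (intro suminf_emeasure[symmetric]) auto
    have mA: "(\<lambda>z. emeasure (P z) (A i)) \<in> borel_measurable pt_borel" for i
      using union.IH by (simp add: markov_fun_indicator[OF A])
    show ?case
      unfolding markov_fun_indicator[OF UA] em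
    proof (intro conjI allI ballI)
      show "(\<lambda>z. \<Sum>i. emeasure (P z) (A i)) \<in> borel_measurable pt_borel" using mA by measurable
      fix z t \<Lambda> assume \<Lambda>: "\<Lambda> \<in> sets (M t)"
      note [measurable] = sets_M_P[OF \<Lambda>, of z]
      have [measurable]: "(\<lambda>\<omega>. emeasure (P (X t \<omega>)) (A i)) \<in> borel_measurable (P z)" for i
        by (rule measurable_compose[OF X_measurable mA])
      have "\<Lambda> \<inter> {\<omega> \<in> \<Omega>. \<theta> t \<omega> \<in> (\<Union>i. A i)} = (\<Union>i. \<Lambda> \<inter> {\<omega> \<in> \<Omega>. \<theta> t \<omega> \<in> A i})" by auto
      also have "emeasure (P z) \<dots> = (\<Sum>i. emeasure (P z) (\<Lambda> \<inter> {\<omega> \<in> \<Omega>. \<theta> t \<omega> \<in> A i}))"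
        using nn_integral_shift_event(2)[OF A \<Lambda>] union(1)
        by (intro suminf_emeasure[symmetric]) (auto simp: disjoint_family_on_def set_eq_iff)
      also have "\<dots> = (\<Sum>i. \<integral>\<^sup>+\<omega>\<in>\<Lambda>. emeasure (P (X t \<omega>)) (A i) \<partial>P z)"
        using union.IH \<Lambda> by (simp add: markov_fun_indicator[OF A])
      also have "\<dots> = (\<integral>\<^sup>+\<omega>\<in>\<Lambda>. (\<Sum>i. emeasure (P (X t \<omega>)) (A i)) \<partial>P z)"
        by (subst nn_integral_suminf[symmetric]) auto
      finally show "emeasure (P z) (\<Lambda> \<inter> {\<omega> \<in> \<Omega>. \<theta> t \<omega> \<in> (\<Union>i. A i)})
        = (\<integral>\<^sup>+\<omega>\<in>\<Lambda>. (\<Sum>i. emeasure (P (X t \<omega>)) (A i)) \<partial>P z)" .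
    qed
  qed
qed

theorem markov_fun_natural: "F \<in> borel_measurable natural_infinity \<Longrightarrow> markov_fun F"
  by (rule markov_fun_induct[of natural_infinity]) (auto simp: space_natural markov_fun_natural_set)

end

section \<open>Functionals measurable for the augmentation\<close>

lemma (in prob_space) expectation_abs_le:
  fixes f :: "'a \<Rightarrow> real"
  assumes "AE x in M. \<bar>f x\<bar> \<le> C" "0 \<le> C"
  shows "\<bar>expectation f\<bar> \<le> C"
proof (cases "integrable M f")
  case True
  have "\<bar>expectation f\<bar> \<le> expectation (\<lambda>x. \<bar>f x\<bar>)" by (rule integral_abs_bound)
  also have "\<dots> \<le> C" using True assms by (intro integral_le_const) auto
  finally show ?thesis .
qed (use assms in \<open>simp add: not_integrable_integral_eq\<close>)

context markov_process_t2 begin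

lemma space_augmented: "space (augmented_filtration \<Omega> P X t) = \<Omega>"
  unfolding augmented_filtration_def by (rule space_measure_of) auto

text \<open>By the Markov property, the law of the shifted path under \<open>P z\<close> is the
  mixture of the measures \<open>P y\<close> over the law of \<open>X t\<close>. The augmentation
  quantifies over all finite initial measures and may be tested with this one; the exceptional set
  is then null for the law of the shifted path.\<close>

lemma augmented_subset_completion:
  "sets (augmented_filtration \<Omega> P X \<infinity>) \<subseteq> sets (completion (distr (P z) natural_infinity (\<theta> t)))"
  unfolding augmented_filtration_def
proof (subst sets_measure_of)
  let ?Q = "distr (P z) natural_infinity (\<theta> t)"
  let ?G = "{\<Lambda>. \<Lambda> \<subseteq> \<Omega> \<and>
     (\<forall>\<nu>. finite_measure \<nu> \<longrightarrow> sets \<nu> = sets pt_borel \<longrightarrow>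
        (\<exists>\<Lambda>'\<in>sets natural_infinity. \<exists>N\<in>sets natural_infinity.
           (\<Lambda> - \<Lambda>') \<union> (\<Lambda>' - \<Lambda>) \<subseteq> N \<and> (\<integral>\<^sup>+z. emeasure (P z) N \<partial>\<nu>) = 0))}"
  show "?G \<subseteq> Pow \<Omega>" by auto
  have "?G \<subseteq> sets (completion ?Q)"
  proof
    fix \<Lambda> assume "\<Lambda> \<in> ?G"
    moreover have "finite_measure (distr (P z) pt_borel (X t))"
      by (intro finite_measure.finite_measure_distr prob_space.finite_measure prob_space_P X_measurable)
    ultimately obtain \<Lambda>' N where N: "\<Lambda>' \<in> sets natural_infinity" "N \<in> sets natural_infinity"
        "(\<Lambda> - \<Lambda>') \<union> (\<Lambda>' - \<Lambda>) \<subseteq> N" "(\<integral>\<^sup>+z. emeasure (P z) N \<partial>distr (P z) pt_borel (X t)) = 0"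
      by (auto dest!: spec[of _ "distr (P z) pt_borel (X t)"])
    have mN: "markov_fun (indicator N)" by (rule markov_fun_natural_set[OF N(2)])
    have "emeasure (P z) (\<Omega> \<inter> {\<omega> \<in> \<Omega>. \<theta> t \<omega> \<in> N}) = (\<integral>\<^sup>+\<omega>\<in>\<Omega>. emeasure (P (X t \<omega>)) N \<partial>P z)"
      using mN sets.top[of "M t"] unfolding markov_fun_indicator[OF N(2)] by (auto simp: space_F)
    also have "\<dots> = (\<integral>\<^sup>+\<omega>. emeasure (P (X t \<omega>)) N \<partial>P z)"
      by (intro nn_integral_cong) (auto simp: space_P)
    also have "\<dots> = (\<integral>\<^sup>+z. emeasure (P z) N \<partial>distr (P z) pt_borel (X t))"
      using mN unfolding markov_fun_indicator[OF N(2)] by (subst nn_integral_distr) (auto intro: X_measurable)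
    finally have "emeasure (P z) (\<Omega> \<inter> {\<omega> \<in> \<Omega>. \<theta> t \<omega> \<in> N}) = 0" using N(4) by simp
    moreover have "\<theta> t -` N \<inter> space (P z) = \<Omega> \<inter> {\<omega> \<in> \<Omega>. \<theta> t \<omega> \<in> N}" by (auto simp: space_P)
    ultimately have null: "N \<in> null_sets ?Q"
      using N(2) by (intro null_setsI) (simp_all only: emeasure_distr[OF shift_measurable_P N(2)] sets_distr)
    have "\<Lambda> = (\<Lambda>' - N) \<union> (\<Lambda> \<inter> N)" using N(3) by blast
    then show "\<Lambda> \<in> sets (completion ?Q)"
      by (rule sets_completionI[OF _ _ null]) (use N in auto)
  qed
  then show "sigma_sets \<Omega> ?G \<subseteq> sets (completion ?Q)"
    using sets.sigma_sets_subset[of ?G "completion ?Q"] by (simp add: space_natural)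
qed

text \<open>\<open>Z\<close> is replaced by a function \<open>W\<close> measurable for the natural
  sigma-algebra. The exceptional set \<open>N\<close> is null for the law of the shifted path, hence
  also for \<open>P (X t \<omega>)\<close> at almost every \<open>\<omega>\<close>. The first fact
  identifies \<open>Zt\<close>, a measurable stand-in for \<open>Z\<close> after the shift, with
  \<open>W\<close> after the shift; the second identifies \<open>V (X t \<omega>)\<close> with the
  mean of \<open>W\<close>.\<close>

theorem markov_augmented:
  fixes Z :: "'w \<Rightarrow> real" and V :: "'a option \<Rightarrow> real"
  assumes Z: "Z \<in> borel_measurable (augmented_filtration \<Omega> P X \<infinity>)" "\<And>\<omega>. \<bar>Z \<omega>\<bar> \<le> C"
    and V: "\<And>z. V z = (\<integral>\<omega>. Z \<omega> \<partial>P z)" "V \<in> borel_measurable pt_borel"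
    and Z_P: "\<And>z. Z \<in> borel_measurable (P z)"
    and Zt: "Zt \<in> borel_measurable (P z)" "AE \<omega> in P z. Z (\<theta> t \<omega>) = Zt \<omega>"
    and Y: "Y \<in> borel_measurable (M t)" "integrable (P z) Y"
  shows "(\<integral>\<omega>. Y \<omega> * Zt \<omega> \<partial>P z) = (\<integral>\<omega>. Y \<omega> * V (X t \<omega>) \<partial>P z)"
proof -
  let ?Q = "distr (P z) natural_infinity (\<theta> t)"
  interpret prob_space "P z" by (rule prob_space_P)
  have C0: "0 \<le> C" using order_trans[OF abs_ge_zero Z(2)] .
  have "Z \<in> borel_measurable (completion ?Q)"
    using Z(1) augmented_subset_completion[of z t]
    by (auto simp: measurable_def space_augmented space_natural)
  from completion_ex_borel_measurable_real[OF this] obtain Z' where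
    Z': "Z' \<in> borel_measurable natural_infinity" "AE \<omega> in ?Q. Z \<omega> = Z' \<omega>" by auto
  \<comment> \<open>Clamping makes the bound hold everywhere and keeps the almost sure equality,
    because \<open>Z\<close> itself obeys the bound.\<close>
  define W where "W \<omega> = max (- C) (min C (Z' \<omega>))" for \<omega>
  have W: "W \<in> borel_measurable natural_infinity" unfolding W_def using Z'(1) by measurable
  have W_bound: "\<bar>W \<omega>\<bar> \<le> C" for \<omega> using C0 by (auto simp: W_def)
  have "AE \<omega> in ?Q. Z \<omega> = W \<omega>"
    using Z'(2)
  proof eventually_elim
    fix \<omega> assume "Z \<omega> = Z' \<omega>"
    then show "Z \<omega> = W \<omega>" using Z(2)[of \<omega>] by (auto simp: W_def abs_le_iff)
  qed
  then obtain N where N: "N \<in> null_sets ?Q" "{\<omega> \<in> \<Omega>. Z \<omega> \<noteq> W \<omega>} \<subseteq> N"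
    by (auto elim!: AE_E simp: space_natural null_sets_def)
  have N_nat: "N \<in> sets natural_infinity" using N(1) by auto
  have ev: "\<Omega> \<inter> {\<omega> \<in> \<Omega>. \<theta> t \<omega> \<in> N} \<in> sets (P z)"
    using nn_integral_shift_event(2)[OF N_nat, of \<Omega> t z] sets.top[of "M t"] by (simp add: space_F)
  have zero: "emeasure (P z) (\<Omega> \<inter> {\<omega> \<in> \<Omega>. \<theta> t \<omega> \<in> N}) = 0"
  proof -
    have "\<theta> t -` N \<inter> space (P z) = \<Omega> \<inter> {\<omega> \<in> \<Omega>. \<theta> t \<omega> \<in> N}" by (auto simp: space_P)
    then show ?thesis
      using null_setsD1[OF N(1)] by (simp only: emeasure_distr[OF shift_measurable_P N_nat])
  qed
  have mN: "markov_fun (indicator N)" by (rule markov_fun_natural_set[OF N_nat])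
  have AE1: "AE \<omega> in P z. Zt \<omega> = W (\<theta> t \<omega>)"
  proof -
    have "AE \<omega> in P z. \<omega> \<notin> \<Omega> \<inter> {\<omega> \<in> \<Omega>. \<theta> t \<omega> \<in> N}"
      by (rule AE_not_in) (use ev zero in auto)
    then show ?thesis using Zt(2) AE_space
    proof eventually_elim
      case (elim \<omega>)
      then show ?case using N(2) shift_closed[of \<omega> t] by (auto simp: space_P)
    qed
  qed
  have AE2: "AE \<omega> in P z. V (X t \<omega>) = (\<integral>\<omega>'. W \<omega>' \<partial>P (X t \<omega>))"
  proof -
    have "(\<integral>\<^sup>+\<omega>. emeasure (P (X t \<omega>)) N \<partial>P z) = (\<integral>\<^sup>+\<omega>\<in>\<Omega>. emeasure (P (X t \<omega>)) N \<partial>P z)"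
      by (intro nn_integral_cong) (auto simp: space_P)
    also have "\<dots> = 0"
      using mN zero sets.top[of "M t"] unfolding markov_fun_indicator[OF N_nat] by (auto simp: space_F)
    finally have "AE \<omega> in P z. emeasure (P (X t \<omega>)) N = 0"
      using mN measurable_compose[OF X_measurable] unfolding markov_fun_indicator[OF N_nat]
      by (subst (asm) nn_integral_0_iff_AE) auto
    then show ?thesis
    proof eventually_elim
      case (elim \<omega>)
      have "AE \<omega>' in P (X t \<omega>). \<omega>' \<notin> N"
        by (rule AE_not_in) (use elim natural_sets_P[OF N_nat] in auto)
      then have "AE \<omega>' in P (X t \<omega>). Z \<omega>' = W \<omega>'"
        using AE_space by eventually_elim (use N(2) in \<open>auto simp: space_P\<close>)
      then show ?case
        unfolding V(1) using Z_P measurable_natural_P[OF W] by (intro integral_cong_AE) auto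
    qed
  qed
  have W_int: "integrable (P y) W" for y
  proof -
    interpret y: prob_space "P y" by (rule prob_space_P)
    show ?thesis using W_bound measurable_natural_P[OF W]
      by (intro y.integrable_const_bound[where B = C]) auto
  qed
  have V_bound: "\<bar>V y\<bar> \<le> C" for y
  proof -
    interpret y: prob_space "P y" by (rule prob_space_P)
    show ?thesis unfolding V(1) by (rule y.expectation_abs_le) (use Z(2) C0 in auto)
  qed
  have VX: "(\<lambda>\<omega>. V (X t \<omega>)) \<in> borel_measurable (M t)"
    by (rule measurable_compose[OF adapted V(2)])
  have Zt_bound: "AE \<omega> in P z. \<bar>Zt \<omega>\<bar> \<le> C"
    using AE1 by eventually_elim (use W_bound in auto)
  have Zt_int: "integrable (P z) Zt"
    using Zt(1) Zt_bound by (intro integrable_const_bound[where B = C]) auto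
  have VX_int: "integrable (P z) (\<lambda>\<omega>. V (X t \<omega>))"
    using measurable_M_P[OF VX] V_bound by (intro integrable_const_bound[where B = C]) auto
  interpret sub: finite_measure_subalgebra "P z" "M t"
    by unfold_locales (auto simp: subalgebra_def space_P space_F intro: sets_M_P)
  \<comment> \<open>The Markov identity is available for events of \<open>M t\<close>; recognising
    the conditional expectation extends it to integrable weights \<open>Y\<close> at once.\<close>
  have "AE \<omega> in P z. real_cond_exp (P z) (M t) Zt \<omega> = V (X t \<omega>)"
  proof (rule sub.real_cond_exp_charact[OF _ Zt_int VX_int VX])
    fix \<Lambda> assume \<Lambda>: "\<Lambda> \<in> sets (M t)"
    note \<Lambda>P [measurable] = sets_M_P[OF \<Lambda>, of z]
    \<comment> \<open>Adding \<open>C\<close> makes the function nonnegative, as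
      \<open>markov_fun\<close> needs \<open>ennreal\<close> values. The same amount
      \<open>C * prob \<Lambda>\<close> appears on both sides and cancels at the end.\<close>
    let ?F = "\<lambda>\<omega>. ennreal (W \<omega> + C)"
    have F: "?F \<in> borel_measurable natural_infinity" using W by measurable
    have eq: "(\<integral>\<^sup>+\<omega>\<in>\<Lambda>. ?F (\<theta> t \<omega>) \<partial>P z) = (\<integral>\<^sup>+\<omega>\<in>\<Lambda>. (\<integral>\<^sup>+\<omega>'. ?F \<omega>' \<partial>P (X t \<omega>)) \<partial>P z)"
      using markov_fun_natural[OF F] \<Lambda> by (auto simp: markov_fun_def)
    have "(\<integral>\<^sup>+\<omega>. ennreal (indicator \<Lambda> \<omega> * (Zt \<omega> + C)) \<partial>P z) = (\<integral>\<^sup>+\<omega>\<in>\<Lambda>. ?F (\<theta> t \<omega>) \<partial>P z)"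
      using AE1 by (intro nn_integral_cong_AE) (auto elim!: eventually_mono simp: indicator_def)
    also have "\<dots> = (\<integral>\<^sup>+\<omega>. ennreal (indicator \<Lambda> \<omega> * (V (X t \<omega>) + C)) \<partial>P z)"
      unfolding eq
    proof (intro nn_integral_cong_AE, use AE2 in eventually_elim)
      case (elim \<omega>)
      interpret y: prob_space "P (X t \<omega>)" by (rule prob_space_P)
      have "(\<integral>\<^sup>+\<omega>'. ?F \<omega>' \<partial>P (X t \<omega>)) = ennreal (\<integral>\<omega>'. W \<omega>' + C \<partial>P (X t \<omega>))"
      proof (rule nn_integral_eq_integral)
        have "0 \<le> W \<omega>' + C" for \<omega>' using W_bound[of \<omega>'] by linarith
        then show "AE \<omega>' in P (X t \<omega>). 0 \<le> W \<omega>' + C" by simp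
      qed (use W_int in simp)
      also have "\<dots> = ennreal (V (X t \<omega>) + C)" using W_int elim by (simp add: y.prob_space)
      finally show ?case by (simp add: indicator_def)
    qed
    finally have "(\<integral>\<^sup>+\<omega>. ennreal (indicator \<Lambda> \<omega> * (Zt \<omega> + C)) \<partial>P z)
      = (\<integral>\<^sup>+\<omega>. ennreal (indicator \<Lambda> \<omega> * (V (X t \<omega>) + C)) \<partial>P z)" .
    moreover have "(\<integral>\<^sup>+\<omega>. ennreal (indicator \<Lambda> \<omega> * (G \<omega> + C)) \<partial>P z)
        = ennreal ((\<integral>\<omega>\<in>\<Lambda>. G \<omega> \<partial>P z) + C * prob \<Lambda>)"
      and "0 \<le> (\<integral>\<omega>\<in>\<Lambda>. G \<omega> \<partial>P z) + C * prob \<Lambda>"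
      if G: "integrable (P z) G" "AE \<omega> in P z. \<bar>G \<omega>\<bar> \<le> C" for G
    proof -
      have i1: "integrable (P z) (\<lambda>\<omega>. indicator \<Lambda> \<omega> * G \<omega>)"
        using integrable_mult_indicator[OF \<Lambda>P G(1)] by simp
      have i2: "integrable (P z) (\<lambda>\<omega>. indicator \<Lambda> \<omega> * C)"
        by (intro integrable_mult_left integrable_real_indicator) (simp_all add: \<Lambda>P emeasure_eq_measure)
      have i: "integrable (P z) (\<lambda>\<omega>. indicator \<Lambda> \<omega> * (G \<omega> + C))"
        using Bochner_Integration.integrable_add[OF i1 i2] by (simp add: distrib_left)
      have pos: "AE \<omega> in P z. 0 \<le> indicator \<Lambda> \<omega> * (G \<omega> + C)"
        using G(2) by eventually_elim (auto simp: indicator_def abs_le_iff)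
      have e: "(\<integral>\<omega>. indicator \<Lambda> \<omega> * (G \<omega> + C) \<partial>P z) = (\<integral>\<omega>\<in>\<Lambda>. G \<omega> \<partial>P z) + C * prob \<Lambda>"
        using Bochner_Integration.integral_add[OF i1 i2]
        by (simp add: distrib_left set_lebesgue_integral_def mult.commute)
      show "(\<integral>\<^sup>+\<omega>. ennreal (indicator \<Lambda> \<omega> * (G \<omega> + C)) \<partial>P z) = ennreal ((\<integral>\<omega>\<in>\<Lambda>. G \<omega> \<partial>P z) + C * prob \<Lambda>)"
        unfolding e[symmetric] by (rule nn_integral_eq_integral[OF i pos])
      show "0 \<le> (\<integral>\<omega>\<in>\<Lambda>. G \<omega> \<partial>P z) + C * prob \<Lambda>"
        unfolding e[symmetric] by (rule integral_nonneg_AE[OF pos])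
    qed
    ultimately show "(\<integral>\<omega>\<in>\<Lambda>. Zt \<omega> \<partial>P z) = (\<integral>\<omega>\<in>\<Lambda>. V (X t \<omega>) \<partial>P z)"
      using Zt_int Zt_bound VX_int V_bound by simp
  qed
  then have "(\<integral>\<omega>. Y \<omega> * real_cond_exp (P z) (M t) Zt \<omega> \<partial>P z) = (\<integral>\<omega>. Y \<omega> * V (X t \<omega>) \<partial>P z)"
    using measurable_M_P[OF VX, of z] measurable_M_P[OF Y(1), of z]
    by (intro integral_cong_AE) (auto elim!: eventually_mono)
  moreover have "integrable (P z) (\<lambda>\<omega>. Y \<omega> * Zt \<omega>)"
  proof (rule Bochner_Integration.integrable_bound)
    show "integrable (P z) (\<lambda>\<omega>. C * Y \<omega>)" using Y(2) by simp
    show "AE \<omega> in P z. norm (Y \<omega> * Zt \<omega>) \<le> norm (C * Y \<omega>)"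
      using Zt_bound
    proof eventually_elim
      case (elim \<omega>)
      then show ?case using C0 mult_right_mono[OF elim, of "\<bar>Y \<omega>\<bar>"] by (simp add: abs_mult mult.commute)
    qed
  qed (use Y Zt measurable_M_P[OF Y(1), of z] in auto)
  ultimately show ?thesis
    using sub.real_cond_exp_intg(2)[OF _ Y(1) Zt(1)] by simp
qed

end

section \<open>Uniform convergence of potentials\<close>

lemma radon_integrable_compact_support:
  fixes \<phi> :: "'a::t2_space \<Rightarrow> real"
  assumes \<mu>: "radon \<mu>" and \<phi>: "continuous_on UNIV \<phi>" "compact (closure {x. \<phi> x \<noteq> 0})"
  shows "integrable \<mu> \<phi>"
proof -
  let ?K = "closure {x. \<phi> x \<noteq> 0}"
  have sets: "sets \<mu> = sets borel" and fin: "emeasure \<mu> ?K < \<infinity>"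
    using \<mu> \<phi>(2) by (auto simp: radon_def)
  have "bounded (\<phi> ` ?K)"
    by (intro compact_imp_bounded compact_continuous_image continuous_on_subset[OF \<phi>(1)] \<phi>(2)) auto
  then obtain B where B: "\<And>x. x \<in> ?K \<Longrightarrow> \<bar>\<phi> x\<bar> \<le> B"
    unfolding bounded_iff real_norm_def by blast
  show ?thesis
  proof (rule integrableI_bounded_set[where A = ?K and B = B])
    show "?K \<in> sets \<mu>" using sets by simp
    show "\<phi> \<in> borel_measurable \<mu>"
      using borel_measurable_continuous_onI[OF \<phi>(1)] sets by (simp cong: measurable_cong_sets)
    show "AE x in \<mu>. x \<in> ?K \<longrightarrow> norm (\<phi> x) \<le> B" using B by auto
    show "AE x in \<mu>. x \<notin> ?K \<longrightarrow> \<phi> x = 0"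
      using closure_subset[of "{x. \<phi> x \<noteq> 0}"] by (intro AE_I2) auto
  qed (rule fin)
qed

lemma compact_closureI:
  fixes A :: "'a::t2_space set"
  assumes "A \<subseteq> K" "compact K"
  shows "compact (closure A)"
proof -
  have "closure A \<subseteq> K" using assms by (intro closure_minimal compact_imp_closed)
  then have "closure A = closure A \<inter> K" by blast
  then show ?thesis using closed_Int_compact[OF closed_closure assms(2)] by metis
qed

text \<open>The Lindelof property thins out the cover by relatively compact open sets to a countable
  one, and finite unions make it increasing. These sets cut the kernel minorants down to compact
  support.\<close>

lemma locally_compact_relatively_compact_exhaustion:
  assumes "locally compact (UNIV :: 'a::{metric_space, second_countable_topology} set)"
  obtains W where "\<And>k::nat. open (W k :: 'a set)" "\<And>k. compact (closure (W k))"
    "incseq W" "(\<Union>k. W k) = UNIV"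
proof -
  let ?F = "{U :: 'a set. open U \<and> compact (closure U)}"
  have "\<Union>?F = UNIV"
  proof (intro equalityI subsetI UNIV_I)
    fix x :: 'a
    obtain u v where uv: "open u" "x \<in> u" "u \<subseteq> v" "compact v"
      using assms by (auto simp: locally_def) (metis UNIV_I open_UNIV)
    then have "compact (closure u)" by (intro compact_closureI[of u v])
    then show "x \<in> \<Union>?F" using uv by blast
  qed
  moreover obtain F' where F': "F' \<subseteq> ?F" "countable F'" "\<Union>F' = \<Union>?F"
    by (rule Lindelof[of ?F]) auto
  ultimately have U: "\<Union>F' = UNIV" by simp
  have ne: "F' \<noteq> {}" using U by auto
  define V where "V = from_nat_into F'"
  have V: "V j \<in> F'" for j unfolding V_def by (rule from_nat_into[OF ne])
  have V_range: "range V = F'" unfolding V_def by (rule range_from_nat_into[OF ne F'(2)])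
  show thesis
  proof (rule that[of "\<lambda>k. \<Union>j\<le>k. V j"])
    show "open (\<Union>j\<le>k. V j)" for k using V F'(1) by auto
    show "compact (closure (\<Union>j\<le>k. V j))" for k
    proof (rule compact_closureI)
      show "(\<Union>j\<le>k. V j) \<subseteq> (\<Union>j\<le>k. closure (V j))" using closure_subset by blast
      show "compact (\<Union>j\<le>k. closure (V j))" using V F'(1) by (intro compact_UN) auto
    qed
    show "incseq (\<lambda>k. \<Union>j\<le>k. V j)" by (force simp: incseq_def)
    show "(\<Union>k. \<Union>j\<le>k. V j) = UNIV" using U V_range by blast
  qed
qed

text \<open>The Lipschitz functions \<open>g\<close> below are inf-convolutions of truncations of the kernel.
  Subtracting \<open>1 / k\<close> makes the estimate stable under small changes of the first argument.\<close>

lemma lsc_kernel_minorants: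
  fixes G :: "'a::{metric_space, second_countable_topology} \<Rightarrow> 'a \<Rightarrow> ennreal" and x :: 'a
  assumes lsc: "lower_semicontinuous (\<lambda>(x, y). G x y)"
    and lc: "locally compact (UNIV :: 'a set)"
  obtains \<phi> :: "nat \<Rightarrow> 'a \<Rightarrow> real" and \<delta> :: "nat \<Rightarrow> real"
  where "\<And>k. continuous_on UNIV (\<phi> k)" "\<And>k. compact (closure {y. \<phi> k y \<noteq> 0})"
    "\<And>k y. 0 \<le> \<phi> k y" "\<And>k. 0 < \<delta> k"
    "\<And>k x' y. dist x x' < \<delta> k \<Longrightarrow> ennreal (\<phi> k y) \<le> G x' y"
    "\<And>y. G x y \<le> liminf (\<lambda>k. ennreal (\<phi> k y))"
proof -
  obtain W :: "nat \<Rightarrow> 'a set" where W: "\<And>k. open (W k)" "\<And>k. compact (closure (W k))"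
    "incseq W" "(\<Union>k. W k) = UNIV"
    by (rule locally_compact_relatively_compact_exhaustion[OF lc]) blast
  \<comment> \<open>Cutting at height \<open>k\<close> and outside \<open>W k\<close> makes the
    kernel bounded and of compact support in the second variable; both cuts are released as
    \<open>k\<close> grows.\<close>
  define H where "H k x' y' = (if y' \<in> W k then enn2real (min (G x' y') (of_nat k)) else 0)" for k x' y'
  have H_nn: "0 \<le> H k x' y'" for k x' y' by (simp add: H_def)
  have H_le: "ennreal (H k x' y') \<le> G x' y'" for k x' y'
  proof -
    have "min (G x' y') (of_nat k) < \<top>" by (simp add: min_less_iff_disj of_nat_less_top)
    then show ?thesis by (simp add: H_def)
  qed
  let ?q = "\<lambda>k y p. H k (fst p) (snd p) + real (Suc k) * (dist x (fst p) + dist y (snd p))"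
  define g where "g k y = (INF p. ?q k y p)" for k y
  have bdd: "bdd_below (range (?q k y))" for k y
    using H_nn by (intro bdd_belowI[where m = 0]) auto
  have g_le: "g k y \<le> ?q k y p" for k y p
    unfolding g_def by (rule cINF_lower[OF bdd]) simp
  have g_ge: "m \<le> g k y" if "\<And>p. m \<le> ?q k y p" for m k y
    unfolding g_def by (rule cINF_greatest) (use that in auto)
  have g_lip: "g k y \<le> g k z + real (Suc k) * dist y z" for k y z
  proof -
    have "g k y - real (Suc k) * dist y z \<le> g k z"
    proof (rule g_ge)
      fix p
      have "g k y \<le> ?q k y p" by (rule g_le)
      also have "\<dots> \<le> H k (fst p) (snd p) + real (Suc k) * (dist x (fst p) + (dist y z + dist z (snd p)))"
        by (intro add_left_mono mult_left_mono dist_triangle) auto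
      finally show "g k y - real (Suc k) * dist y z \<le> ?q k z p" by (simp add: algebra_simps)
    qed
    then show ?thesis by simp
  qed
  have g_cont: "continuous_on UNIV (g k)" for k
  proof (rule lipschitz_on_continuous_on)
    show "(real (Suc k))-lipschitz_on UNIV (g k)"
    proof (rule lipschitz_onI)
      fix y z
      show "dist (g k y) (g k z) \<le> real (Suc k) * dist y z"
        using g_lip[of k y z] g_lip[of k z y] by (simp add: dist_real_def dist_commute[of z y] abs_le_iff)
    qed simp
  qed
  define \<phi> where "\<phi> k y = max 0 (g k y - 1 / real (Suc k))" for k y
  \<comment> \<open>The penalty constant \<open>Suc k\<close> times this radius is
    \<open>1 / Suc k\<close>, exactly the amount subtracted in \<open>\<phi>\<close>.\<close>
  define \<delta> where "\<delta> k = 1 / (real (Suc k) * real (Suc k))" for k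
  show thesis
  proof (rule that[of \<phi> \<delta>])
    show "continuous_on UNIV (\<phi> k)" for k
      unfolding \<phi>_def by (intro continuous_intros g_cont)
    show "0 \<le> \<phi> k y" for k y by (simp add: \<phi>_def)
    show "0 < \<delta> k" for k by (simp add: \<delta>_def)
    show "compact (closure {y. \<phi> k y \<noteq> 0})" for k
    proof -
      have "\<phi> k y = 0" if "y \<notin> W k" for y
      proof -
        have "g k y \<le> 0" using g_le[of k y "(x, y)"] that by (simp add: H_def)
        moreover have "0 \<le> 1 / real (Suc k)" by simp
        ultimately show ?thesis unfolding \<phi>_def by linarith
      qed
      then have "{y. \<phi> k y \<noteq> 0} \<subseteq> W k" by blast
      then show ?thesis using closure_subset[of "W k"] by (intro compact_closureI[OF _ W(2)]) blast
    qed
    show "ennreal (\<phi> k y) \<le> G x' y" if "dist x x' < \<delta> k" for k x' y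
    proof -
      have "real (Suc k) * dist x x' \<le> real (Suc k) * \<delta> k" using that by (intro mult_left_mono) auto
      also have "\<dots> = 1 / real (Suc k)" by (simp add: \<delta>_def)
      finally have "g k y - 1 / real (Suc k) \<le> H k x' y" using g_le[of k y "(x', y)"] by simp
      then have "\<phi> k y \<le> H k x' y" using H_nn[of k x' y] by (simp add: \<phi>_def)
      then have "ennreal (\<phi> k y) \<le> ennreal (H k x' y)" by (rule ennreal_leI)
      also have "\<dots> \<le> G x' y" by (rule H_le)
      finally show ?thesis .
    qed
    show "G x y \<le> liminf (\<lambda>k. ennreal (\<phi> k y))" for y
    proof (rule dense_le)
      fix e assume "e < G x y"
      then obtain e' where e': "e < e'" "e' < G x y" using dense by blast
      then obtain d where d: "e' = ennreal d" "0 \<le> d"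
        by (cases e') auto
      have "open {p. ennreal d < (\<lambda>(x, y). G x y) p}"
        using lsc by (simp add: lower_semicontinuous_def)
      moreover have "(x, y) \<in> {p. ennreal d < (\<lambda>(x, y). G x y) p}" using e' d by simp
      ultimately obtain A B where AB: "open A" "open B" "(x, y) \<in> A \<times> B"
          "A \<times> B \<subseteq> {p. ennreal d < (\<lambda>(x, y). G x y) p}"
        by (rule open_prod_elim)
      obtain j where j: "y \<in> W j" using W(4) by blast
      obtain r1 where r1: "0 < r1" "\<And>x'. dist x x' < r1 \<Longrightarrow> x' \<in> A"
        using AB by (auto simp: open_dist) (metis dist_commute)
      have "open (B \<inter> W j)" "y \<in> B \<inter> W j" using AB j W(1) by auto
      then obtain r2 where r2: "0 < r2" "\<And>y'. dist y y' < r2 \<Longrightarrow> y' \<in> B \<inter> W j"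
        unfolding open_dist by (metis dist_commute)
      define r where "r = min r1 r2"
      have r: "0 < r" using r1 r2 by (simp add: r_def)
      obtain N where N: "d / r < real N" "d < real N"
        using reals_Archimedean2[of "max (d / r) d"] by auto
      \<comment> \<open>A competitor \<open>p\<close> either lies in the neighbourhood where lower
        semicontinuity keeps the kernel above \<open>d\<close>, or pays a penalty of at least
        \<open>real (Suc k) * r\<close>, which is at least \<open>d\<close> for these
        \<open>k\<close>.\<close>
      have ge: "d - 1 / real (Suc k) \<le> \<phi> k y" if k: "max N j \<le> k" for k
      proof -
        have "d \<le> g k y"
        proof (rule g_ge)
          fix p :: "'a \<times> 'a"
          have kr: "d \<le> real (Suc k) * r"
          proof -
            have "d \<le> real N * r" using N r by (simp add: field_simps)
            also have "\<dots> \<le> real (Suc k) * r" using k r by (intro mult_right_mono) auto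
            finally show ?thesis .
          qed
          show "d \<le> ?q k y p"
          proof (cases "dist x (fst p) < r \<and> dist y (snd p) < r")
            case True
            then have p: "fst p \<in> A" "snd p \<in> B" "snd p \<in> W j"
              using r1(2)[of "fst p"] r2(2)[of "snd p"] by (auto simp: r_def)
            then have G: "ennreal d < G (fst p) (snd p)" using AB(4) by (auto dest!: subsetD[of _ _ p] simp: mem_Times_iff split_beta)
            have "snd p \<in> W k" using p(3) W(3) k by (auto simp: incseq_def)
            moreover have "ennreal d \<le> min (G (fst p) (snd p)) (of_nat k)"
            proof -
              have "d \<le> real k" using N k by linarith
              then have "ennreal d \<le> of_nat k" by (simp add: ennreal_of_nat_eq_real_of_nat ennreal_leI)
              then show ?thesis using G by simp
            qed
            then have "enn2real (ennreal d) \<le> enn2real (min (G (fst p) (snd p)) (of_nat k))"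
              by (rule enn2real_mono) (simp add: min_less_iff_disj of_nat_less_top)
            ultimately have "d \<le> H k (fst p) (snd p)" using d by (simp add: H_def)
            then show ?thesis by (simp add: add_increasing2)
          next
            case False
            then have "r \<le> dist x (fst p) + dist y (snd p)"
              using zero_le_dist[of x "fst p"] zero_le_dist[of y "snd p"] by linarith
            then have "real (Suc k) * r \<le> real (Suc k) * (dist x (fst p) + dist y (snd p))"
              by (intro mult_left_mono) auto
            then show ?thesis using kr H_nn[of k "fst p" "snd p"] by linarith
          qed
        qed
        then show ?thesis by (simp add: \<phi>_def)
      qed
      have "(\<lambda>k. ennreal (d - 1 / real (Suc k))) \<longlonglongrightarrow> ennreal d"
      proof (rule tendsto_ennrealI)
        show "(\<lambda>k. d - 1 / real (Suc k)) \<longlonglongrightarrow> d" by real_asymp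
      qed
      then have "eventually (\<lambda>k. e < ennreal (d - 1 / real (Suc k))) sequentially"
        using e' d by (intro order_tendstoD(1)) auto
      then have "eventually (\<lambda>k. e \<le> ennreal (\<phi> k y)) sequentially"
        using eventually_ge_at_top[of "max N j"]
      proof eventually_elim
        case (elim k)
        then have "ennreal (d - 1 / real (Suc k)) \<le> ennreal (\<phi> k y)" by (intro ennreal_leI ge)
        then show ?case using elim by simp
      qed
      then show "e \<le> liminf (\<lambda>k. ennreal (\<phi> k y))" by (rule Liminf_bounded)
    qed
  qed
qed

text \<open>Fatou's lemma for the limit measure yields one minorant whose integral already exceeds
  \<open>c\<close>. To this single test function vague convergence applies, and its stability in the
  first argument gives the bound on a whole ball. The bound is one-sided, since passing to a
  minorant of the kernel can only lose mass.\<close>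

lemma potential_lower_bound:
  fixes G :: "'a::{metric_space, second_countable_topology} \<Rightarrow> 'a \<Rightarrow> ennreal"
  assumes lsc: "lower_semicontinuous (\<lambda>(x, y). G x y)"
    and lc: "locally compact (UNIV :: 'a set)"
    and \<mu>: "\<And>n. radon (\<mu> n)" and \<nu>: "radon \<nu>" and vague: "vague_convergence \<mu> \<nu>"
    and f: "continuous_on UNIV f" "\<And>y. 0 \<le> f y"
    and c: "c < (\<integral>\<^sup>+y. G x y * ennreal (f y) \<partial>\<nu>)"
  shows "\<exists>\<delta>>0. \<exists>N. \<forall>n\<ge>N. \<forall>x'. dist x x' < \<delta> \<longrightarrow> c < (\<integral>\<^sup>+y. G x' y * ennreal (f y) \<partial>\<mu> n)"
proof -
  obtain \<phi> :: "nat \<Rightarrow> 'a \<Rightarrow> real" and \<delta> :: "nat \<Rightarrow> real"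
  where \<phi>: "\<And>k. continuous_on UNIV (\<phi> k)" "\<And>k. compact (closure {y. \<phi> k y \<noteq> 0})"
    "\<And>k y. 0 \<le> \<phi> k y" "\<And>k. 0 < \<delta> k"
    "\<And>k x' y. dist x x' < \<delta> k \<Longrightarrow> ennreal (\<phi> k y) \<le> G x' y"
    "\<And>y. G x y \<le> liminf (\<lambda>k. ennreal (\<phi> k y))"
    by (rule lsc_kernel_minorants[OF lsc lc, of x]) blast
  let ?h = "\<lambda>k y. \<phi> k y * f y"
  have h_cont: "continuous_on UNIV (?h k)" for k by (intro continuous_intros \<phi> f)
  have h_supp: "compact (closure {y. ?h k y \<noteq> 0})" for k
  proof -
    have "{y. ?h k y \<noteq> 0} \<subseteq> {y. \<phi> k y \<noteq> 0}" by auto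
    then show ?thesis using closure_subset[of "{y. \<phi> k y \<noteq> 0}"] by (intro compact_closureI[OF _ \<phi>(2)]) blast
  qed
  have h_meas: "?h k \<in> borel_measurable M" if "sets M = sets borel" for k M
    using borel_measurable_continuous_onI[OF h_cont] that by (simp cong: measurable_cong_sets)
  have nn_eq: "(\<integral>\<^sup>+y. ennreal (?h k y) \<partial>M) = ennreal (\<integral>y. ?h k y \<partial>M)" if "radon M" for k M
    using radon_integrable_compact_support[OF that h_cont h_supp] \<phi>(3) f(2)
    by (intro nn_integral_eq_integral) auto
  have "c < (\<integral>\<^sup>+y. G x y * ennreal (f y) \<partial>\<nu>)" by (rule c)
  also have "\<dots> \<le> (\<integral>\<^sup>+y. liminf (\<lambda>k. ennreal (?h k y)) \<partial>\<nu>)"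
  proof (intro nn_integral_mono)
    fix y
    have "G x y * ennreal (f y) \<le> liminf (\<lambda>k. ennreal (\<phi> k y)) * ennreal (f y)"
      by (intro mult_right_mono \<phi>(6)) auto
    also have "\<dots> \<le> liminf (\<lambda>k. ennreal (\<phi> k y) * ennreal (f y))"
    proof (rule eq_refl, rule Liminf_compose_continuous_mono[symmetric])
      have "continuous_on UNIV (\<lambda>z. ennreal (f y) * z)"
        by (intro ennreal_continuous_on_cmult continuous_on_id) simp
      then show "continuous_on UNIV (\<lambda>z. z * ennreal (f y))" by (simp add: mult.commute)
    qed (auto simp: mono_def intro: mult_right_mono)
    finally show "G x y * ennreal (f y) \<le> liminf (\<lambda>k. ennreal (?h k y))"
      using \<phi>(3) f(2) by (simp add: ennreal_mult)
  qed
  also have "\<dots> \<le> liminf (\<lambda>k. \<integral>\<^sup>+y. ennreal (?h k y) \<partial>\<nu>)"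
    using h_meas \<nu> by (intro nn_integral_liminf) (auto simp: radon_def)
  finally have "eventually (\<lambda>k. c < (\<integral>\<^sup>+y. ennreal (?h k y) \<partial>\<nu>)) sequentially"
    by (simp add: less_LiminfD)
  then obtain k where k: "c < ennreal (\<integral>y. ?h k y \<partial>\<nu>)"
    unfolding nn_eq[OF \<nu>] by (auto dest: eventually_happens)
  have "(\<lambda>n. ennreal (\<integral>y. ?h k y \<partial>\<mu> n)) \<longlonglongrightarrow> ennreal (\<integral>y. ?h k y \<partial>\<nu>)"
    using vague h_cont h_supp by (intro tendsto_ennrealI) (auto simp: vague_convergence_def)
  from order_tendstoD(1)[OF this k] obtain N where N: "\<And>n. N \<le> n \<Longrightarrow> c < ennreal (\<integral>y. ?h k y \<partial>\<mu> n)"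
    by (auto simp: eventually_sequentially)
  have "c < (\<integral>\<^sup>+y. G x' y * ennreal (f y) \<partial>\<mu> n)" if "N \<le> n" "dist x x' < \<delta> k" for n x'
  proof -
    have "c < (\<integral>\<^sup>+y. ennreal (?h k y) \<partial>\<mu> n)" using N[OF that(1)] by (simp add: nn_eq[OF \<mu>])
    also have "\<dots> \<le> (\<integral>\<^sup>+y. G x' y * ennreal (f y) \<partial>\<mu> n)"
      using \<phi>(5)[OF that(2)] \<phi>(3) f(2) by (intro nn_integral_mono) (auto simp: ennreal_mult intro: mult_right_mono)
    finally show ?thesis .
  qed
  then show ?thesis using \<phi>(4) by blast
qed

section \<open>Two-sided convergence of real-valued potentials\<close>

definition real_potential :: "('a \<Rightarrow> 'a \<Rightarrow> ennreal) \<Rightarrow> 'a measure \<Rightarrow> ('a \<Rightarrow> real) \<Rightarrow> 'a \<Rightarrow> real" where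
  "real_potential G \<mu> f x = enn2real (\<integral>\<^sup>+y. G x y * ennreal (f y) \<partial>\<mu>)"

lemma lsc_borel_measurable_section:
  fixes G :: "'a::{metric_space, second_countable_topology} \<Rightarrow> 'a \<Rightarrow> ennreal"
  assumes "lower_semicontinuous (\<lambda>(x, y). G x y)"
  shows "G x \<in> borel_measurable borel"
proof (rule borel_measurableI_greater)
  fix e
  have "open ((\<lambda>y. (x, y)) -` {p. e < (\<lambda>(x, y). G x y) p})"
    using assms by (intro open_vimage continuous_intros) (simp add: lower_semicontinuous_def)
  moreover have "(\<lambda>y. (x, y)) -` {p. e < (\<lambda>(x, y). G x y) p} = {y \<in> space borel. e < G x y}" by auto
  ultimately show "{y \<in> space borel. e < G x y} \<in> sets borel" by simp
qed

context
  fixes G :: "'a::{metric_space, second_countable_topology} \<Rightarrow> 'a \<Rightarrow> ennreal"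
  assumes lsc: "lower_semicontinuous (\<lambda>(x, y). G x y)"
    and lc: "locally compact (UNIV :: 'a set)"
begin

lemma potential_finite:
  assumes f: "\<And>y. f y \<le> 1" and fin: "(\<integral>\<^sup>+y. G x y \<partial>\<mu>) < \<infinity>"
  shows "(\<integral>\<^sup>+y. G x y * ennreal (f y) \<partial>\<mu>) = ennreal (real_potential G \<mu> f x)"
    and "real_potential G \<mu> f x \<le> real_potential G \<mu> (\<lambda>_. 1) x"
proof -
  have le: "(\<integral>\<^sup>+y. G x y * ennreal (f y) \<partial>\<mu>) \<le> (\<integral>\<^sup>+y. G x y * ennreal 1 \<partial>\<mu>)"
    using f by (intro nn_integral_mono mult_left_mono ennreal_leI) auto
  then show "(\<integral>\<^sup>+y. G x y * ennreal (f y) \<partial>\<mu>) = ennreal (real_potential G \<mu> f x)"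
    using fin unfolding real_potential_def by (subst ennreal_enn2real) (auto intro: order_le_less_trans)
  show "real_potential G \<mu> f x \<le> real_potential G \<mu> (\<lambda>_. 1) x"
    unfolding real_potential_def using le fin by (intro enn2real_mono) auto
qed

lemma real_potential_nonneg: "0 \<le> real_potential G \<mu> f x"
  by (simp add: real_potential_def)

lemma real_potential_complement:
  assumes \<mu>: "sets \<mu> = sets borel" and f: "continuous_on UNIV f" "\<And>y. 0 \<le> f y" "\<And>y. f y \<le> 1"
    and fin: "(\<integral>\<^sup>+y. G x y \<partial>\<mu>) < \<infinity>"
  shows "real_potential G \<mu> f x + real_potential G \<mu> (\<lambda>y. 1 - f y) x = real_potential G \<mu> (\<lambda>_. 1) x"
proof -
  have Gm [measurable]: "G x \<in> borel_measurable \<mu>"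
    using lsc_borel_measurable_section[OF lsc] \<mu> by (simp cong: measurable_cong_sets)
  have fm [measurable]: "f \<in> borel_measurable \<mu>"
    using borel_measurable_continuous_onI[OF f(1)] \<mu> by (simp cong: measurable_cong_sets)
  have "(\<integral>\<^sup>+y. G x y * ennreal 1 \<partial>\<mu>) = (\<integral>\<^sup>+y. G x y * ennreal (f y) + G x y * ennreal (1 - f y) \<partial>\<mu>)"
  proof (intro nn_integral_cong)
    fix y
    have "ennreal 1 = ennreal (f y) + ennreal (1 - f y)"
      using f(2,3)[of y] by (subst ennreal_plus[symmetric]) auto
    then show "G x y * ennreal 1 = G x y * ennreal (f y) + G x y * ennreal (1 - f y)"
      by (simp only: distrib_left)
  qed
  also have "\<dots> = (\<integral>\<^sup>+y. G x y * ennreal (f y) \<partial>\<mu>) + (\<integral>\<^sup>+y. G x y * ennreal (1 - f y) \<partial>\<mu>)"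
    by (intro nn_integral_add) measurable
  finally have "ennreal (real_potential G \<mu> (\<lambda>_. 1) x)
      = ennreal (real_potential G \<mu> f x) + ennreal (real_potential G \<mu> (\<lambda>y. 1 - f y) x)"
    using potential_finite(1)[of "\<lambda>_. 1", OF _ fin] potential_finite(1)[OF f(3) fin]
      potential_finite(1)[of "\<lambda>y. 1 - f y", OF _ fin] f(2) by simp
  then show ?thesis
    using real_potential_nonneg by (simp add: ennreal_plus[symmetric] del: ennreal_plus)
qed

lemma real_potential_lower:
  assumes \<mu>: "\<And>n. radon (\<mu> n)" "radon \<nu>" "vague_convergence \<mu> \<nu>"
    and fin: "\<And>n x. (\<integral>\<^sup>+y. G x y \<partial>\<mu> n) < \<infinity>" "\<And>x. (\<integral>\<^sup>+y. G x y \<partial>\<nu>) < \<infinity>"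
    and f: "continuous_on UNIV f" "\<And>y. 0 \<le> f y" "\<And>y. f y \<le> 1"
    and e: "0 < e"
  shows "\<exists>\<delta>>0. \<exists>N. \<forall>n\<ge>N. \<forall>x'. dist x x' < \<delta> \<longrightarrow> real_potential G \<nu> f x - e < real_potential G (\<mu> n) f x'"
proof (cases "real_potential G \<nu> f x - e < 0")
  case True
  then have "real_potential G \<nu> f x - e < real_potential G (\<mu> n) f x'" for n x'
    using real_potential_nonneg[of "\<mu> n" f x'] by linarith
  then show ?thesis by (intro exI[of _ 1]) auto
next
  case False
  have "ennreal (real_potential G \<nu> f x - e) < (\<integral>\<^sup>+y. G x y * ennreal (f y) \<partial>\<nu>)"
    unfolding potential_finite(1)[OF f(3) fin(2)] using False e by (simp add: ennreal_less_iff)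
  from potential_lower_bound[OF lsc lc \<mu> f(1,2) this]
  show ?thesis
    unfolding potential_finite(1)[OF f(3) fin(1)] using False by (simp add: ennreal_less_iff)
qed

text \<open>An upper bound for the potential of \<open>f\<close> is the potential of 1 minus a lower
  bound for that of \<open>1 - f\<close>. This gives closeness near every point; finitely many balls
  cover a compact set, and outside it all potentials are squeezed between 0 and the small potential
  of 1.\<close>

theorem potential_uniform_limit:
  assumes \<mu>: "\<And>n. radon (\<mu> n)" "radon \<nu>" "vague_convergence \<mu> \<nu>"
    and fin: "\<And>n x. (\<integral>\<^sup>+y. G x y \<partial>\<mu> n) < \<infinity>" "\<And>x. (\<integral>\<^sup>+y. G x y \<partial>\<nu>) < \<infinity>"
    and cont: "continuous_on UNIV (real_potential G \<nu> (\<lambda>_. 1))"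
    and van: "vanishes_at_infinity (real_potential G \<nu> (\<lambda>_. 1))"
    and lim: "uniform_limit UNIV (\<lambda>n. real_potential G (\<mu> n) (\<lambda>_. 1)) (real_potential G \<nu> (\<lambda>_. 1)) sequentially"
    and f: "continuous_on UNIV f" "\<And>y. 0 \<le> f y" "\<And>y. f y \<le> 1"
  shows "uniform_limit UNIV (\<lambda>n. real_potential G (\<mu> n) f) (real_potential G \<nu> f) sequentially"
proof (rule uniform_limitI)
  fix e :: real assume e: "0 < e"
  let ?F = "\<lambda>n. real_potential G (\<mu> n) f" and ?F' = "real_potential G \<nu> f"
  let ?H = "\<lambda>n. real_potential G (\<mu> n) (\<lambda>y. 1 - f y)" and ?H' = "real_potential G \<nu> (\<lambda>y. 1 - f y)"
  let ?g = "\<lambda>n. real_potential G (\<mu> n) (\<lambda>_. 1)" and ?g' = "real_potential G \<nu> (\<lambda>_. 1)"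
  \<comment> \<open>At most four errors of size \<open>d\<close> accumulate below, so
    \<open>e / 8\<close> leaves room.\<close>
  define d where "d = e / 8"
  have d: "0 < d" using e by (simp add: d_def)
  have sets: "sets (\<mu> n) = sets borel" "sets \<nu> = sets borel" for n using \<mu> by (auto simp: radon_def)
  have F_H: "?F n x + ?H n x = ?g n x" "?F' x + ?H' x = ?g' x" for n x
    using real_potential_complement[OF sets(1) f fin(1)] real_potential_complement[OF sets(2) f fin(2)] by auto
  \<comment> \<open>For the constant sequence the lower bounds become lower semicontinuity of the
    limit potentials of \<open>f\<close> and \<open>1 - f\<close>.\<close>
  have vague': "vague_convergence (\<lambda>_. \<nu>) \<nu>" by (simp add: vague_convergence_def)
  have f': "continuous_on UNIV (\<lambda>y. 1 - f y)" "\<And>y. 0 \<le> 1 - f y" "\<And>y. 1 - f y \<le> 1"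
    using f by (auto intro!: continuous_intros)
  obtain N0 where N0: "\<And>n x. N0 \<le> n \<Longrightarrow> \<bar>?g n x - ?g' x\<bar> < d"
    using uniform_limitD[OF lim d] by (auto simp: eventually_sequentially dist_real_def)
  have near: "\<exists>\<delta>>0. \<exists>N. \<forall>n\<ge>N. \<forall>x'. dist x x' < \<delta> \<longrightarrow> \<bar>?F n x' - ?F' x'\<bar> < e" for x
  proof -
    obtain \<delta>1 N1 where 1: "0 < \<delta>1" "\<And>n x'. N1 \<le> n \<Longrightarrow> dist x x' < \<delta>1 \<Longrightarrow> ?F' x - d < ?F n x'"
      using real_potential_lower[OF \<mu> fin f d, of x] by blast
    obtain \<delta>2 N2 where 2: "0 < \<delta>2" "\<And>n x'. N2 \<le> n \<Longrightarrow> dist x x' < \<delta>2 \<Longrightarrow> ?H' x - d < ?H n x'"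
      using real_potential_lower[OF \<mu> fin f' d, of x] by blast
    obtain \<delta>3 where 3: "0 < \<delta>3" "\<And>x'. dist x x' < \<delta>3 \<Longrightarrow> ?F' x - d < ?F' x'"
      using real_potential_lower[OF \<mu>(2) \<mu>(2) vague' fin(2) fin(2) f d, of x] by blast
    obtain \<delta>4 where 4: "0 < \<delta>4" "\<And>x'. dist x x' < \<delta>4 \<Longrightarrow> ?H' x - d < ?H' x'"
      using real_potential_lower[OF \<mu>(2) \<mu>(2) vague' fin(2) fin(2) f' d, of x] by blast
    have "isCont ?g' x" using cont by (simp add: continuous_on_eq_continuous_at)
    then obtain \<delta>5 where 5: "0 < \<delta>5" "\<And>x'. dist x x' < \<delta>5 \<Longrightarrow> \<bar>?g' x' - ?g' x\<bar> < d"
      using d unfolding continuous_at_eps_delta dist_real_def by (metis dist_commute)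
    show ?thesis
    proof (intro exI[of _ "Min {\<delta>1, \<delta>2, \<delta>3, \<delta>4, \<delta>5}"] conjI exI[of _ "max N0 (max N1 N2)"] allI impI)
      fix n x' assume n: "max N0 (max N1 N2) \<le> n" and x': "dist x x' < Min {\<delta>1, \<delta>2, \<delta>3, \<delta>4, \<delta>5}"
      have "\<bar>?g n x' - ?g' x'\<bar> < d" using n by (intro N0) auto
      moreover have "?F' x - d < ?F n x'" "?H' x - d < ?H n x'" "?F' x - d < ?F' x'" "?H' x - d < ?H' x'" "\<bar>?g' x' - ?g' x\<bar> < d"
        using n x' by (auto intro!: 1(2) 2(2) 3(2) 4(2) 5(2))
      ultimately show "\<bar>?F n x' - ?F' x'\<bar> < e"
        using F_H(1)[of n x'] F_H(2)[of x'] F_H(2)[of x] e unfolding d_def by linarith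
    qed (use 1 2 3 4 5 in auto)
  qed
  obtain \<delta> N where \<delta>: "\<And>x. 0 < \<delta> x" "\<And>x n x'. N x \<le> n \<Longrightarrow> dist x x' < \<delta> x \<Longrightarrow> \<bar>?F n x' - ?F' x'\<bar> < e"
    using near by metis
  obtain K where K: "compact K" "\<And>x. x \<notin> K \<Longrightarrow> \<bar>?g' x\<bar> < d"
    using van d unfolding vanishes_at_infinity_def by blast
  have cover: "K \<subseteq> (\<Union>x\<in>K. ball x (\<delta> x))" using \<delta>(1) by auto
  obtain C where C: "finite C" "C \<subseteq> K" "K \<subseteq> (\<Union>x\<in>C. ball x (\<delta> x))"
    by (rule compactE_image[OF K(1) _ cover]) (rule open_ball)
  define N' where "N' = Max (insert N0 (N ` C))"
  have N': "N0 \<le> N'" "\<And>x. x \<in> C \<Longrightarrow> N x \<le> N'" using C(1) by (auto simp: N'_def)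
  show "\<forall>\<^sub>F n in sequentially. \<forall>x\<in>UNIV. dist (?F n x) (?F' x) < e"
    using eventually_ge_at_top[of N']
  proof (eventually_elim, intro ballI)
    fix n x assume n: "N' \<le> n"
    show "dist (?F n x) (?F' x) < e"
    proof (cases "x \<in> K")
      case True
      then obtain c where "c \<in> C" "dist c x < \<delta> c" using C(3) by auto
      then show ?thesis using \<delta>(2)[of c n x] N'(2)[of c] n by (simp add: dist_real_def)
    next
      case False
      have "?F n x \<le> ?g n x" "?F' x \<le> ?g' x"
        using potential_finite(2)[OF f(3) fin(1)] potential_finite(2)[OF f(3) fin(2)] by auto
      moreover have "\<bar>?g' x\<bar> < d" using K(2) False .
      moreover have "\<bar>?g n x - ?g' x\<bar> < d" using N0 N'(1) n by simp
      moreover have "0 \<le> ?F n x" "0 \<le> ?F' x" by (simp_all add: real_potential_nonneg)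
      ultimately show ?thesis using e unfolding d_def dist_real_def by linarith
    qed
  qed
qed

end

section \<open>The time-changed resolvent\<close>

lemma bcontfun_abs_le: "\<bar>apply_bcontfun u x\<bar> \<le> norm u"
  using norm_bounded[of u x] by simp

text \<open>The time-changed resolvent integrates a path functional over the completed measure.
  Completeness transfers measurability from an almost everywhere equal version, which can then
  replace it.\<close>

lemma integral_completion_AE:
  fixes f g :: "'a \<Rightarrow> real"
  assumes g: "g \<in> borel_measurable M" and eq: "AE x in M. f x = g x"
  shows "(\<integral>x. f x \<partial>completion M) = (\<integral>x. g x \<partial>M)"
proof -
  have eq': "AE x in completion M. g x = f x"
    using AE_completion[OF eq] by eventually_elim simp
  have g': "g \<in> borel_measurable (completion M)" by (rule measurable_completion[OF g])
  have "f \<in> borel_measurable (completion M)"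
  proof (rule measurableI)
    fix S :: "real set" assume S: "S \<in> sets borel"
    show "f -` S \<inter> space (completion M) \<in> sets (completion M)"
    proof (rule complete_measure.in_sets_AE)
      show "complete_measure (completion M)" by (rule completion.complete_measure_axioms)
      show "g -` S \<inter> space (completion M) \<in> sets (completion M)" by (rule measurable_sets[OF g' S])
      show "AE x in completion M. (x \<in> g -` S \<inter> space (completion M)) = (x \<in> f -` S \<inter> space (completion M))"
        using eq' by eventually_elim auto
    qed auto
  qed simp
  then have "(\<integral>x. f x \<partial>completion M) = (\<integral>x. g x \<partial>completion M)"
    using g' eq' by (intro integral_cong_AE) auto
  then show ?thesis using g by (simp add: integral_completion)
qed

text \<open>Only finitely many grid times enter, so measurability at fixed times gives joint
  measurability in path and operational time. Indicators of moving intervals are rewritten as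
  conditionals on the pair.\<close>

lemma borel_measurable_grid_step_pair:
  assumes H: "\<And>t. (\<lambda>\<omega>. H t \<omega>) \<in> borel_measurable N" and A: "\<And>t. (\<lambda>\<omega>. A t \<omega>) \<in> borel_measurable N"
  shows "(\<lambda>(\<omega>, r). grid_step (\<lambda>t. H t \<omega>) (\<lambda>t. A t \<omega>) k r) \<in> borel_measurable (N \<Otimes>\<^sub>M borel)"
proof -
  note [measurable] = H A
  let ?b = "\<lambda>i \<omega>. enn2real (A (ennreal (real i / real k)) \<omega>)"
  have "(\<lambda>p. \<Sum>i<k*k. H (ennreal (real (Suc i) / real k)) (fst p) *
      (if ?b i (fst p) \<le> snd p \<and> snd p < ?b (Suc i) (fst p) then 1 else 0)) \<in> borel_measurable (N \<Otimes>\<^sub>M borel)"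
    by measurable
  also have "(\<lambda>p. \<Sum>i<k*k. H (ennreal (real (Suc i) / real k)) (fst p) *
      (if ?b i (fst p) \<le> snd p \<and> snd p < ?b (Suc i) (fst p) then 1 else 0))
    = (\<lambda>(\<omega>, r). grid_step (\<lambda>t. H t \<omega>) (\<lambda>t. A t \<omega>) k r)"
  proof -
    have ind: "indicator {a..<b} r = (if a \<le> r \<and> r < b then 1 else 0 :: real)" for a b r :: real
      by (simp add: indicator_def)
    show ?thesis unfolding grid_step_def ind case_prod_beta' ..
  qed
  finally show ?thesis .
qed

lemma grid_step_cong:
  assumes "\<And>t. t < \<infinity> \<Longrightarrow> h t = h' t" "\<And>i. a (ennreal (real i / real k)) = a' (ennreal (real i / real k))"
  shows "grid_step h a k r = grid_step h' a' k r"
  unfolding grid_step_def using assms by (simp del: of_nat_Suc)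

text \<open>The Revuz formula enters at \<alpha> = 0; the link between positive \<alpha> and
  potentials is made by the resolvent equation. \<open>G\<close> may be any kernel for which this
  formula and finiteness hold.\<close>

locale time_change = standard_process \<Omega> M P X \<theta>
  for \<Omega> :: "'w set" and M
    and P :: "'a::{metric_space, second_countable_topology} option \<Rightarrow> 'w measure" and X and \<theta> +
  fixes A :: "ennreal \<Rightarrow> 'w \<Rightarrow> ennreal" and \<mu> :: "'a measure" and G :: "'a \<Rightarrow> 'a \<Rightarrow> ennreal"
  assumes pcaf: "PCAF \<Omega> P X \<theta> A"
    and revuz: "f \<in> borel_measurable borel \<Longrightarrow> AF_integral P X A (\<lambda>_. 1) f x = (\<integral>\<^sup>+y. G x y * f y \<partial>\<mu>)"
    and finite_potential: "(\<integral>\<^sup>+y. G x y \<partial>\<mu>) < \<infinity>"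
begin

sublocale markov_process_t2 \<Omega> M P X \<theta> by unfold_locales

abbreviation "augmented \<equiv> augmented_filtration \<Omega> P X"

lemma sets_augmented: "sets (augmented t) = sigma_sets \<Omega> {\<Lambda>. \<Lambda> \<subseteq> \<Omega> \<and>
     (\<forall>\<nu>. finite_measure \<nu> \<longrightarrow> sets \<nu> = sets pt_borel \<longrightarrow>
        (\<exists>\<Lambda>'\<in>sets (natural_filtration \<Omega> X t). \<exists>N\<in>sets natural_infinity.
           (\<Lambda> - \<Lambda>') \<union> (\<Lambda>' - \<Lambda>) \<subseteq> N \<and> (\<integral>\<^sup>+z. emeasure (P z) N \<partial>\<nu>) = 0))}"
  unfolding augmented_filtration_def by (rule sets_measure_of) auto

lemma natural_mono: "s \<le> t \<Longrightarrow> sets (natural_filtration \<Omega> X s) \<subseteq> sets (natural_filtration \<Omega> X t)"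
  unfolding sets_natural by (rule sigma_sets_mono') (use order_trans in blast)

lemma augmented_mono: "sets (augmented t) \<subseteq> sets (augmented \<infinity>)"
proof -
  have sub: "sets (natural_filtration \<Omega> X t) \<subseteq> sets natural_infinity"
    by (rule natural_mono) simp
  show ?thesis
    unfolding sets_augmented
  proof (intro sigma_sets_mono' subsetI CollectI conjI allI impI; elim CollectE conjE)
    fix \<Lambda> and \<nu> :: "'a option measure"
    assume \<nu>: "finite_measure \<nu>" "sets \<nu> = sets pt_borel"
      and *: "\<forall>\<nu>. finite_measure \<nu> \<longrightarrow> sets \<nu> = sets pt_borel \<longrightarrow>
        (\<exists>\<Lambda>'\<in>sets (natural_filtration \<Omega> X t). \<exists>N\<in>sets natural_infinity.
           (\<Lambda> - \<Lambda>') \<union> (\<Lambda>' - \<Lambda>) \<subseteq> N \<and> (\<integral>\<^sup>+z. emeasure (P z) N \<partial>\<nu>) = 0)"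
    from *[rule_format, OF \<nu>] show "\<exists>\<Lambda>'\<in>sets natural_infinity. \<exists>N\<in>sets natural_infinity.
           (\<Lambda> - \<Lambda>') \<union> (\<Lambda>' - \<Lambda>) \<subseteq> N \<and> (\<integral>\<^sup>+z. emeasure (P z) N \<partial>\<nu>) = 0"
      by (elim bexE) (rule bexI[OF _ subsetD[OF sub]], rule bexI)
  qed (erule (1) subsetD)
qed

lemma natural_subset_augmented: "sets natural_infinity \<subseteq> sets (augmented \<infinity>)"
proof
  fix \<Lambda> assume "\<Lambda> \<in> sets natural_infinity"
  moreover from this have "\<Lambda> \<subseteq> \<Omega>" using sets.sets_into_space space_natural by blast
  ultimately show "\<Lambda> \<in> sets (augmented \<infinity>)"
    unfolding sets_augmented
    by (intro sigma_sets.Basic CollectI conjI allI impI bexI[of _ \<Lambda>] bexI[of _ "{}"]) auto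
qed

lemma measurable_augmented_P: "f \<in> augmented \<infinity> \<rightarrow>\<^sub>M N \<Longrightarrow> f \<in> P z \<rightarrow>\<^sub>M N"
  using complete_filtration[of \<infinity>] sets_P[of z] by (auto simp: measurable_def space_P space_augmented)

lemma A_augmented: "A t \<in> borel_measurable (augmented t)"
  using pcaf by (auto simp: PCAF_def)

lemma A_M: "A t \<in> borel_measurable (M t)"
  using A_augmented[of t] complete_filtration[of t] by (auto simp: measurable_def space_F space_augmented)

lemma A_augmented_infinity: "A t \<in> borel_measurable (augmented \<infinity>)"
  using A_augmented[of t] augmented_mono[of t] by (auto simp: measurable_def space_augmented)

lemma X_augmented: "X t \<in> augmented \<infinity> \<rightarrow>\<^sub>M pt_borel"
proof -
  have "X t \<in> natural_infinity \<rightarrow>\<^sub>M pt_borel"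
    by (rule measurableI) (use vimage_X_natural[of _ t] in \<open>auto simp: space_natural vimage_def Int_def conj_commute\<close>)
  then show ?thesis using natural_subset_augmented by (auto simp: measurable_def space_augmented space_natural)
qed

text \<open>The limit exists on almost every path only; clamping bounds the density on all paths.\<close>

definition dens :: "('a \<Rightarrow>\<^sub>C real) \<Rightarrow> 'w \<Rightarrow> real \<Rightarrow> real" where
  "dens u \<omega> r = indicator {0..} r * max (- norm u) (min (norm u)
     (lim (\<lambda>k. grid_step (\<lambda>t. ext (apply_bcontfun u) (X t \<omega>)) (\<lambda>t. A t \<omega>) k r)))"

lemma bcontfun_borel: "apply_bcontfun u \<in> borel_measurable borel"
  by (intro borel_measurable_continuous_onI) simp

lemma ext_augmented: "(\<lambda>\<omega>. ext (apply_bcontfun u) (X t \<omega>)) \<in> borel_measurable (augmented \<infinity>)"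
  by (rule measurable_compose[OF X_augmented measurable_ext[OF bcontfun_borel]])

lemma dens_augmented [measurable]: "(\<lambda>(\<omega>, r). dens u \<omega> r) \<in> borel_measurable (augmented \<infinity> \<Otimes>\<^sub>M borel)"
proof -
  note [measurable] = borel_measurable_grid_step_pair[OF ext_augmented A_augmented_infinity]
  show ?thesis unfolding dens_def by measurable
qed

lemma dens_augmented_lborel: "(\<lambda>(\<omega>, r). dens u \<omega> r) \<in> borel_measurable (augmented \<infinity> \<Otimes>\<^sub>M lborel)"
  using dens_augmented[of u] by (simp cong: measurable_cong_sets sets_pair_measure_cong)

lemma dens_P: "(\<lambda>(\<omega>, r). dens u \<omega> r) \<in> borel_measurable (P z \<Otimes>\<^sub>M lborel)"
proof -
  have id: "(\<lambda>\<omega>. \<omega>) \<in> P z \<rightarrow>\<^sub>M augmented \<infinity>" by (rule measurable_augmented_P) simp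
  have "(\<lambda>p. (fst p, snd p)) \<in> P z \<Otimes>\<^sub>M lborel \<rightarrow>\<^sub>M augmented \<infinity> \<Otimes>\<^sub>M lborel"
    by (intro measurable_Pair measurable_compose[OF measurable_fst id] measurable_snd)
  from measurable_compose[OF this dens_augmented_lborel] show ?thesis
    by (simp add: split_beta)
qed

lemma dens_bound: "\<bar>dens u \<omega> r\<bar> \<le> norm u * indicator {0..} r"
proof (cases "0 \<le> r")
  case True
  then show ?thesis using norm_ge_zero[of u] by (simp add: dens_def abs_le_iff max_def min_def)
qed (simp add: dens_def)

lemma dens_bound': "\<bar>dens u \<omega> r\<bar> \<le> norm u"
  using order_trans[OF dens_bound[of u \<omega> r], of "norm u"] by (cases "0 \<le> r") auto

definition functional :: "(real \<Rightarrow> real) \<Rightarrow> ('a \<Rightarrow>\<^sub>C real) \<Rightarrow> 'w \<Rightarrow> real" where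
  "functional w u \<omega> = (LINT r|lborel. w r * dens u \<omega> r)"

lemma functional_augmented:
  assumes [measurable]: "w \<in> borel_measurable borel"
  shows "functional w u \<in> borel_measurable (augmented \<infinity>)"
proof -
  note [measurable] = dens_augmented_lborel
  have "(\<lambda>\<omega>. LINT r|lborel. w r * dens u \<omega> r) \<in> borel_measurable (augmented \<infinity>)"
    by (rule lborel.borel_measurable_lebesgue_integral) measurable
  then show ?thesis by (simp add: functional_def[abs_def])
qed

lemmas functional_P = measurable_augmented_P[OF functional_augmented]

definition good :: "'w \<Rightarrow> bool" where
  "good \<omega> \<longleftrightarrow> finite_clock_path (\<lambda>t. A t \<omega>) (\<lambda>t. X t \<omega>)"

lemma almost_surely_AE: "almost_surely \<Omega> P X Q \<Longrightarrow> AE \<omega> in P z. Q \<omega>"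
proof -
  assume "almost_surely \<Omega> P X Q"
  then obtain N where N: "N \<in> sets (augmented \<infinity>)" "emeasure (P z) N = 0" "{\<omega>\<in>\<Omega>. \<not> Q \<omega>} \<subseteq> N"
    by (auto simp: almost_surely_def)
  then show ?thesis
    using complete_filtration[of \<infinity>] sets_P[of z] by (intro AE_I[of _ _ N]) (auto simp: space_P)
qed

lemma AE_clock_path: "AE \<omega> in P z. clock_path (\<lambda>t. A t \<omega>) (\<lambda>t. X t \<omega>)"
proof -
  have "almost_surely \<Omega> P X (\<lambda>\<omega>. A 0 \<omega> = 0 \<and> mono (\<lambda>t. A t \<omega>) \<and> continuous_on UNIV (\<lambda>t. A t \<omega>) \<and>
       (\<forall>t<lifetime X \<omega>. A t \<omega> < \<infinity>) \<and> (\<forall>t\<ge>lifetime X \<omega>. A t \<omega> = A (lifetime X \<omega>) \<omega>))"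
    using pcaf by (simp add: PCAF_def)
  from almost_surely_AE[OF this] right_continuous_paths AE_space
  show ?thesis
  proof eventually_elim
    case (elim \<omega>)
    then have \<omega>: "\<omega> \<in> \<Omega>" by (simp add: space_P)
    show ?case
    proof
      show "A t \<omega> = A \<infinity> \<omega>" if "X t \<omega> = None" for t
      proof -
        have "lifetime X \<omega> \<le> t" unfolding lifetime_def by (rule Inf_lower) (simp add: that)
        moreover have "lifetime X \<omega> \<le> \<infinity>" by simp
        ultimately show ?thesis using elim by metis
      qed
    qed (use elim absorbing[OF \<omega>] at_infinity[OF \<omega>] in auto)
  qed
qed

lemma AF_integral_one: "AF_integral P X A (\<lambda>_. 1) f x
    = (\<integral>\<^sup>+\<omega>. stieltjes_integral (\<lambda>t. ext f (X (ennreal t) \<omega>)) (\<lambda>t. A t \<omega>) \<partial>P (Some x))"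
  by (simp add: AF_integral_def)

lemma nn_integral_A_infinity: "(\<integral>\<^sup>+\<omega>. A \<infinity> \<omega> \<partial>P (Some x)) = (\<integral>\<^sup>+y. G x y \<partial>\<mu>)"
proof -
  have "(\<integral>\<^sup>+\<omega>. A \<infinity> \<omega> \<partial>P (Some x)) = AF_integral P X A (\<lambda>_. 1) (\<lambda>_. 1) x"
    unfolding AF_integral_one
    using AE_clock_path[of "Some x"]
    by (intro nn_integral_cong_AE) (auto elim!: eventually_mono dest: clock_path.stieltjes_integral_one)
  then show ?thesis by (simp add: revuz)
qed

text \<open>The mean of the total clock is the potential of 1, hence finite, so the total clock is
  finite almost surely.\<close>

lemma AE_good: "AE \<omega> in P (Some x). good \<omega>"
proof -
  have "AE \<omega> in P (Some x). A \<infinity> \<omega> \<noteq> \<infinity>"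
    using nn_integral_A_infinity[of x] finite_potential[of x]
      measurable_augmented_P[OF A_augmented_infinity]
    by (intro nn_integral_PInf_AE) auto
  then show ?thesis using AE_clock_path
  proof eventually_elim
    case (elim \<omega>)
    then show ?case
      unfolding good_def finite_clock_path_def finite_clock_def finite_clock_axioms_def
      by (auto simp: clock_path_def less_top)
  qed
qed

lemma integrable_A_infinity: "integrable (P (Some x)) (\<lambda>\<omega>. enn2real (A \<infinity> \<omega>))"
  and integral_A_infinity: "(\<integral>\<omega>. enn2real (A \<infinity> \<omega>) \<partial>P (Some x)) = real_potential G \<mu> (\<lambda>_. 1) x"
proof -
  have [measurable]: "A \<infinity> \<in> borel_measurable (P (Some x))"
    by (rule measurable_augmented_P[OF A_augmented_infinity])
  have m: "(\<lambda>\<omega>. enn2real (A \<infinity> \<omega>)) \<in> borel_measurable (P (Some x))" by measurable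
  have eq: "(\<integral>\<^sup>+\<omega>. ennreal (enn2real (A \<infinity> \<omega>)) \<partial>P (Some x)) = (\<integral>\<^sup>+y. G x y \<partial>\<mu>)"
    unfolding nn_integral_A_infinity[symmetric]
  proof (rule nn_integral_cong_AE, use AE_good[of x] in eventually_elim)
    case (elim \<omega>)
    then interpret finite_clock_path "\<lambda>t. A t \<omega>" "\<lambda>t. X t \<omega>" by (simp add: good_def)
    show ?case using clock_eq[of \<infinity>] by simp
  qed
  then show int: "integrable (P (Some x)) (\<lambda>\<omega>. enn2real (A \<infinity> \<omega>))"
    using finite_potential[of x] m by (intro integrableI_nonneg) auto
  show "(\<integral>\<omega>. enn2real (A \<infinity> \<omega>) \<partial>P (Some x)) = real_potential G \<mu> (\<lambda>_. 1) x"
    using eq m by (subst integral_eq_nn_integral) (auto simp: real_potential_def)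
qed

lemma dens_good:
  assumes "good \<omega>"
  shows "dens u \<omega> = finite_clock_path.time_changed (\<lambda>t. A t \<omega>) (\<lambda>t. X t \<omega>) (apply_bcontfun u)"
proof
  fix r
  interpret finite_clock_path "\<lambda>t. A t \<omega>" "\<lambda>t. X t \<omega>" using assms by (simp add: good_def)
  show "dens u \<omega> r = time_changed (apply_bcontfun u) r"
  proof (cases "0 \<le> r")
    case True
    have "(\<lambda>k. grid_step (\<lambda>t. ext (apply_bcontfun u) (X t \<omega>)) (\<lambda>t. A t \<omega>) k r)
        \<longlonglongrightarrow> ext (apply_bcontfun u) (X (time_inverse (\<lambda>t. A t \<omega>) (ennreal r)) \<omega>)"
      using True by (intro grid_step_tendsto right_cont_ext ext_infinity) auto
    then have "lim (\<lambda>k. grid_step (\<lambda>t. ext (apply_bcontfun u) (X t \<omega>)) (\<lambda>t. A t \<omega>) k r)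
        = ext (apply_bcontfun u) (X (time_inverse (\<lambda>t. A t \<omega>) (ennreal r)) \<omega>)"
      by (rule limI)
    moreover have "\<bar>ext (apply_bcontfun u) (X (time_inverse (\<lambda>t. A t \<omega>) (ennreal r)) \<omega>)\<bar> \<le> norm u"
      by (rule ext_abs_le) (rule bcontfun_abs_le)
    ultimately show ?thesis by (auto simp: dens_def time_changed_def abs_le_iff)
  qed (simp add: dens_def time_changed_def)
qed

lemma functional_good:
  assumes "good \<omega>"
  shows "functional w u \<omega> = (LINT r:{0..}|lborel. w r * ext (apply_bcontfun u) (X (time_inverse (\<lambda>t. A t \<omega>) (ennreal r)) \<omega>))"
  unfolding functional_def dens_good[OF assms] set_lebesgue_integral_def
    finite_clock_path.time_changed_def[OF assms[unfolded good_def]]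
  by (intro Bochner_Integration.integral_cong) (auto simp: indicator_def)

definition mean :: "(real \<Rightarrow> real) \<Rightarrow> ('a \<Rightarrow>\<^sub>C real) \<Rightarrow> 'a \<Rightarrow> real" where
  "mean w u x = (\<integral>\<omega>. functional w u \<omega> \<partial>P (Some x))"

lemma time_changed_resolvent_eq:
  "time_changed_resolvent P X A \<alpha> (apply_bcontfun u) x = mean (\<lambda>r. exp (- \<alpha> * r)) u x"
  unfolding time_changed_resolvent_def mean_def
proof (rule integral_completion_AE)
  show "functional (\<lambda>r. exp (- \<alpha> * r)) u \<in> borel_measurable (P (Some x))"
    by (rule functional_P) measurable
  show "AE \<omega> in P (Some x). (LINT t:{0..}|lborel. exp (- \<alpha> * t) * ext (apply_bcontfun u) (X (inverse_AF A (ennreal t) \<omega>) \<omega>))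
      = functional (\<lambda>r. exp (- \<alpha> * r)) u \<omega>"
    using AE_good[of x]
    by eventually_elim (simp add: functional_good inverse_AF_def time_inverse_def)
qed

lemma functional_integrable_good:
  assumes \<omega>: "good \<omega>" and w: "w \<in> borel_measurable borel" "\<And>r. 0 \<le> r \<Longrightarrow> \<bar>w r\<bar> \<le> C"
  shows "integrable lborel (\<lambda>r. w r * dens u \<omega> r)"
    and "\<bar>functional w u \<omega>\<bar> \<le> C * norm u * enn2real (A \<infinity> \<omega>)"
proof -
  interpret finite_clock_path "\<lambda>t. A t \<omega>" "\<lambda>t. X t \<omega>" using \<omega> by (simp add: good_def)
  let ?f = "apply_bcontfun u"
  have f: "right_cont (\<lambda>t. ext ?f (X t \<omega>))" "ext ?f (X \<infinity> \<omega>) = 0" "\<And>t. \<bar>ext ?f (X t \<omega>)\<bar> \<le> norm u"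
    by (intro right_cont_ext continuous_on_apply_bcontfun ext_infinity ext_abs_le bcontfun_abs_le)+
  have "set_integrable lborel {0..} (\<lambda>r. w r * ext ?f (X (time_inverse (\<lambda>t. A t \<omega>) (ennreal r)) \<omega>))"
    by (rule set_integrable_time_change[where h = "\<lambda>t. ext ?f (X t \<omega>)", OF f w])
  then show "integrable lborel (\<lambda>r. w r * dens u \<omega> r)"
    unfolding dens_good[OF \<omega>] time_changed_def set_integrable_def by (simp add: mult.left_commute)
  show "\<bar>functional w u \<omega>\<bar> \<le> C * norm u * enn2real (A \<infinity> \<omega>)"
    unfolding functional_good[OF \<omega>]
    by (rule LIMSEQ_le_const2[OF tendsto_rabs[OF integral_grid_step_tendsto[where h = "\<lambda>t. ext ?f (X t \<omega>)", OF f w]]])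
       (use integral_grid_step_bound[where h = "\<lambda>t. ext ?f (X t \<omega>)", OF f w] in auto)
qed

text \<open>The total clock bounds the functional without help from discounting. So the weight 1 is
  covered, and the potential operator of any \<open>u\<close> is controlled by the potential of 1;
  this bound later provides the contraction.\<close>

lemma
  assumes w: "w \<in> borel_measurable borel" "\<And>r. 0 \<le> r \<Longrightarrow> \<bar>w r\<bar> \<le> C"
  shows integrable_functional: "integrable (P (Some x)) (functional w u)"
    and mean_bound: "\<bar>mean w u x\<bar> \<le> C * norm u * real_potential G \<mu> (\<lambda>_. 1) x"
proof -
  have bound: "AE \<omega> in P (Some x). \<bar>functional w u \<omega>\<bar> \<le> C * norm u * enn2real (A \<infinity> \<omega>)"
    using AE_good[of x] by eventually_elim (rule functional_integrable_good(2)[OF _ w])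
  have int: "integrable (P (Some x)) (\<lambda>\<omega>. C * norm u * enn2real (A \<infinity> \<omega>))"
    using integrable_A_infinity[of x] by (rule integrable_mult_right)
  show i: "integrable (P (Some x)) (functional w u)"
  proof (rule Bochner_Integration.integrable_bound[OF int functional_P[OF w(1)]])
    show "AE \<omega> in P (Some x). norm (functional w u \<omega>) \<le> norm (C * norm u * enn2real (A \<infinity> \<omega>))"
      using bound by eventually_elim (auto intro: order_trans[OF _ abs_ge_self])
  qed
  have "\<bar>mean w u x\<bar> \<le> (\<integral>\<omega>. \<bar>functional w u \<omega>\<bar> \<partial>P (Some x))"
    unfolding mean_def by (rule integral_abs_bound)
  also have "\<dots> \<le> (\<integral>\<omega>. C * norm u * enn2real (A \<infinity> \<omega>) \<partial>P (Some x))"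
    using i bound by (intro integral_mono_AE int integrable_abs)
  also have "\<dots> = C * norm u * real_potential G \<mu> (\<lambda>_. 1) x"
    by (simp only: Bochner_Integration.integral_mult_right_zero integral_A_infinity)
  finally show "\<bar>mean w u x\<bar> \<le> C * norm u * real_potential G \<mu> (\<lambda>_. 1) x" .
qed

lemma mean_linear:
  assumes w: "w \<in> borel_measurable borel" "\<And>r. 0 \<le> r \<Longrightarrow> \<bar>w r\<bar> \<le> C"
  shows "mean w (a *\<^sub>R u + b *\<^sub>R v) x = a * mean w u x + b * mean w v x"
proof -
  have "AE \<omega> in P (Some x). functional w (a *\<^sub>R u + b *\<^sub>R v) \<omega> = a * functional w u \<omega> + b * functional w v \<omega>"
    using AE_good[of x]
  proof eventually_elim
    case (elim \<omega>)
    have "dens (a *\<^sub>R u + b *\<^sub>R v) \<omega> r = a * dens u \<omega> r + b * dens v \<omega> r" for r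
      unfolding dens_good[OF elim] finite_clock_path.time_changed_def[OF elim[unfolded good_def]]
      by (auto simp: ext_def plus_bcontfun.rep_eq scaleR_bcontfun.rep_eq algebra_simps split: option.split)
    then have "functional w (a *\<^sub>R u + b *\<^sub>R v) \<omega> = (LINT r|lborel. a * (w r * dens u \<omega> r) + b * (w r * dens v \<omega> r))"
      by (simp add: functional_def algebra_simps)
    also have "\<dots> = a * functional w u \<omega> + b * functional w v \<omega>"
      using functional_integrable_good(1)[OF elim w] by (simp add: functional_def)
    finally show ?case .
  qed
  then have "mean w (a *\<^sub>R u + b *\<^sub>R v) x = (\<integral>\<omega>. a * functional w u \<omega> + b * functional w v \<omega> \<partial>P (Some x))"
    unfolding mean_def using functional_P[OF w(1)] by (intro integral_cong_AE) auto
  also have "\<dots> = a * mean w u x + b * mean w v x"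
    using integrable_functional[OF w] by (simp add: mean_def)
  finally show ?thesis .
qed

text \<open>The Revuz formula gives the mean of the Stieltjes integral, and the change of variables
  turns that integral into one over operational time. Nonnegativity allows the comparison in
  \<open>ennreal\<close>.\<close>

lemma mean_one:
  assumes f: "\<And>y. 0 \<le> apply_bcontfun f y"
  shows "mean (\<lambda>_. 1) f x = real_potential G \<mu> (apply_bcontfun f) x"
proof -
  have nn: "AE \<omega> in P (Some x). 0 \<le> functional (\<lambda>_. 1) f \<omega>"
    using AE_good[of x]
  proof eventually_elim
    case (elim \<omega>)
    show ?case
      unfolding functional_good[OF elim] set_lebesgue_integral_def
      by (intro Bochner_Integration.integral_nonneg) (auto simp: ext_def f split: option.split)
  qed
  have "(\<integral>\<^sup>+\<omega>. ennreal (functional (\<lambda>_. 1) f \<omega>) \<partial>P (Some x)) = AF_integral P X A (\<lambda>_. 1) (\<lambda>y. ennreal (f y)) x"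
    unfolding AF_integral_one
  proof (rule nn_integral_cong_AE, use AE_good[of x] in eventually_elim)
    case (elim \<omega>)
    interpret finite_clock_path "\<lambda>t. A t \<omega>" "\<lambda>t. X t \<omega>" using elim by (simp add: good_def)
    have int: "integrable lborel (\<lambda>r. 1 * dens f \<omega> r)"
      by (rule functional_integrable_good(1)[OF elim, of _ 1]) auto
    have eq: "dens f \<omega> r = indicator {0..} r * ext (apply_bcontfun f) (X (time_inverse (\<lambda>t. A t \<omega>) (ennreal r)) \<omega>)" for r
      unfolding dens_good[OF elim] time_changed_def ..
    have "stieltjes_integral (\<lambda>t. ext (\<lambda>y. ennreal (f y)) (X (ennreal t) \<omega>)) (\<lambda>t. A t \<omega>)
        = (\<integral>\<^sup>+r\<in>{0..}. ennreal (ext (apply_bcontfun f) (X (time_inverse (\<lambda>t. A t \<omega>) (ennreal r)) \<omega>)) \<partial>lborel)"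
      using f bcontfun_abs_le[of f] by (intro stieltjes_integral_eq[where B = "norm f"]) (auto simp: abs_le_iff)
    also have "\<dots> = (\<integral>\<^sup>+r. ennreal (dens f \<omega> r) \<partial>lborel)"
      by (intro nn_integral_cong) (auto simp: eq indicator_def)
    also have "\<dots> = ennreal (functional (\<lambda>_. 1) f \<omega>)"
    proof -
      have "0 \<le> dens f \<omega> r" for r by (simp add: eq ext_def f split: option.split)
      then show ?thesis unfolding functional_def using int by (subst nn_integral_eq_integral) auto
    qed
    finally show ?case by simp
  qed
  also have "\<dots> = (\<integral>\<^sup>+y. G x y * ennreal (f y) \<partial>\<mu>)"
    using bcontfun_borel[of f] by (intro revuz) measurable
  finally have "(\<integral>\<^sup>+\<omega>. ennreal (functional (\<lambda>_. 1) f \<omega>) \<partial>P (Some x)) = (\<integral>\<^sup>+y. G x y * ennreal (f y) \<partial>\<mu>)" .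
  then show ?thesis
    unfolding mean_def real_potential_def
    using nn functional_P[of "\<lambda>_. 1" f "Some x"] by (subst integral_eq_nn_integral) auto
qed

end

section \<open>Integrals up to a fixed operational time and their Laplace transforms\<close>

lemma laplace_integral:
  fixes D :: "real \<Rightarrow> real"
  assumes D [measurable]: "D \<in> borel_measurable borel" and C: "\<And>r. \<bar>D r\<bar> \<le> C * indicator {0..} r"
    and \<alpha>: "0 < \<alpha>"
  shows "(LINT t:{0..}|lborel. exp (- \<alpha> * t) * (LINT r|lborel. indicator {0..t} r * D r))
    = (LINT r|lborel. exp (- \<alpha> * r) * D r) / \<alpha>"
proof -
  have C0: "0 \<le> C" using order_trans[OF abs_ge_zero C[of 0]] by simp
  define g where "g t r = (if 0 \<le> r \<and> r \<le> t then exp (- \<alpha> * t) * D r else 0)" for t r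
  have gm: "(\<lambda>(t, r). g t r) \<in> borel_measurable (lborel \<Otimes>\<^sub>M lborel)"
  proof -
    have "(\<lambda>p. if 0 \<le> snd p \<and> snd p \<le> fst p then exp (- \<alpha> * fst p) * D (snd p) else 0)
        \<in> borel_measurable (lborel \<Otimes>\<^sub>M lborel)" by measurable
    then show ?thesis by (simp add: g_def case_prod_beta')
  qed
  have bnd: "\<bar>D r\<bar> \<le> C" for r using C[of r] C0 by (cases "0 \<le> r") auto
  have g_int: "integrable lborel (g t)" for t
  proof (rule integrableI_bounded_set[where A = "{0..t}" and B = "exp (- \<alpha> * t) * C"])
    show "g t \<in> borel_measurable lborel" unfolding g_def by measurable
    show "emeasure lborel {0..t} < \<infinity>" by (simp add: emeasure_lborel_Icc_eq)
    show "AE r in lborel. r \<in> {0..t} \<longrightarrow> norm (g t r) \<le> exp (- \<alpha> * t) * C"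
      using bnd by (auto simp: g_def abs_mult)
    show "AE r in lborel. r \<notin> {0..t} \<longrightarrow> g t r = 0" by (auto simp: g_def)
  qed auto
  have int: "integrable (lborel \<Otimes>\<^sub>M lborel) (\<lambda>(t, r). g t r)"
  proof (rule lborel_pair.Fubini_integrable[OF gm])
    show "AE t in lborel. integrable lborel (\<lambda>r. (\<lambda>(t, r). g t r) (t, r))" using g_int by simp
    have "set_integrable lborel {0..} (\<lambda>t. exp (- \<alpha> * t) * (C * t))"
      using \<alpha> by (rule set_integrable_laplace[where B = C])
        (auto intro!: continuous_intros simp: abs_mult C0 algebra_simps)
    then have dom: "integrable lborel (\<lambda>t. indicator {0..} t *\<^sub>R (exp (- \<alpha> * t) * (C * t)))"
      by (simp add: set_integrable_def)
    show "integrable lborel (\<lambda>t. \<integral>r. norm ((\<lambda>(t, r). g t r) (t, r)) \<partial>lborel)"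
    proof (rule Bochner_Integration.integrable_bound[OF dom])
      have "(\<lambda>p. norm ((\<lambda>(t, r). g t r) p)) \<in> borel_measurable (lborel \<Otimes>\<^sub>M lborel)"
        using gm by measurable
      then have "(\<lambda>t. \<integral>r. norm ((\<lambda>(t, r). g t r) (t, r)) \<partial>lborel) \<in> borel_measurable lborel"
        by (intro lborel.borel_measurable_lebesgue_integral) (simp add: case_prod_beta')
      then show "(\<lambda>t. \<integral>r. norm ((\<lambda>(t, r). g t r) (t, r)) \<partial>lborel) \<in> borel_measurable lborel" .
      show "AE t in lborel. norm (\<integral>r. norm ((\<lambda>(t, r). g t r) (t, r)) \<partial>lborel)
          \<le> norm (indicator {0..} t *\<^sub>R (exp (- \<alpha> * t) * (C * t)))"
      proof (rule AE_I2)
        fix t :: real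
        have "(\<integral>r. norm (g t r) \<partial>lborel) \<le> (\<integral>r. (exp (- \<alpha> * t) * C) * indicator {0..t} r \<partial>lborel)"
        proof (rule integral_mono)
          show "integrable lborel (\<lambda>r. norm (g t r))" by (rule integrable_norm[OF g_int])
          show "integrable lborel (\<lambda>r. (exp (- \<alpha> * t) * C) * indicator {0..t} r)"
            by (intro integrable_mult_right integrable_real_indicator) (auto simp: emeasure_lborel_Icc_eq)
          show "norm (g t r) \<le> (exp (- \<alpha> * t) * C) * indicator {0..t} r" for r
            using bnd[of r] by (auto simp: g_def abs_mult indicator_def)
        qed
        also have "\<dots> = indicator {0..} t *\<^sub>R (exp (- \<alpha> * t) * (C * t))"
          by (cases "0 \<le> t") auto
        finally show "norm (\<integral>r. norm ((\<lambda>(t, r). g t r) (t, r)) \<partial>lborel)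
          \<le> norm (indicator {0..} t *\<^sub>R (exp (- \<alpha> * t) * (C * t)))" by simp
      qed
    qed
  qed
  have "(LINT t:{0..}|lborel. exp (- \<alpha> * t) * (LINT r|lborel. indicator {0..t} r * D r))
      = (LINT t|lborel. LINT r|lborel. g t r)"
    unfolding set_lebesgue_integral_def
  proof (intro Bochner_Integration.integral_cong refl)
    fix t :: real
    have "g t r = (indicator {0..} t * exp (- \<alpha> * t)) * (indicator {0..t} r * D r)" for r
      by (auto simp: g_def indicator_def)
    then show "indicator {0..} t *\<^sub>R (exp (- \<alpha> * t) * (LINT r|lborel. indicator {0..t} r * D r)) = (LINT r|lborel. g t r)"
      by simp
  qed
  also have "\<dots> = (LINT r|lborel. LINT t|lborel. g t r)"
    by (rule lborel_pair.Fubini_integral[OF int, symmetric])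
  also have "\<dots> = (LINT r|lborel. exp (- \<alpha> * r) * D r / \<alpha>)"
  proof (intro Bochner_Integration.integral_cong refl)
    fix r :: real
    show "(LINT t|lborel. g t r) = exp (- \<alpha> * r) * D r / \<alpha>"
    proof (cases "0 \<le> r")
      case True
      have "(LINT t|lborel. g t r) = (LINT t|lborel. g (r + t) r)"
        by (subst lborel_integral_real_affine[where c = 1 and t = r]) auto
      also have "\<dots> = (LINT t|lborel. (exp (- \<alpha> * r) * D r) * (indicator {0..} t *\<^sub>R exp (- \<alpha> * t)))"
        using True by (intro Bochner_Integration.integral_cong refl)
          (auto simp: g_def indicator_def exp_add[symmetric] algebra_simps)
      also have "\<dots> = (exp (- \<alpha> * r) * D r) * (1 / \<alpha>)"
        using set_integral_exp_minus[OF \<alpha>] by (simp add: set_lebesgue_integral_def)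
      finally show ?thesis by simp
    next
      case False
      then have "D r = 0" using C[of r] by simp
      moreover have "g t r = 0" for t using False by (simp add: g_def)
      ultimately show ?thesis by simp
    qed
  qed
  finally show ?thesis by simp
qed

context time_change begin

lemma dens_borel: "dens u \<omega> \<in> borel_measurable borel"
  unfolding dens_def grid_step_def by measurable

text \<open>The clamping built into \<open>dens\<close> gives the bound on every path, exceptional
  ones included, as \<open>markov_augmented\<close> demands of its functional.\<close>

lemma functional_exp_bound:
  assumes "0 < \<alpha>"
  shows "\<bar>functional (\<lambda>r. exp (- \<alpha> * r)) u \<omega>\<bar> \<le> norm u / \<alpha>"
proof -
  have i: "integrable lborel (\<lambda>r. norm u * (indicator {0..} r *\<^sub>R exp (- \<alpha> * r)))"
    using set_integrable_exp_minus[OF assms] by (intro integrable_mult_right) (simp add: set_integrable_def)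
  have b: "\<bar>exp (- \<alpha> * r) * dens u \<omega> r\<bar> \<le> norm u * (indicator {0..} r *\<^sub>R exp (- \<alpha> * r))" for r
    using mult_left_mono[OF dens_bound[of u \<omega> r], of "exp (- \<alpha> * r)"] by (simp add: abs_mult mult.commute mult.left_commute)
  have j: "integrable lborel (\<lambda>r. exp (- \<alpha> * r) * dens u \<omega> r)"
    using dens_borel[of u \<omega>] b
    by (intro Bochner_Integration.integrable_bound[OF i]) (auto intro!: AE_I2 intro: order_trans[OF _ abs_ge_self])
  have "\<bar>functional (\<lambda>r. exp (- \<alpha> * r)) u \<omega>\<bar> \<le> (LINT r|lborel. \<bar>exp (- \<alpha> * r) * dens u \<omega> r\<bar>)"
    unfolding functional_def by (rule integral_abs_bound)
  also have "\<dots> \<le> (LINT r|lborel. norm u * (indicator {0..} r *\<^sub>R exp (- \<alpha> * r)))"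
    using b by (intro integral_mono integrable_abs i j) auto
  also have "\<dots> = norm u / \<alpha>"
    using set_integral_exp_minus[OF assms] by (simp add: set_lebesgue_integral_def)
  finally show ?thesis .
qed

lemma mean_exp_bound: "0 < \<alpha> \<Longrightarrow> \<bar>mean (\<lambda>r. exp (- \<alpha> * r)) u x\<bar> \<le> norm u / \<alpha>"
  unfolding mean_def
  by (rule prob_space.expectation_abs_le[OF prob_space_P], rule AE_I2, erule functional_exp_bound) simp

lemma mean_Icc_lipschitz:
  assumes "0 \<le> s" "s \<le> t"
  shows "\<bar>mean (indicator {0..t}) u x - mean (indicator {0..s}) u x\<bar> \<le> norm u * (t - s)"
proof -
  have "mean (indicator {0..t}) u x - mean (indicator {0..s}) u x
      = (\<integral>\<omega>. functional (indicator {0..t}) u \<omega> - functional (indicator {0..s}) u \<omega> \<partial>P (Some x))"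
    unfolding mean_def by (subst Bochner_Integration.integral_diff)
      (auto intro!: integrable_functional[where C = 1] simp: indicator_def)
  also have "\<bar>\<dots>\<bar> \<le> norm u * (t - s)"
  proof (rule prob_space.expectation_abs_le[OF prob_space_P], rule AE_I2)
    fix \<omega>
    note [measurable] = dens_borel[of u \<omega>]
    have int: "integrable lborel (\<lambda>r. indicator {a..b} r * dens u \<omega> r)" for a b
      using dens_bound'[of u \<omega>]
      by (intro integrableI_bounded_set[where A = "{a..b}" and B = "norm u"])
         (auto simp: emeasure_lborel_Icc_eq)
    have int': "integrable lborel (\<lambda>r. indicator {s<..t} r * dens u \<omega> r)"
      using dens_bound'[of u \<omega>]
      by (intro integrableI_bounded_set[where A = "{s<..t}" and B = "norm u"])
         (use assms in auto)
    have "functional (indicator {0..t}) u \<omega> - functional (indicator {0..s}) u \<omega>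
        = (LINT r|lborel. indicator {0..t} r * dens u \<omega> r - indicator {0..s} r * dens u \<omega> r)"
      unfolding functional_def using int by simp
    also have "\<dots> = (LINT r|lborel. indicator {s<..t} r * dens u \<omega> r)"
      using assms by (intro Bochner_Integration.integral_cong) (auto simp: indicator_def)
    also have "\<bar>\<dots>\<bar> \<le> (LINT r|lborel. \<bar>indicator {s<..t} r * dens u \<omega> r\<bar>)" by (rule integral_abs_bound)
    also have "\<dots> \<le> (LINT r|lborel. norm u * indicator {s<..t} r)"
      using int' dens_bound'[of u \<omega>]
      by (intro integral_mono integrable_abs integrable_mult_right integrable_real_indicator)
         (use assms in \<open>auto simp: indicator_def\<close>)
    also have "\<dots> = norm u * (t - s)" using assms by simp
    finally show "\<bar>functional (indicator {0..t}) u \<omega> - functional (indicator {0..s}) u \<omega>\<bar> \<le> norm u * (t - s)" .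
  qed (use assms in simp)
  finally show ?thesis .
qed

lemma mean_Icc_0: "mean (indicator {0..0}) u x = 0"
proof -
  have "functional (indicator {0..0}) u \<omega> = 0" for \<omega>
    unfolding functional_def
  proof (rule integral_eq_zero_AE)
    show "AE r in lborel. indicator {0..0} r * dens u \<omega> r = 0"
      using AE_lborel_singleton[of 0] by eventually_elim simp
  qed
  then show ?thesis by (simp add: mean_def)
qed

lemma mean_Icc_bound: "0 \<le> t \<Longrightarrow> \<bar>mean (indicator {0..t}) u x\<bar> \<le> norm u * t"
  using mean_Icc_lipschitz[of 0 t u x] by (simp only: mean_Icc_0) simp

lemma mean_Icc_continuous: "continuous_on {0..} (\<lambda>t. mean (indicator {0..t}) u x)"
proof (rule lipschitz_on_continuous_on)
  show "(norm u)-lipschitz_on {0..} (\<lambda>t. mean (indicator {0..t}) u x)"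
  proof (rule lipschitz_onI)
    fix s t :: real assume "s \<in> {0..}" "t \<in> {0..}"
    then show "dist (mean (indicator {0..s}) u x) (mean (indicator {0..t}) u x) \<le> norm u * dist s t"
      using mean_Icc_lipschitz[of s t u x] mean_Icc_lipschitz[of t s u x]
      by (cases "s \<le> t") (auto simp: dist_real_def abs_minus_commute)
  qed simp
qed

text \<open>Fubini over paths, justified by the linear bound in \<open>t\<close>, reduces this to
  the identity for a bounded density, which holds on every path.\<close>

lemma mean_Icc_laplace:
  assumes \<alpha>: "0 < \<alpha>"
  shows "(LINT t:{0..}|lborel. exp (- \<alpha> * t) * mean (indicator {0..t}) u x) = mean (\<lambda>r. exp (- \<alpha> * r)) u x / \<alpha>"
proof -
  interpret px: prob_space "P (Some x)" by (rule prob_space_P)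
  interpret pair: pair_sigma_finite lborel "P (Some x)" by unfold_locales
  define g where "g t \<omega> = indicator {0..} t * exp (- \<alpha> * t) * functional (indicator {0..t}) u \<omega>" for t \<omega>
  have Fm: "(\<lambda>(t, \<omega>). functional (indicator {0..t}) u \<omega>) \<in> borel_measurable (lborel \<Otimes>\<^sub>M P (Some x))"
  proof -
    note [measurable] = dens_P[of u "Some x"]
    have "(\<lambda>p. (snd (fst p), snd p)) \<in> (lborel \<Otimes>\<^sub>M P (Some x)) \<Otimes>\<^sub>M lborel \<rightarrow>\<^sub>M P (Some x) \<Otimes>\<^sub>M lborel"
      by measurable
    from measurable_compose[OF this dens_P[of u "Some x"]]
    have [measurable]: "(\<lambda>p. dens u (snd (fst p)) (snd p)) \<in> borel_measurable ((lborel \<Otimes>\<^sub>M P (Some x)) \<Otimes>\<^sub>M lborel)"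
      by (simp add: case_prod_beta')
    have "(\<lambda>p. (if 0 \<le> snd p \<and> snd p \<le> fst (fst p) then 1 else 0) * dens u (snd (fst p)) (snd p))
      \<in> borel_measurable ((lborel \<Otimes>\<^sub>M P (Some x)) \<Otimes>\<^sub>M lborel)" by measurable
    then have "(\<lambda>q. LINT r|lborel. (if 0 \<le> r \<and> r \<le> fst q then 1 else 0) * dens u (snd q) r)
      \<in> borel_measurable (lborel \<Otimes>\<^sub>M P (Some x))"
      by (intro lborel.borel_measurable_lebesgue_integral) (simp add: case_prod_beta')
    moreover have "indicator {0..t} r = (if 0 \<le> r \<and> r \<le> t then 1 else 0 :: real)" for t r :: real
      by (simp add: indicator_def)
    ultimately show ?thesis by (simp add: functional_def case_prod_beta')
  qed
  have gm: "(\<lambda>(t, \<omega>). g t \<omega>) \<in> borel_measurable (lborel \<Otimes>\<^sub>M P (Some x))"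
  proof -
    have "(\<lambda>p. indicator {0..} (fst p) * exp (- \<alpha> * fst p) * (\<lambda>(t, \<omega>). functional (indicator {0..t}) u \<omega>) p)
      \<in> borel_measurable (lborel \<Otimes>\<^sub>M P (Some x))"
      using Fm by measurable
    then show ?thesis by (simp add: g_def case_prod_beta')
  qed
  have F_bound: "\<bar>functional (indicator {0..t}) u \<omega>\<bar> \<le> norm u * t" if "0 \<le> t" for t \<omega>
  proof -
    have int: "integrable lborel (\<lambda>r. indicator {0..t} r * dens u \<omega> r)"
      using dens_bound'[of u \<omega>] dens_borel[of u \<omega>]
      by (intro integrableI_bounded_set[where A = "{0..t}" and B = "norm u"])
         (auto simp: emeasure_lborel_Icc_eq)
    have "\<bar>functional (indicator {0..t}) u \<omega>\<bar> \<le> (LINT r|lborel. \<bar>indicator {0..t} r * dens u \<omega> r\<bar>)"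
      unfolding functional_def by (rule integral_abs_bound)
    also have "\<dots> \<le> (LINT r|lborel. norm u * indicator {0..t} r)"
      using int dens_bound'[of u \<omega>]
      by (intro integral_mono integrable_abs integrable_mult_right integrable_real_indicator)
         (auto simp: indicator_def emeasure_lborel_Icc_eq)
    also have "\<dots> = norm u * t" using that by simp
    finally show ?thesis .
  qed
  have g_bound: "\<bar>g t \<omega>\<bar> \<le> indicator {0..} t * exp (- \<alpha> * t) * (norm u * t)" for t \<omega>
    using F_bound[of t \<omega>] by (cases "0 \<le> t") (auto simp: g_def abs_mult)
  have Ft: "functional (indicator {0..t}) u \<in> borel_measurable (P (Some x))" for t
    by (rule functional_P) measurable
  have g_int: "integrable (P (Some x)) (g t)" for t
    using g_bound[of t] Ft[of t]
    by (intro px.integrable_const_bound[where B = "indicator {0..} t * exp (- \<alpha> * t) * (norm u * t)"])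
       (auto simp: g_def[abs_def])
  have int: "integrable (lborel \<Otimes>\<^sub>M P (Some x)) (\<lambda>(t, \<omega>). g t \<omega>)"
  proof (rule pair.Fubini_integrable[OF gm])
    show "AE t in lborel. integrable (P (Some x)) (\<lambda>\<omega>. (\<lambda>(t, \<omega>). g t \<omega>) (t, \<omega>))" using g_int by simp
    have "set_integrable lborel {0..} (\<lambda>t. exp (- \<alpha> * t) * (norm u * t))"
      using \<alpha> by (rule set_integrable_laplace[where B = "norm u"])
        (auto intro!: continuous_intros simp: abs_mult algebra_simps)
    then have dom: "integrable lborel (\<lambda>t. indicator {0..} t * exp (- \<alpha> * t) * (norm u * t))"
      by (simp add: set_integrable_def mult.assoc)
    show "integrable lborel (\<lambda>t. \<integral>\<omega>. norm ((\<lambda>(t, \<omega>). g t \<omega>) (t, \<omega>)) \<partial>P (Some x))"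
    proof (rule Bochner_Integration.integrable_bound[OF dom])
      have "(\<lambda>p. norm ((\<lambda>(t, \<omega>). g t \<omega>) p)) \<in> borel_measurable (lborel \<Otimes>\<^sub>M P (Some x))"
        using gm by measurable
      then show "(\<lambda>t. \<integral>\<omega>. norm ((\<lambda>(t, \<omega>). g t \<omega>) (t, \<omega>)) \<partial>P (Some x)) \<in> borel_measurable lborel"
        by (intro px.borel_measurable_lebesgue_integral) (simp add: case_prod_beta')
      show "AE t in lborel. norm (\<integral>\<omega>. norm ((\<lambda>(t, \<omega>). g t \<omega>) (t, \<omega>)) \<partial>P (Some x))
          \<le> norm (indicator {0..} t * exp (- \<alpha> * t) * (norm u * t))"
      proof (rule AE_I2)
        fix t :: real
        have "\<bar>\<integral>\<omega>. norm (g t \<omega>) \<partial>P (Some x)\<bar> \<le> indicator {0..} t * exp (- \<alpha> * t) * (norm u * t)"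
          using g_bound[of t] by (intro px.expectation_abs_le) (auto simp: indicator_def)
        then show "norm (\<integral>\<omega>. norm ((\<lambda>(t, \<omega>). g t \<omega>) (t, \<omega>)) \<partial>P (Some x))
          \<le> norm (indicator {0..} t * exp (- \<alpha> * t) * (norm u * t))"
          by (auto intro: order_trans[OF _ abs_ge_self])
      qed
    qed
  qed
  have "(LINT t:{0..}|lborel. exp (- \<alpha> * t) * mean (indicator {0..t}) u x) = (LINT t|lborel. \<integral>\<omega>. g t \<omega> \<partial>P (Some x))"
    unfolding set_lebesgue_integral_def mean_def g_def by (simp add: mult.assoc)
  also have "\<dots> = (\<integral>\<omega>. (LINT t|lborel. g t \<omega>) \<partial>P (Some x))"
    by (rule pair.Fubini_integral[OF int, symmetric])
  also have "\<dots> = (\<integral>\<omega>. functional (\<lambda>r. exp (- \<alpha> * r)) u \<omega> / \<alpha> \<partial>P (Some x))"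
  proof (intro Bochner_Integration.integral_cong refl)
    fix \<omega>
    show "(LINT t|lborel. g t \<omega>) = functional (\<lambda>r. exp (- \<alpha> * r)) u \<omega> / \<alpha>"
      using laplace_integral[OF dens_borel dens_bound \<alpha>, of u \<omega>]
      by (simp add: functional_def g_def set_lebesgue_integral_def mult.assoc)
  qed
  finally show ?thesis by (simp add: mean_def)
qed

end

section \<open>The resolvent equation by conditioning at grid times\<close>

context time_change begin

lemma additive:
  "s < \<infinity> \<Longrightarrow> t < \<infinity> \<Longrightarrow> AE \<omega> in P x. A (t + s) \<omega> = A t \<omega> + A s (\<theta> t \<omega>)"
  using pcaf by (simp add: PCAF_def)

text \<open>A version of the discounted functional of the shifted path that involves no shift: it is
  read off from the original density beyond the clock reading at \<open>t\<close>, which makes it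
  measurable.\<close>

definition future :: "real \<Rightarrow> ('a \<Rightarrow>\<^sub>C real) \<Rightarrow> ennreal \<Rightarrow> 'w \<Rightarrow> real" where
  "future \<alpha> u t \<omega> = discounted \<alpha> (dens u \<omega>) (enn2real (A t \<omega>))"

lemma future_measurable: "future \<alpha> u t \<in> borel_measurable (P z)"
proof -
  have [measurable]: "A t \<in> borel_measurable (P z)"
    by (rule measurable_augmented_P[OF A_augmented_infinity])
  have "(\<lambda>p. (fst p, enn2real (A t (fst p)) + snd p)) \<in> P z \<Otimes>\<^sub>M lborel \<rightarrow>\<^sub>M P z \<Otimes>\<^sub>M lborel"
    by measurable
  from measurable_compose[OF this dens_P[of u z]]
  have [measurable]: "(\<lambda>p. dens u (fst p) (enn2real (A t (fst p)) + snd p)) \<in> borel_measurable (P z \<Otimes>\<^sub>M lborel)"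
    by (simp add: case_prod_beta')
  have "(\<lambda>p. indicator {0..} (snd p) *\<^sub>R (exp (- \<alpha> * snd p) * dens u (fst p) (enn2real (A t (fst p)) + snd p)))
      \<in> borel_measurable (P z \<Otimes>\<^sub>M lborel)" by measurable
  then have "(\<lambda>\<omega>. LINT r|lborel. indicator {0..} r *\<^sub>R (exp (- \<alpha> * r) * dens u \<omega> (enn2real (A t \<omega>) + r)))
      \<in> borel_measurable (P z)"
    by (intro lborel.borel_measurable_lebesgue_integral) (simp add: case_prod_beta')
  then show ?thesis
    by (simp add: future_def[abs_def] discounted_shift set_lebesgue_integral_def)
qed

text \<open>Additivity at countably many times identifies the functional of the shifted path.\<close>

lemma functional_shift:
  assumes \<alpha>: "0 < \<alpha>" and t: "t < \<infinity>"
  shows "AE \<omega> in P (Some x). functional (\<lambda>r. exp (- \<alpha> * r)) u (\<theta> t \<omega>) = future \<alpha> u t \<omega>"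
proof -
  have "AE \<omega> in P (Some x). \<forall>k i. A (t + ennreal (real i / real k)) \<omega> = A t \<omega> + A (ennreal (real i / real k)) (\<theta> t \<omega>)"
    unfolding AE_all_countable using t by (intro allI additive) auto
  then show ?thesis using AE_good[of x] AE_space
  proof eventually_elim
    case (elim \<omega>)
    then have \<omega>: "\<omega> \<in> \<Omega>" by (simp add: space_P)
    interpret finite_clock_path "\<lambda>t. A t \<omega>" "\<lambda>t. X t \<omega>" using elim by (simp add: good_def)
    let ?a = "\<lambda>s. A (t + s) \<omega> - A t \<omega>" and ?x = "\<lambda>s. X (t + s) \<omega>"
    interpret s: finite_clock_path ?a ?x by (rule finite_clock_path_shift[OF t])
    have A_shift: "A (ennreal (real i / real k)) (\<theta> t \<omega>) = ?a (ennreal (real i / real k))" for k i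
      using elim(1) clock_finite[of t] by (simp add: less_top)
    have X_shift: "X s (\<theta> t \<omega>) = ?x s" for s
      using homogeneous[OF \<omega>] by (simp add: add.commute)
    have "dens u (\<theta> t \<omega>) r = s.time_changed (apply_bcontfun u) r" for r
    proof (cases "0 \<le> r")
      case True
      have "grid_step (\<lambda>t'. ext (apply_bcontfun u) (X t' (\<theta> t \<omega>))) (\<lambda>t'. A t' (\<theta> t \<omega>)) k r
          = grid_step (\<lambda>s. ext (apply_bcontfun u) (?x s)) ?a k r" for k
        by (rule grid_step_cong) (simp_all only: X_shift A_shift)
      moreover have "(\<lambda>k. grid_step (\<lambda>s. ext (apply_bcontfun u) (?x s)) ?a k r)
          \<longlonglongrightarrow> ext (apply_bcontfun u) (?x (time_inverse ?a (ennreal r)))"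
        by (rule s.grid_step_tendsto[OF s.right_cont_ext s.ext_infinity True]) simp
      ultimately have "lim (\<lambda>k. grid_step (\<lambda>t'. ext (apply_bcontfun u) (X t' (\<theta> t \<omega>))) (\<lambda>t'. A t' (\<theta> t \<omega>)) k r)
          = ext (apply_bcontfun u) (?x (time_inverse ?a (ennreal r)))"
        by (simp only: limI)
      moreover have "\<bar>ext (apply_bcontfun u) (?x (time_inverse ?a (ennreal r)))\<bar> \<le> norm u"
        by (rule s.ext_abs_le) (rule bcontfun_abs_le)
      ultimately show ?thesis by (auto simp: dens_def s.time_changed_def abs_le_iff)
    qed (simp add: dens_def s.time_changed_def)
    then have "functional (\<lambda>r. exp (- \<alpha> * r)) u (\<theta> t \<omega>)
        = (LINT r:{0..}|lborel. exp (- \<alpha> * r) * ext (apply_bcontfun u) (?x (time_inverse ?a (ennreal r))))"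
      unfolding functional_def set_lebesgue_integral_def
      by (intro Bochner_Integration.integral_cong) (auto simp: s.time_changed_def indicator_def)
    also have "\<dots> = future \<alpha> u t \<omega>"
      unfolding future_def dens_good[OF elim(2)]
      by (rule discounted_path_shift[OF continuous_on_apply_bcontfun bcontfun_abs_le \<alpha> t])
    finally show ?case .
  qed
qed

text \<open>The path may be dead when the Markov property is applied, so the mean has to be known at
  the cemetery too: it is 0, in agreement with the extension by \<open>ext\<close>.\<close>

lemma functional_None: "AE \<omega> in P None. functional w u \<omega> = 0"
  using start_cemetery AE_space
proof eventually_elim
  case (elim \<omega>)
  then have "X t \<omega> = None" for t
    using absorbing[of \<omega> 0 t] by (simp add: space_P)
  then have "dens u \<omega> r = 0" for r by (simp add: dens_def grid_step_def ext_def)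
  then show ?case by (simp add: functional_def)
qed

text \<open>As a function of the starting point, the mean of the functional is \<open>ext\<close> of
  \<open>v\<close>. Its measurability is inherited from continuity of \<open>v\<close>, which is why
  the resolvent is supplied as a bounded continuous function.\<close>

lemma markov_future:
  assumes \<alpha>: "0 < \<alpha>" and t: "t < \<infinity>"
    and v: "\<And>y. apply_bcontfun v y = mean (\<lambda>r. exp (- \<alpha> * r)) u y"
    and Y: "Y \<in> borel_measurable (M t)" "integrable (P (Some x)) Y"
  shows "(\<integral>\<omega>. Y \<omega> * future \<alpha> u t \<omega> \<partial>P (Some x)) = (\<integral>\<omega>. Y \<omega> * ext (apply_bcontfun v) (X t \<omega>) \<partial>P (Some x))"
proof (rule markov_augmented[where Z = "functional (\<lambda>r. exp (- \<alpha> * r)) u" and C = "norm u / \<alpha>"])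
  have w: "(\<lambda>r. exp (- \<alpha> * r)) \<in> borel_measurable borel" by measurable
  show "functional (\<lambda>r. exp (- \<alpha> * r)) u \<in> borel_measurable (augmented \<infinity>)"
    by (rule functional_augmented[OF w])
  show "functional (\<lambda>r. exp (- \<alpha> * r)) u \<in> borel_measurable (P z)" for z
    by (rule functional_P[OF w])
  show "\<bar>functional (\<lambda>r. exp (- \<alpha> * r)) u \<omega>\<bar> \<le> norm u / \<alpha>" for \<omega>
    by (rule functional_exp_bound[OF \<alpha>])
  show "ext (apply_bcontfun v) z = (\<integral>\<omega>. functional (\<lambda>r. exp (- \<alpha> * r)) u \<omega> \<partial>P z)" for z
  proof (cases z)
    case None
    have "(\<integral>\<omega>. functional (\<lambda>r. exp (- \<alpha> * r)) u \<omega> \<partial>P None) = 0"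
      by (rule integral_eq_zero_AE[OF functional_None])
    then show ?thesis using None by (simp add: ext_def)
  next
    case (Some y)
    then show ?thesis by (simp add: ext_def v mean_def)
  qed
  show "ext (apply_bcontfun v) \<in> borel_measurable pt_borel"
    by (rule measurable_ext[OF bcontfun_borel])
qed (use Y functional_shift[OF \<alpha> t] future_measurable in auto)

lemma exp_indicator_measurable:
  fixes f g :: "'b \<Rightarrow> real"
  assumes "f \<in> borel_measurable N" "g \<in> borel_measurable N"
  shows "(\<lambda>\<omega>. LINT r:{0..}|lborel. exp (- \<beta> * r) * indicator {f \<omega>..<g \<omega>} r) \<in> borel_measurable N"
proof -
  note [measurable] = assms
  have "(\<lambda>p. (if 0 \<le> snd p then 1 else 0) * (exp (- \<beta> * snd p) *
      (if f (fst p) \<le> snd p \<and> snd p < g (fst p) then 1 else 0))) \<in> borel_measurable (N \<Otimes>\<^sub>M lborel)"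
    by measurable
  then have "(\<lambda>\<omega>. LINT r|lborel. (if 0 \<le> r then 1 else 0) * (exp (- \<beta> * r) *
      (if f \<omega> \<le> r \<and> r < g \<omega> then 1 else 0))) \<in> borel_measurable N"
    by (intro lborel.borel_measurable_lebesgue_integral) (simp add: case_prod_beta')
  moreover have "indicator {a..<b} r = (if a \<le> r \<and> r < b then 1 else 0 :: real)" for a b r :: real
    by (simp add: indicator_def)
  moreover have "indicator {0..} r = (if 0 \<le> r then 1 else 0 :: real)" for r :: real
    by (simp add: indicator_def)
  ultimately show ?thesis unfolding set_lebesgue_integral_def by simp
qed

text \<open>The discounted length of one cell of operational time, i.e. the coefficient of a sample
  of \<open>h\<close> in the Laplace integral of \<open>grid_step h\<close>.\<close>

definition weight :: "real \<Rightarrow> nat \<Rightarrow> nat \<Rightarrow> 'w \<Rightarrow> real" where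
  "weight \<beta> k i \<omega> = (LINT r:{0..}|lborel. exp (- \<beta> * r) *
    indicator {enn2real (A (ennreal (real i / real k)) \<omega>)..<enn2real (A (ennreal (real (Suc i) / real k)) \<omega>)} r)"

lemma measurable_M_mono:
  assumes "f \<in> M s \<rightarrow>\<^sub>M N" "s \<le> t"
  shows "f \<in> M t \<rightarrow>\<^sub>M N"
  by (rule measurableI)
     (use measurable_space[OF assms(1)] measurable_sets[OF assms(1)] sets_F_mono[OF assms(2)] in \<open>auto simp: space_F\<close>)

text \<open>Both clock readings of the cell are known at its right end, the very time at which the
  path is sampled; so the weight is an admissible factor for conditioning there.\<close>

lemma weight_measurable: "weight \<beta> k i \<in> borel_measurable (M (ennreal (real (Suc i) / real k)))"
proof -
  have "ennreal (real i / real k) \<le> ennreal (real (Suc i) / real k)"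
    by (intro ennreal_leI divide_right_mono) auto
  then have "A (ennreal (real i / real k)) \<in> borel_measurable (M (ennreal (real (Suc i) / real k)))"
    by (rule measurable_M_mono[OF A_M])
  then show ?thesis
    unfolding weight_def[abs_def]
    using A_M[of "ennreal (real (Suc i) / real k)"]
    by (intro exp_indicator_measurable borel_measurable_enn2real)
qed

lemma weight_eq:
  assumes \<omega>: "good \<omega>" and \<beta>: "0 \<le> \<beta>"
  shows "set_integrable lborel {0..} (\<lambda>r. exp (- \<beta> * r) *
    indicator {enn2real (A (ennreal (real i / real k)) \<omega>)..<enn2real (A (ennreal (real (Suc i) / real k)) \<omega>)} r)"
    and "\<bar>weight \<beta> k i \<omega>\<bar> \<le> enn2real (A \<infinity> \<omega>)"
proof -
  interpret finite_clock_path "\<lambda>t. A t \<omega>" "\<lambda>t. X t \<omega>" using \<omega> by (simp add: good_def)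
  let ?p = "enn2real (A (ennreal (real i / real k)) \<omega>)" and ?q = "enn2real (A (ennreal (real (Suc i) / real k)) \<omega>)"
  have L: "?q \<le> enn2real (A \<infinity> \<omega>)" by (intro clock_real_mono) auto
  let ?f = "\<lambda>r. indicator {0..} r *\<^sub>R (exp (- \<beta> * r) * indicator {?p..<?q} r)"
  have dom: "integrable lborel (\<lambda>r. indicator {0..enn2real (A \<infinity> \<omega>)} r :: real)"
    by (intro integrable_real_indicator) auto
  have b: "\<bar>?f r\<bar> \<le> indicator {0..enn2real (A \<infinity> \<omega>)} r" for r
    using L \<beta> by (auto simp: indicator_def)
  have i: "integrable lborel ?f"
    by (rule Bochner_Integration.integrable_bound[OF dom])
       (use b in \<open>auto intro!: AE_I2 intro: order_trans[OF _ abs_ge_self] simp del: scaleR_conv_of_real\<close>)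
  then show "set_integrable lborel {0..} (\<lambda>r. exp (- \<beta> * r) * indicator {?p..<?q} r)"
    by (simp add: set_integrable_def)
  have "\<bar>weight \<beta> k i \<omega>\<bar> \<le> (LINT r|lborel. \<bar>?f r\<bar>)"
    unfolding weight_def set_lebesgue_integral_def by (rule integral_abs_bound)
  also have "\<dots> \<le> (LINT r|lborel. indicator {0..enn2real (A \<infinity> \<omega>)} r)"
    using b by (intro integral_mono integrable_abs i dom) auto
  also have "\<dots> = enn2real (A \<infinity> \<omega>)" by simp
  finally show "\<bar>weight \<beta> k i \<omega>\<bar> \<le> enn2real (A \<infinity> \<omega>)" .
qed

lemma integral_grid_step_weights:
  assumes "good \<omega>" "0 \<le> \<beta>"
  shows "(LINT r:{0..}|lborel. exp (- \<beta> * r) * grid_step h (\<lambda>t. A t \<omega>) k r)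
    = (\<Sum>i<k*k. weight \<beta> k i \<omega> * h (ennreal (real (Suc i) / real k)))"
proof -
  let ?I = "\<lambda>i r. indicator {enn2real (A (ennreal (real i / real k)) \<omega>)..<enn2real (A (ennreal (real (Suc i) / real k)) \<omega>)} r :: real"
  let ?h = "\<lambda>i. h (ennreal (real (Suc i) / real k))"
  have "(LINT r:{0..}|lborel. exp (- \<beta> * r) * grid_step h (\<lambda>t. A t \<omega>) k r)
      = (LINT r|lborel. (\<Sum>i<k*k. (indicator {0..} r *\<^sub>R (exp (- \<beta> * r) * ?I i r)) * ?h i))"
    unfolding set_lebesgue_integral_def grid_step_def
    by (intro Bochner_Integration.integral_cong refl, simp only: real_scaleR_def sum_distrib_left)
       (intro sum.cong refl, simp only: mult_ac)
  also have "\<dots> = (\<Sum>i<k*k. (LINT r|lborel. (indicator {0..} r *\<^sub>R (exp (- \<beta> * r) * ?I i r)) * ?h i))"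
    using weight_eq(1)[OF assms] unfolding set_integrable_def
    by (intro Bochner_Integration.integral_sum integrable_mult_left) blast
  also have "\<dots> = (\<Sum>i<k*k. weight \<beta> k i \<omega> * ?h i)"
    by (simp only: weight_def set_lebesgue_integral_def Bochner_Integration.integral_mult_left_zero)
  finally show ?thesis .
qed

text \<open>Two families of weighted sums have equal means: one samples \<open>v\<close> along the
  path, the other the discounted future, and at each grid time the two samples have the same
  conditional mean. In the limit the first family gives the mean for \<open>v\<close>, the second
  the resolvent identity of the single path.\<close>

lemma resolvent_equation:
  assumes \<alpha>: "0 < \<alpha>" and \<beta>: "0 \<le> \<beta>"
    and v: "\<And>y. apply_bcontfun v y = mean (\<lambda>r. exp (- \<alpha> * r)) u y"
  shows "(\<alpha> - \<beta>) * mean (\<lambda>r. exp (- \<beta> * r)) v x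
    = mean (\<lambda>r. exp (- \<beta> * r)) u x - mean (\<lambda>r. exp (- \<alpha> * r)) u x"
proof -
  let ?P = "P (Some x)"
  let ?L = "\<lambda>\<omega>. enn2real (A \<infinity> \<omega>)"
  define hv where "hv \<omega> t = ext (apply_bcontfun v) (X t \<omega>)" for \<omega> t
  define hF where "hF \<omega> t = future \<alpha> u t \<omega>" for \<omega> t
  define S where "S h k \<omega> = (\<Sum>i<k*k. weight \<beta> k i \<omega> * h \<omega> (ennreal (real (Suc i) / real k)))" for h :: "'w \<Rightarrow> ennreal \<Rightarrow> real" and k \<omega>
  have w: "(\<lambda>r. exp (- \<beta> * r)) \<in> borel_measurable borel" "\<And>r. 0 \<le> r \<Longrightarrow> \<bar>exp (- \<beta> * r)\<bar> \<le> 1"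
    using \<beta> by auto
  have hv_m: "(\<lambda>\<omega>. hv \<omega> t) \<in> borel_measurable ?P" for t
    unfolding hv_def by (rule measurable_augmented_P[OF ext_augmented])
  have hF_m: "(\<lambda>\<omega>. hF \<omega> t) \<in> borel_measurable ?P" for t
    unfolding hF_def by (rule future_measurable)
  have W_m: "weight \<beta> k i \<in> borel_measurable ?P" for k i
    by (rule measurable_M_P[OF weight_measurable])
  have W_int: "integrable ?P (weight \<beta> k i)" for k i
  proof (rule Bochner_Integration.integrable_bound[OF integrable_A_infinity W_m])
    show "AE \<omega> in ?P. norm (weight \<beta> k i \<omega>) \<le> norm (?L \<omega>)"
      using AE_good[of x] by eventually_elim (use weight_eq(2)[OF _ \<beta>] in auto)
  qed
  have hv_path: "right_cont (hv \<omega>)" "hv \<omega> \<infinity> = 0" "\<bar>hv \<omega> t\<bar> \<le> norm v" if "good \<omega>" for \<omega> t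
  proof -
    interpret finite_clock_path "\<lambda>t. A t \<omega>" "\<lambda>t. X t \<omega>" using that by (simp add: good_def)
    show "right_cont (hv \<omega>)" unfolding hv_def[abs_def] by (rule right_cont_ext) simp
    show "hv \<omega> \<infinity> = 0" unfolding hv_def by (rule ext_infinity)
    show "\<bar>hv \<omega> t\<bar> \<le> norm v" unfolding hv_def by (rule ext_abs_le) (rule bcontfun_abs_le)
  qed
  have hF_path: "right_cont (hF \<omega>)" "hF \<omega> \<infinity> = 0" "\<bar>hF \<omega> t\<bar> \<le> norm u / \<alpha>"
    "(\<alpha> - \<beta>) * (LINT r:{0..}|lborel. exp (- \<beta> * r) * hF \<omega> (time_inverse (\<lambda>t. A t \<omega>) (ennreal r)))
      = functional (\<lambda>r. exp (- \<beta> * r)) u \<omega> - functional (\<lambda>r. exp (- \<alpha> * r)) u \<omega>" if \<omega>: "good \<omega>" for \<omega> t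
  proof -
    interpret finite_clock_path "\<lambda>t. A t \<omega>" "\<lambda>t. X t \<omega>" using \<omega> by (simp add: good_def)
    note path = right_cont_discounted discounted_infinity discounted_clock_bound discounted_resolvent
    note path' = path[where f = "apply_bcontfun u" and B = "norm u", OF continuous_on_apply_bcontfun bcontfun_abs_le \<alpha>]
    have hF_eq: "hF \<omega> = (\<lambda>t. discounted \<alpha> (time_changed (apply_bcontfun u)) (enn2real (A t \<omega>)))"
      by (simp add: hF_def[abs_def] future_def dens_good[OF \<omega>])
    show "right_cont (hF \<omega>)" "hF \<omega> \<infinity> = 0" "\<bar>hF \<omega> t\<bar> \<le> norm u / \<alpha>"
      unfolding hF_eq by (rule path'(1), rule path'(2), rule path'(3))
    let ?D = "\<lambda>r. ext (apply_bcontfun u) (X (time_inverse (\<lambda>t. A t \<omega>) (ennreal r)) \<omega>)"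
    have int: "set_integrable lborel {0..} (\<lambda>r. exp (- c * r) * ?D r)" if "0 \<le> c" for c
    proof -
      have "integrable lborel (\<lambda>r. exp (- c * r) * dens u \<omega> r)"
        by (rule functional_integrable_good(1)[OF \<omega>, where C = 1]) (use that in auto)
      then show ?thesis
        unfolding set_integrable_def dens_good[OF \<omega>] time_changed_def by (simp add: mult.left_commute)
    qed
    have "(\<alpha> - \<beta>) * (LINT r:{0..}|lborel. exp (- \<beta> * r) * hF \<omega> (time_inverse (\<lambda>t. A t \<omega>) (ennreal r)))
        = (LINT r:{0..}|lborel. (exp (- \<beta> * r) - exp (- \<alpha> * r)) * ?D r)"
      unfolding hF_eq by (rule path'(4)[OF \<beta>])
    also have "\<dots> = (LINT r:{0..}|lborel. exp (- \<beta> * r) * ?D r - exp (- \<alpha> * r) * ?D r)"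
      by (simp add: left_diff_distrib)
    also have "\<dots> = functional (\<lambda>r. exp (- \<beta> * r)) u \<omega> - functional (\<lambda>r. exp (- \<alpha> * r)) u \<omega>"
      unfolding functional_good[OF \<omega>] using int[OF \<beta>] int[of \<alpha>] \<alpha> by (subst set_integral_diff) auto
    finally show "(\<alpha> - \<beta>) * (LINT r:{0..}|lborel. exp (- \<beta> * r) * hF \<omega> (time_inverse (\<lambda>t. A t \<omega>) (ennreal r)))
      = functional (\<lambda>r. exp (- \<beta> * r)) u \<omega> - functional (\<lambda>r. exp (- \<alpha> * r)) u \<omega>" .
  qed
  have lim: "(\<lambda>k. \<integral>\<omega>. S h k \<omega> \<partial>?P)
      \<longlonglongrightarrow> (\<integral>\<omega>. g \<omega> \<partial>?P)"
    if h: "\<And>\<omega>. good \<omega> \<Longrightarrow> right_cont (h \<omega>)" "\<And>\<omega>. good \<omega> \<Longrightarrow> h \<omega> \<infinity> = 0" "\<And>\<omega> t. good \<omega> \<Longrightarrow> \<bar>h \<omega> t\<bar> \<le> B"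
      and hm: "\<And>t. (\<lambda>\<omega>. h \<omega> t) \<in> borel_measurable ?P" and gm: "g \<in> borel_measurable ?P"
      and g: "\<And>\<omega>. good \<omega> \<Longrightarrow> g \<omega> = (LINT r:{0..}|lborel. exp (- \<beta> * r) * h \<omega> (time_inverse (\<lambda>t. A t \<omega>) (ennreal r)))"
    for h B g
  proof (rule integral_dominated_convergence[where w = "\<lambda>\<omega>. 1 * B * ?L \<omega>"])
    show "integrable ?P (\<lambda>\<omega>. 1 * B * ?L \<omega>)" by (rule integrable_mult_right[OF integrable_A_infinity])
    show "S h k \<in> borel_measurable ?P" for k
      unfolding S_def[abs_def] using hm W_m by measurable
    show "g \<in> borel_measurable ?P" by (rule gm)
    show "AE \<omega> in ?P. (\<lambda>k. S h k \<omega>) \<longlonglongrightarrow> g \<omega>"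
      using AE_good[of x]
    proof eventually_elim
      case (elim \<omega>)
      interpret finite_clock_path "\<lambda>t. A t \<omega>" "\<lambda>t. X t \<omega>" using elim by (simp add: good_def)
      show ?case
        unfolding S_def g[OF elim] integral_grid_step_weights[OF elim \<beta>, symmetric]
        by (rule integral_grid_step_tendsto[OF h(1-3)[OF elim] w])
    qed
    show "AE \<omega> in ?P. norm (S h k \<omega>) \<le> 1 * B * ?L \<omega>" for k
      using AE_good[of x]
    proof eventually_elim
      case (elim \<omega>)
      interpret finite_clock_path "\<lambda>t. A t \<omega>" "\<lambda>t. X t \<omega>" using elim by (simp add: good_def)
      show ?case
        unfolding S_def integral_grid_step_weights[OF elim \<beta>, symmetric] real_norm_def
        by (rule integral_grid_step_bound[OF h(1-3)[OF elim] w])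
    qed
  qed
  have "(\<lambda>k. \<integral>\<omega>. S hv k \<omega> \<partial>?P) \<longlonglongrightarrow> (\<integral>\<omega>. functional (\<lambda>r. exp (- \<beta> * r)) v \<omega> \<partial>?P)"
    by (rule lim[OF hv_path hv_m functional_P[OF w(1)]]) (simp_all add: functional_good hv_def)
  then have l1: "(\<lambda>k. \<integral>\<omega>. S hv k \<omega> \<partial>?P) \<longlonglongrightarrow> mean (\<lambda>r. exp (- \<beta> * r)) v x"
    by (simp add: mean_def)
  define g where "g \<omega> = (functional (\<lambda>r. exp (- \<beta> * r)) u \<omega> - functional (\<lambda>r. exp (- \<alpha> * r)) u \<omega>)" for \<omega>
  have f_m: "functional (\<lambda>r. exp (- c * r)) u \<in> borel_measurable ?P" for c by (rule functional_P) measurable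
  have S_eq: "(\<integral>\<omega>. S hv k \<omega> \<partial>?P) = (\<integral>\<omega>. S hF k \<omega> \<partial>?P)" for k
  proof -
    have int: "integrable ?P (\<lambda>\<omega>. weight \<beta> k i \<omega> * h \<omega> t)"
      if "\<And>\<omega>. good \<omega> \<Longrightarrow> \<bar>h \<omega> t\<bar> \<le> B" "(\<lambda>\<omega>. h \<omega> t) \<in> borel_measurable ?P" for i h B t
    proof (rule Bochner_Integration.integrable_bound)
      show "integrable ?P (\<lambda>\<omega>. B * weight \<beta> k i \<omega>)" using W_int by simp
      show "AE \<omega> in ?P. norm (weight \<beta> k i \<omega> * h \<omega> t) \<le> norm (B * weight \<beta> k i \<omega>)"
        using AE_good[of x]
      proof eventually_elim
        case (elim \<omega>)
        have "\<bar>h \<omega> t\<bar> \<le> \<bar>B\<bar>" using that(1)[OF elim] by simp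
        then show ?case by (simp add: abs_mult mult.commute[of "\<bar>weight \<beta> k i \<omega>\<bar>"] mult_right_mono)
      qed
    qed (use that(2) W_m in measurable)
    have "(\<integral>\<omega>. S hv k \<omega> \<partial>?P) = (\<Sum>i<k*k. \<integral>\<omega>. weight \<beta> k i \<omega> * hv \<omega> (ennreal (real (Suc i) / real k)) \<partial>?P)"
      unfolding S_def by (intro Bochner_Integration.integral_sum int[of hv _ "norm v"] hv_path(3) hv_m)
    also have "\<dots> = (\<Sum>i<k*k. \<integral>\<omega>. weight \<beta> k i \<omega> * hF \<omega> (ennreal (real (Suc i) / real k)) \<partial>?P)"
      unfolding hv_def hF_def
      by (intro sum.cong refl markov_future[symmetric] \<alpha> v weight_measurable W_int) simp
    also have "\<dots> = (\<integral>\<omega>. S hF k \<omega> \<partial>?P)"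
      unfolding S_def
      by (intro Bochner_Integration.integral_sum[symmetric] int[of hF _ "norm u / \<alpha>"] hF_path(3) hF_m)
    finally show ?thesis .
  qed
  \<comment> \<open>The identity of the single path is divided by \<open>\<alpha> - \<beta>\<close>;
    for equal parameters both sides are 0.\<close>
  show ?thesis
  proof (cases "\<alpha> = \<beta>")
    case False
    have "(\<lambda>k. \<integral>\<omega>. S hF k \<omega> \<partial>?P) \<longlonglongrightarrow> (\<integral>\<omega>. g \<omega> / (\<alpha> - \<beta>) \<partial>?P)"
    proof (rule lim[OF hF_path(1-3) hF_m])
      show "(\<lambda>\<omega>. g \<omega> / (\<alpha> - \<beta>)) \<in> borel_measurable ?P" unfolding g_def using f_m by measurable
      show "g \<omega> / (\<alpha> - \<beta>) = (LINT r:{0..}|lborel. exp (- \<beta> * r) * hF \<omega> (time_inverse (\<lambda>t. A t \<omega>) (ennreal r)))"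
        if "good \<omega>" for \<omega>
        using hF_path(4)[OF that] False by (simp add: g_def field_simps)
    qed
    from LIMSEQ_unique[OF l1 this[folded S_eq]]
    have "(\<alpha> - \<beta>) * mean (\<lambda>r. exp (- \<beta> * r)) v x = (\<integral>\<omega>. g \<omega> \<partial>?P)"
      using False by simp
    also have "\<dots> = mean (\<lambda>r. exp (- \<beta> * r)) u x - mean (\<lambda>r. exp (- \<alpha> * r)) u x"
      unfolding g_def mean_def using integrable_functional[OF w] integrable_functional[of "\<lambda>r. exp (- \<alpha> * r)" 1 x u] \<alpha>
      by (intro Bochner_Integration.integral_diff) auto
    finally show ?thesis .
  qed simp
qed

end

section \<open>Convergence of resolvents and integrated semigroups\<close>

lemma bcontfun_norm_le: "0 \<le> b \<Longrightarrow> (\<And>x. \<bar>apply_bcontfun f x\<bar> \<le> b) \<Longrightarrow> norm f \<le> b"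
  by (rule norm_bound) simp

lemma C0_add:
  assumes "u \<in> C0" "v \<in> C0"
  shows "u + v \<in> C0"
  unfolding C0_def mem_Collect_eq vanishes_at_infinity_def
proof (intro allI impI)
  fix e :: real assume "0 < e"
  then obtain K1 K2 where K: "compact K1" "\<And>x. x \<notin> K1 \<Longrightarrow> \<bar>apply_bcontfun u x\<bar> < e / 2"
      "compact K2" "\<And>x. x \<notin> K2 \<Longrightarrow> \<bar>apply_bcontfun v x\<bar> < e / 2"
    using assms[unfolded C0_def mem_Collect_eq vanishes_at_infinity_def] half_gt_zero by metis
  have "\<bar>apply_bcontfun (u + v) x\<bar> < e" if "x \<notin> K1 \<union> K2" for x
    using K(2)[of x] K(4)[of x] that by (simp add: plus_bcontfun.rep_eq)
  then show "\<exists>K. compact K \<and> (\<forall>x. x \<notin> K \<longrightarrow> \<bar>apply_bcontfun (u + v) x\<bar> < e)"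
    using K by (intro exI[of _ "K1 \<union> K2"]) auto
qed

lemma C0_scaleR:
  assumes "u \<in> C0"
  shows "c *\<^sub>R u \<in> C0"
  unfolding C0_def mem_Collect_eq vanishes_at_infinity_def
proof (intro allI impI)
  fix e :: real assume e: "0 < e"
  then have "0 < e / (\<bar>c\<bar> + 1)" by simp
  then obtain K where K: "compact K" "\<And>x. x \<notin> K \<Longrightarrow> \<bar>apply_bcontfun u x\<bar> < e / (\<bar>c\<bar> + 1)"
    using assms[unfolded C0_def mem_Collect_eq vanishes_at_infinity_def] by metis
  have "\<bar>apply_bcontfun (c *\<^sub>R u) x\<bar> < e" if "x \<notin> K" for x
  proof -
    have "\<bar>c\<bar> * \<bar>apply_bcontfun u x\<bar> \<le> \<bar>c\<bar> * (e / (\<bar>c\<bar> + 1))"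
      using K(2)[OF that] by (intro mult_left_mono) auto
    also have "\<dots> < e" using e by (simp add: field_simps)
    finally show ?thesis by (simp add: scaleR_bcontfun.rep_eq abs_mult)
  qed
  then show "\<exists>K. compact K \<and> (\<forall>x. x \<notin> K \<longrightarrow> \<bar>apply_bcontfun (c *\<^sub>R u) x\<bar> < e)"
    using K(1) by blast
qed

locale time_change_semigroup = time_change \<Omega> M P X \<theta> A \<mu> G
  for \<Omega> :: "'w set" and M
    and P :: "'a::{metric_space, second_countable_topology} option \<Rightarrow> 'w measure" and X and \<theta>
    and A and \<mu> :: "'a measure" and G +
  fixes S :: "real \<Rightarrow> ('a \<Rightarrow>\<^sub>C real) \<Rightarrow> ('a \<Rightarrow>\<^sub>C real)"
  assumes semigroup: "integrated_semigroup (time_changed_resolvent P X A) S"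
begin

lemma ex_resolvent:
  assumes "0 < \<alpha>" "u \<in> C0"
  shows "\<exists>v\<in>C0. ((\<lambda>t. exp (- \<alpha> * t) *\<^sub>R S t u) has_integral (1 / \<alpha>) *\<^sub>R v) {0..} \<and>
    (\<forall>x. apply_bcontfun v x = mean (\<lambda>r. exp (- \<alpha> * r)) u x)"
proof -
  obtain I where I: "I \<in> C0" "((\<lambda>t. exp (- \<alpha> * t) *\<^sub>R S t u) has_integral I) {0..}"
    "\<And>x. time_changed_resolvent P X A \<alpha> (apply_bcontfun u) x = \<alpha> * apply_bcontfun I x"
    using semigroup assms unfolding integrated_semigroup_def by blast
  show ?thesis
  proof (intro bexI[of _ "\<alpha> *\<^sub>R I"] conjI allI)
    show "((\<lambda>t. exp (- \<alpha> * t) *\<^sub>R S t u) has_integral (1 / \<alpha>) *\<^sub>R \<alpha> *\<^sub>R I) {0..}"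
      using I(2) assms(1) by simp
    show "apply_bcontfun (\<alpha> *\<^sub>R I) x = mean (\<lambda>r. exp (- \<alpha> * r)) u x" for x
      using I(3)[of x] by (simp add: time_changed_resolvent_eq scaleR_bcontfun.rep_eq)
    show "\<alpha> *\<^sub>R I \<in> C0" by (rule C0_scaleR[OF I(1)])
  qed
qed

text \<open>The resolvent as an element of the Banach space. That it is continuous and vanishes at
  infinity is extracted from the Laplace integral of the integrated semigroup.\<close>

definition res :: "real \<Rightarrow> ('a \<Rightarrow>\<^sub>C real) \<Rightarrow> ('a \<Rightarrow>\<^sub>C real)" where
  "res \<alpha> u = (SOME v. v \<in> C0 \<and> ((\<lambda>t. exp (- \<alpha> * t) *\<^sub>R S t u) has_integral (1 / \<alpha>) *\<^sub>R v) {0..} \<and>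
    (\<forall>x. apply_bcontfun v x = mean (\<lambda>r. exp (- \<alpha> * r)) u x))"

lemma
  assumes "0 < \<alpha>" "u \<in> C0"
  shows res_C0: "res \<alpha> u \<in> C0"
    and res_integral: "((\<lambda>t. exp (- \<alpha> * t) *\<^sub>R S t u) has_integral (1 / \<alpha>) *\<^sub>R res \<alpha> u) {0..}"
    and res_apply: "apply_bcontfun (res \<alpha> u) x = mean (\<lambda>r. exp (- \<alpha> * r)) u x"
proof -
  have "\<exists>v. v \<in> C0 \<and> ((\<lambda>t. exp (- \<alpha> * t) *\<^sub>R S t u) has_integral (1 / \<alpha>) *\<^sub>R v) {0..} \<and>
    (\<forall>x. apply_bcontfun v x = mean (\<lambda>r. exp (- \<alpha> * r)) u x)"
    using ex_resolvent[OF assms] by blast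
  from someI_ex[OF this] show "res \<alpha> u \<in> C0"
    "((\<lambda>t. exp (- \<alpha> * t) *\<^sub>R S t u) has_integral (1 / \<alpha>) *\<^sub>R res \<alpha> u) {0..}"
    "apply_bcontfun (res \<alpha> u) x = mean (\<lambda>r. exp (- \<alpha> * r)) u x"
    by (auto simp: res_def)
qed

lemma res_norm: "0 < \<alpha> \<Longrightarrow> u \<in> C0 \<Longrightarrow> norm (res \<alpha> u) \<le> norm u / \<alpha>"
  using mean_exp_bound[of \<alpha> u] by (intro bcontfun_norm_le) (simp_all add: res_apply)

lemma res_linear:
  assumes "0 < \<alpha>" "u \<in> C0" "v \<in> C0"
  shows "res \<alpha> (a *\<^sub>R u + b *\<^sub>R v) = a *\<^sub>R res \<alpha> u + b *\<^sub>R res \<alpha> v"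
proof (rule bcontfun_eqI)
  fix x
  have "a *\<^sub>R u + b *\<^sub>R v \<in> C0" using assms by (intro C0_add C0_scaleR)
  then show "apply_bcontfun (res \<alpha> (a *\<^sub>R u + b *\<^sub>R v)) x = apply_bcontfun (a *\<^sub>R res \<alpha> u + b *\<^sub>R res \<alpha> v) x"
    using assms by (simp add: res_apply plus_bcontfun.rep_eq scaleR_bcontfun.rep_eq mean_linear[where C = 1])
qed

lemma res_resolvent:
  assumes "0 < \<alpha>" "0 < \<beta>" "u \<in> C0"
  shows "res \<beta> u = res \<alpha> u + (\<alpha> - \<beta>) *\<^sub>R res \<beta> (res \<alpha> u)"
proof (rule bcontfun_eqI)
  fix x
  show "apply_bcontfun (res \<beta> u) x = apply_bcontfun (res \<alpha> u + (\<alpha> - \<beta>) *\<^sub>R res \<beta> (res \<alpha> u)) x"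
    using resolvent_equation[of \<alpha> \<beta> "res \<alpha> u" u x] assms
    by (simp add: res_apply res_C0 plus_bcontfun.rep_eq scaleR_bcontfun.rep_eq)
qed

text \<open>The resolvent equation at \<beta> = 0. The potential operator is kept as a pointwise
  mean and not as an operator on \<open>C0\<close>.\<close>

lemma potential_res:
  assumes "0 < \<alpha>" "u \<in> C0"
  shows "\<alpha> * mean (\<lambda>_. 1) (res \<alpha> u) x = mean (\<lambda>_. 1) u x - apply_bcontfun (res \<alpha> u) x"
  using resolvent_equation[of \<alpha> 0 "res \<alpha> u" u x] assms by (simp add: res_apply)

text \<open>Evaluation at \<open>x\<close> is bounded and linear, so the strong Laplace integral may
  be evaluated at a point, where it agrees with the transform of the mean. The strong integral
  delivers a gauge integral, hence uniqueness is used in the form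
  \<open>laplace_eq_0\<close>.\<close>

lemma semigroup_apply:
  assumes u: "u \<in> C0" and t: "0 \<le> t"
  shows "apply_bcontfun (S t u) x = mean (indicator {0..t}) u x"
proof -
  have bl: "bounded_linear (\<lambda>f. apply_bcontfun f x)"
    by (rule bounded_linear_intro[where K = 1])
       (auto simp: plus_bcontfun.rep_eq scaleR_bcontfun.rep_eq norm_bounded)
  have "apply_bcontfun (S t u) x - mean (indicator {0..t}) u x = 0"
  proof (rule laplace_eq_0[where f = "\<lambda>t. apply_bcontfun (S t u) x - mean (indicator {0..t}) u x", OF _ _ t])
    have "continuous_on {0..} (\<lambda>t. S t u)"
      using semigroup u by (simp add: integrated_semigroup_def)
    then have "continuous_on {0..} (\<lambda>t. apply_bcontfun (S t u) x)"
      by (rule bounded_linear.continuous_on[OF bl])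
    then show "continuous_on {0..} (\<lambda>t. apply_bcontfun (S t u) x - mean (indicator {0..t}) u x)"
      by (intro continuous_on_diff mean_Icc_continuous)
    fix \<alpha> :: real assume \<alpha>: "0 < \<alpha>"
    have "((\<lambda>t. apply_bcontfun (exp (- \<alpha> * t) *\<^sub>R S t u) x) has_integral apply_bcontfun ((1 / \<alpha>) *\<^sub>R res \<alpha> u) x) {0..}"
      using has_integral_linear[OF res_integral[OF \<alpha> u] bl] by (simp add: comp_def)
    then have h1: "((\<lambda>t. exp (- \<alpha> * t) * apply_bcontfun (S t u) x) has_integral mean (\<lambda>r. exp (- \<alpha> * r)) u x / \<alpha>) {0..}"
      by (simp add: scaleR_bcontfun.rep_eq res_apply[OF \<alpha> u])
    have "set_integrable lborel {0..} (\<lambda>t. exp (- \<alpha> * t) * mean (indicator {0..t}) u x)"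
    proof (rule set_integrable_laplace[OF \<alpha> mean_Icc_continuous])
      show "\<bar>mean (indicator {0..t}) u x\<bar> \<le> norm u * (1 + t)" if "0 \<le> t" for t
        using mean_Icc_bound[OF that, of u x] norm_ge_zero[of u] unfolding distrib_left by linarith
    qed
    from set_borel_integral_eq_integral[OF this]
    have h2: "((\<lambda>t. exp (- \<alpha> * t) * mean (indicator {0..t}) u x) has_integral mean (\<lambda>r. exp (- \<alpha> * r)) u x / \<alpha>) {0..}"
      unfolding mean_Icc_laplace[OF \<alpha>] by (simp add: has_integral_iff)
    show "((\<lambda>t. exp (- \<alpha> * t) * (apply_bcontfun (S t u) x - mean (indicator {0..t}) u x)) has_integral 0) {0..}"
      using has_integral_diff[OF h1 h2] by (simp add: right_diff_distrib)
  qed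
  then show ?thesis by simp
qed

end

section \<open>Convergence along a sequence of additive functionals\<close>

locale time_change_sequence =
  fixes \<Omega> :: "'w set" and M
    and P :: "'a::{metric_space, second_countable_topology} option \<Rightarrow> 'w measure" and X and \<theta>
    and A :: "enat \<Rightarrow> ennreal \<Rightarrow> 'w \<Rightarrow> ennreal" and \<mu> :: "enat \<Rightarrow> 'a measure" and G
    and S :: "enat \<Rightarrow> real \<Rightarrow> ('a \<Rightarrow>\<^sub>C real) \<Rightarrow> ('a \<Rightarrow>\<^sub>C real)" and g :: "'a \<Rightarrow>\<^sub>C real"
  assumes time_change: "time_change_semigroup \<Omega> M P X \<theta> (A n) (\<mu> n) G (S n)"
    and radon: "radon (\<mu> n)"
    and vague: "vague_convergence (\<lambda>n. \<mu> (enat n)) (\<mu> \<infinity>)"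
    and lsc: "lower_semicontinuous (\<lambda>(x, y). G x y)"
    and lc: "locally compact (UNIV :: 'a set)"
    and limit_potential: "real_potential G (\<mu> \<infinity>) (\<lambda>_. 1) = apply_bcontfun g" "g \<in> C0"
    and potential_limit: "uniform_limit UNIV (\<lambda>n. real_potential G (\<mu> (enat n)) (\<lambda>_. 1))
      (real_potential G (\<mu> \<infinity>) (\<lambda>_. 1)) sequentially"
begin

sublocale T: time_change_semigroup \<Omega> M P X \<theta> "A n" "\<mu> n" G "S n" for n
  by (rule time_change)

lemma real_potential_limit:
  assumes "continuous_on UNIV f" "\<And>y. 0 \<le> f y" "\<And>y. f y \<le> 1"
  shows "uniform_limit UNIV (\<lambda>n. real_potential G (\<mu> (enat n)) f) (real_potential G (\<mu> \<infinity>) f) sequentially"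
proof (rule potential_uniform_limit[OF lsc lc radon radon vague T.finite_potential T.finite_potential _ _ potential_limit assms])
  show "continuous_on UNIV (real_potential G (\<mu> \<infinity>) (\<lambda>_. 1))"
    "vanishes_at_infinity (real_potential G (\<mu> \<infinity>) (\<lambda>_. 1))"
    using limit_potential by (simp_all add: C0_def)
qed

text \<open>Uniform convergence is known for functions between 0 and 1. An affine change with
  constant \<open>norm u + 1\<close>, positive even for u = 0, brings \<open>u\<close> into this
  range at the price of a multiple of the potential of 1.\<close>

lemma mean_limit: "uniform_limit UNIV (\<lambda>n. T.mean (enat n) (\<lambda>_. 1) u) (T.mean \<infinity> (\<lambda>_. 1) u) sequentially"
proof -
  define c where "c = norm u + 1"
  have c: "0 < c" by (simp add: c_def add_nonneg_pos)
  define one :: "'a \<Rightarrow>\<^sub>C real" where "one = const_bcontfun 1"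
  define f where "f = (1 / (2 * c)) *\<^sub>R u + (1 / 2) *\<^sub>R one"
  have one: "apply_bcontfun one y = 1" for y by (simp add: one_def const_bcontfun.rep_eq)
  have f_eq: "apply_bcontfun f y = (apply_bcontfun u y + c) / (2 * c)" for y
    using c by (simp add: f_def one plus_bcontfun.rep_eq scaleR_bcontfun.rep_eq field_simps)
  have f: "0 \<le> apply_bcontfun f y" "apply_bcontfun f y \<le> 1" for y
    using bcontfun_abs_le[of u y] c unfolding f_eq c_def by (auto simp: field_simps abs_le_iff)
  have u: "u = (2 * c) *\<^sub>R f + (- c) *\<^sub>R one"
    using c by (intro bcontfun_eqI) (simp add: f_eq one plus_bcontfun.rep_eq scaleR_bcontfun.rep_eq)
  have mean_u: "T.mean n (\<lambda>_. 1) u x = (2 * c) * real_potential G (\<mu> n) f x + (- c) * real_potential G (\<mu> n) (\<lambda>_. 1) x" for n x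
  proof -
    have "T.mean n (\<lambda>_. 1) u x = (2 * c) * T.mean n (\<lambda>_. 1) f x + (- c) * T.mean n (\<lambda>_. 1) one x"
      by (subst u) (rule T.mean_linear[where C = 1], auto)
    moreover have "apply_bcontfun one = (\<lambda>_. 1)" using one by auto
    ultimately show ?thesis using f(1) one by (simp add: T.mean_one)
  qed
  show ?thesis
    unfolding mean_u[abs_def]
    by (intro uniform_limit_add bounded_linear.uniform_limit[OF bounded_linear_mult_right]
        real_potential_limit potential_limit) (use f in auto)
qed

text \<open>Write U_n and U for the potential operators, r for the limit resolvent of
  \<open>u\<close> and d for the difference of the resolvents. The equation at \<beta> = 0 gives d =
  (U_n - U) u - a (U_n - U) r - a U_n d. The first two terms tend to 0 because \<open>u\<close> and
  r are fixed, and the last one is absorbed on the left.\<close>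

lemma res_limit_small:
  obtains a where "0 < a" "\<And>u. u \<in> C0 \<Longrightarrow> (\<lambda>n. T.res (enat n) a u) \<longlonglongrightarrow> T.res \<infinity> a u"
proof -
  \<comment> \<open>For large \<open>n\<close> the potential of 1 is within 1 of \<open>g\<close>,
    hence at most \<open>z\<close>; with a = 1/(2z) the operator a U_n has norm at most 1/2.\<close>
  define z where "z = norm g + 1"
  have z: "0 < z" by (simp add: z_def add_nonneg_pos)
  define a where "a = 1 / (2 * z)"
  have a: "0 < a" using z by (simp add: a_def)
  have "(\<lambda>n. T.res (enat n) a u) \<longlonglongrightarrow> T.res \<infinity> a u" if u: "u \<in> C0" for u
  proof (rule tendstoI)
    fix e :: real assume e: "0 < e"
    define e' where "e' = e / (4 * (1 + a))"
    have e': "0 < e'" using e a by (simp add: e'_def)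
    let ?r = "T.res \<infinity> a u"
    let ?\<Delta> = "\<lambda>n v x. T.mean (enat n) (\<lambda>_. 1) v x - T.mean \<infinity> (\<lambda>_. 1) v x"
    have lim: "\<forall>\<^sub>F n in sequentially. \<forall>x. \<bar>?\<Delta> n v x\<bar> < e'" for v
      using uniform_limitD[OF mean_limit e', of v] by (simp add: dist_real_def)
    have "\<forall>\<^sub>F n in sequentially. \<forall>x. \<bar>real_potential G (\<mu> (enat n)) (\<lambda>_. 1) x - apply_bcontfun g x\<bar> < 1"
      using uniform_limitD[OF potential_limit, of 1] by (simp add: dist_real_def limit_potential(1))
    with lim[of u] lim[of ?r] show "\<forall>\<^sub>F n in sequentially. dist (T.res (enat n) a u) ?r < e"
    proof eventually_elim
      case (elim n)
      define d where "d = T.res (enat n) a u - ?r"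
      have d_mean: "T.mean (enat n) (\<lambda>_. 1) d x = T.mean (enat n) (\<lambda>_. 1) (T.res (enat n) a u) x - T.mean (enat n) (\<lambda>_. 1) ?r x" for x
        using T.mean_linear[of "\<lambda>_. 1" 1 "enat n" 1 "T.res (enat n) a u" "-1" ?r x] by (simp add: d_def)
      have d_eq: "apply_bcontfun d x = ?\<Delta> n u x - a * ?\<Delta> n ?r x - a * T.mean (enat n) (\<lambda>_. 1) d x" for x
        using T.potential_res[OF a u, of "enat n" x] T.potential_res[OF a u, of \<infinity> x]
        unfolding d_mean by (simp add: d_def minus_bcontfun.rep_eq algebra_simps)
      have "norm d \<le> (1 + a) * e' + norm d / 2"
      proof (rule bcontfun_norm_le)
        show "0 \<le> (1 + a) * e' + norm d / 2" using a e' by simp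
        fix x
        have pot: "real_potential G (\<mu> (enat n)) (\<lambda>_. 1) x \<le> z"
          using elim(3)[rule_format, of x] bcontfun_abs_le[of g x] unfolding z_def by linarith
        have "\<bar>T.mean (enat n) (\<lambda>_. 1) d x\<bar> \<le> 1 * norm d * real_potential G (\<mu> (enat n)) (\<lambda>_. 1) x"
          by (rule T.mean_bound) auto
        also have "\<dots> \<le> norm d * z" using pot by (simp add: mult_left_mono)
        finally have "a * \<bar>T.mean (enat n) (\<lambda>_. 1) d x\<bar> \<le> a * (norm d * z)"
          using a by (intro mult_left_mono) auto
        also have "\<dots> = norm d / 2" using z by (simp add: a_def)
        finally have 1: "\<bar>a * T.mean (enat n) (\<lambda>_. 1) d x\<bar> \<le> norm d / 2" using a by (simp add: abs_mult)
        have 2: "\<bar>a * ?\<Delta> n ?r x\<bar> \<le> a * e'"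
          using elim(2)[rule_format, of x] a by (simp add: abs_mult)
        have 3: "\<bar>?\<Delta> n u x\<bar> \<le> e'" using elim(1)[rule_format, of x] by simp
        show "\<bar>apply_bcontfun d x\<bar> \<le> (1 + a) * e' + norm d / 2"
          unfolding d_eq distrib_right mult_1_left using 1 2 3 by linarith
      qed
      then have "norm d \<le> 2 * ((1 + a) * e')" by simp
      also have "\<dots> = e / 2"
      proof -
        have "y * (e / (4 * y)) = e / 4" if "0 < y" for y using that by simp
        from this[of "1 + a"] a show ?thesis unfolding e'_def by linarith
      qed
      also have "\<dots> < e" using e by simp
      finally show ?case by (simp add: d_def dist_norm)
    qed
  qed
  then show thesis using that a by blast
qed

text \<open>Let r be the limit resolvent of \<open>u\<close> at \<open>b\<close>. The function w = u
  + (a - b) r has limit resolvent r at \<open>a\<close>, so the error at \<open>b\<close> is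
  expressed exactly by the error \<open>v n\<close> at \<open>a\<close> on the fixed function w.
  This reaches every b > 0 without a chain of small steps.\<close>

lemma res_limit:
  assumes b: "0 < b" and u: "u \<in> C0"
  shows "(\<lambda>n. T.res (enat n) b u) \<longlonglongrightarrow> T.res \<infinity> b u"
proof -
  obtain a where a: "0 < a" "\<And>u. u \<in> C0 \<Longrightarrow> (\<lambda>n. T.res (enat n) a u) \<longlonglongrightarrow> T.res \<infinity> a u"
    by (rule res_limit_small) blast
  let ?r = "T.res \<infinity> b u"
  have r: "?r \<in> C0" by (rule T.res_C0[OF b u])
  define w where "w = 1 *\<^sub>R u + (a - b) *\<^sub>R ?r"
  have w: "w \<in> C0" unfolding w_def by (intro C0_add C0_scaleR u r)
  define v where "v n = T.res (enat n) a w - T.res \<infinity> a w" for n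
  have v_C0: "v n \<in> C0" for n
  proof -
    have "T.res (enat n) a w + (-1) *\<^sub>R T.res \<infinity> a w \<in> C0"
      by (intro C0_add C0_scaleR T.res_C0 a w)
    then show ?thesis by (simp add: v_def)
  qed
  have "v \<longlonglongrightarrow> 0"
    unfolding v_def[abs_def] using a(2)[OF w] by (simp add: LIM_zero_iff)
  then have v0: "(\<lambda>n. (1 + \<bar>a - b\<bar> / b) * norm (v n)) \<longlonglongrightarrow> 0"
    using tendsto_mult_right_zero tendsto_norm_zero by blast
  have rw: "T.res \<infinity> a w = ?r"
    unfolding w_def T.res_linear[OF a(1) u r] using T.res_resolvent[OF b a(1) u, of \<infinity>]
    by (simp add: algebra_simps)
  have diff: "T.res (enat n) b u - ?r = v n + (a - b) *\<^sub>R T.res (enat n) b (v n)" for n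
  proof -
    let ?R = "T.res (enat n)"
    have "?R b (v n) = ?R b (?R a w) - ?R b ?r"
      using T.res_linear[OF b T.res_C0[OF a(1) w] r, of "enat n" 1 "enat n" "-1"] by (simp add: v_def rw)
    moreover have "(a - b) *\<^sub>R ?R b (?R a w) = ?R b w - ?R a w"
      using T.res_resolvent[OF a(1) b w, of "enat n"] by simp
    moreover have "?R b w = ?R b u + (a - b) *\<^sub>R ?R b ?r"
      unfolding w_def T.res_linear[OF b u r] by simp
    ultimately show ?thesis by (simp add: v_def rw scaleR_diff_right)
  qed
  have "(\<lambda>n. T.res (enat n) b u - ?r) \<longlonglongrightarrow> 0"
  proof (rule Lim_null_comparison[OF _ v0])
    show "\<forall>\<^sub>F n in sequentially. norm (T.res (enat n) b u - ?r) \<le> (1 + \<bar>a - b\<bar> / b) * norm (v n)"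
    proof (intro always_eventually allI)
      fix n
      have "norm (T.res (enat n) b u - ?r) \<le> norm (v n) + \<bar>a - b\<bar> * norm (T.res (enat n) b (v n))"
        unfolding diff by (rule order_trans[OF norm_triangle_ineq]) simp
      also have "\<dots> \<le> norm (v n) + \<bar>a - b\<bar> * (norm (v n) / b)"
        by (intro add_left_mono mult_left_mono T.res_norm b v_C0) simp
      finally show "norm (T.res (enat n) b u - ?r) \<le> (1 + \<bar>a - b\<bar> / b) * norm (v n)"
        by (simp add: algebra_simps)
    qed
  qed
  then show ?thesis by (simp add: LIM_zero_iff)
qed

context
  fixes u :: "'a \<Rightarrow>\<^sub>C real"
  assumes u: "u \<in> C0"
begin

definition err :: "nat \<Rightarrow> 'a \<Rightarrow> real \<Rightarrow> real" where
  "err n x t = T.mean (enat n) (indicator {0..t}) u x - T.mean \<infinity> (indicator {0..t}) u x"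

text \<open>Each of the two means contributes \<open>norm u\<close>; the summand 1 keeps the
  constant positive, as it occurs in denominators.\<close>

definition lip :: real where "lip = 2 * norm u + 1"

lemma lip_pos: "0 < lip" by (simp add: lip_def add_nonneg_pos)

lemma err_lipschitz: "0 \<le> s \<Longrightarrow> 0 \<le> t \<Longrightarrow> \<bar>err n x s - err n x t\<bar> \<le> lip * \<bar>s - t\<bar>"
proof (induction s t rule: linorder_wlog)
  case (le s t)
  have "\<bar>err n x s - err n x t\<bar> \<le> norm u * (t - s) + norm u * (t - s)"
    using T.mean_Icc_lipschitz[of s t "enat n" u x] T.mean_Icc_lipschitz[of s t \<infinity> u x] le
    unfolding err_def by linarith
  also have "\<dots> \<le> lip * \<bar>s - t\<bar>" using le by (simp add: lip_def algebra_simps)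
  finally show ?case .
qed (simp add: abs_minus_commute)

lemma err_bound: "0 \<le> t \<Longrightarrow> \<bar>err n x t\<bar> \<le> lip * (1 + t)"
proof -
  assume t: "0 \<le> t"
  have "err n x 0 = 0" by (simp only: err_def T.mean_Icc_0 diff_self)
  then have "\<bar>err n x t\<bar> \<le> lip * t" using err_lipschitz[OF t, of 0 n x] t by simp
  also have "\<dots> \<le> lip * (1 + t)" using lip_pos by simp
  finally show ?thesis .
qed

lemma err_continuous: "continuous_on {0..} (err n x)"
  unfolding err_def[abs_def] by (intro continuous_on_diff T.mean_Icc_continuous)

lemma err_laplace:
  assumes \<alpha>: "0 < \<alpha>"
  shows "\<bar>LINT t:{0..}|lborel. exp (- \<alpha> * t) * err n x t\<bar> \<le> norm (T.res (enat n) \<alpha> u - T.res \<infinity> \<alpha> u) / \<alpha>"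
proof -
  have int: "set_integrable lborel {0..} (\<lambda>t. exp (- \<alpha> * t) * T.mean k (indicator {0..t}) u x)" for k
  proof (rule set_integrable_laplace[OF \<alpha> T.mean_Icc_continuous])
    show "\<bar>T.mean k (indicator {0..t}) u x\<bar> \<le> norm u * (1 + t)" if "0 \<le> t" for t
      using T.mean_Icc_bound[OF that, of k u x] norm_ge_zero[of u] unfolding distrib_left by linarith
  qed
  have "(LINT t:{0..}|lborel. exp (- \<alpha> * t) * err n x t)
      = (T.mean (enat n) (\<lambda>r. exp (- \<alpha> * r)) u x - T.mean \<infinity> (\<lambda>r. exp (- \<alpha> * r)) u x) / \<alpha>"
    unfolding err_def right_diff_distrib using int
    by (subst set_integral_diff) (simp_all only: T.mean_Icc_laplace[OF \<alpha>] diff_divide_distrib)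
  also have "\<dots> = apply_bcontfun (T.res (enat n) \<alpha> u - T.res \<infinity> \<alpha> u) x / \<alpha>"
    by (simp add: T.res_apply[OF \<alpha> u] minus_bcontfun.rep_eq)
  finally show ?thesis
    using bcontfun_abs_le[of "T.res (enat n) \<alpha> u - T.res \<infinity> \<alpha> u" x] \<alpha> by (simp add: divide_right_mono)
qed

lemma err_limit:
  assumes t: "0 < t0" and e: "0 < e"
  shows "\<forall>\<^sub>F n in sequentially. \<forall>x. \<bar>err n x t0\<bar> \<le> e"
proof -
  \<comment> \<open>Three errors of size e/3: the oscillation on the window is at most
    \<open>lip * \<delta>\<close>, the approximation error is \<open>e / (3 * lip)\<close> times the
    growth constant \<open>lip\<close>, and the finite sum of transforms tends to 0. The minimum
    with \<open>t0 / 2\<close> keeps the window inside positive times.\<close>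
  define \<delta> where "\<delta> = min (e / (3 * lip)) (t0 / 2)"
  have \<delta>: "0 < \<delta>" "\<delta> < t0" using t e lip_pos by (auto simp: \<delta>_def)
  have \<epsilon>: "0 < e / (3 * lip)" using e lip_pos by simp
  show ?thesis
  proof (rule laplace_point_estimate[OF \<delta> \<epsilon>])
    fix c :: "nat \<Rightarrow> real" and N :: nat
    assume est: "\<And>f B \<eta>. continuous_on {0..} f \<Longrightarrow> (\<And>t. 0 \<le> t \<Longrightarrow> \<bar>f t\<bar> \<le> B * (1 + t)) \<Longrightarrow>
       (\<And>t. \<bar>t - t0\<bar> \<le> \<delta> \<Longrightarrow> \<bar>f t - f t0\<bar> \<le> \<eta>) \<Longrightarrow>
       \<bar>f t0\<bar> \<le> \<eta> + (\<Sum>j\<le>N. \<bar>c j\<bar> * \<bar>LINT t:{0..}|lborel. exp (- (1 + real j) * t) * f t\<bar>) + e / (3 * lip) * B"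
    let ?s = "\<lambda>n. \<Sum>j\<le>N. \<bar>c j\<bar> * (norm (T.res (enat n) (1 + real j) u - T.res \<infinity> (1 + real j) u) / (1 + real j))"
    have "(\<lambda>n. norm (T.res (enat n) (1 + real j) u - T.res \<infinity> (1 + real j) u)) \<longlonglongrightarrow> 0" for j
      using res_limit[of "1 + real j", OF _ u] by (intro tendsto_norm_zero) (simp add: LIM_zero_iff)
    then have "?s \<longlonglongrightarrow> (\<Sum>j\<le>N. \<bar>c j\<bar> * (0 / (1 + real j)))"
      by (intro tendsto_intros) auto
    then have "?s \<longlonglongrightarrow> 0" by simp
    then have "\<forall>\<^sub>F n in sequentially. ?s n < e / 3" using e by (intro order_tendstoD) auto
    then show ?thesis
    proof eventually_elim
      case (elim n)
      show ?case
      proof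
        fix x
        have "\<bar>err n x t0\<bar> \<le> e / 3 + (\<Sum>j\<le>N. \<bar>c j\<bar> * \<bar>LINT t:{0..}|lborel. exp (- (1 + real j) * t) * err n x t\<bar>)
            + e / (3 * lip) * lip"
        proof (rule est[OF err_continuous err_bound])
          fix t assume t': "\<bar>t - t0\<bar> \<le> \<delta>"
          then have "\<bar>err n x t - err n x t0\<bar> \<le> lip * \<bar>t - t0\<bar>"
            using \<delta> t by (intro err_lipschitz) auto
          also have "\<dots> \<le> lip * (e / (3 * lip))"
            using t' lip_pos by (intro mult_left_mono) (auto simp: \<delta>_def)
          finally show "\<bar>err n x t - err n x t0\<bar> \<le> e / 3" using lip_pos by simp
        qed
        also have "(\<Sum>j\<le>N. \<bar>c j\<bar> * \<bar>LINT t:{0..}|lborel. exp (- (1 + real j) * t) * err n x t\<bar>) \<le> ?s n"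
          by (intro sum_mono mult_left_mono err_laplace) auto
        also have "e / 3 + ?s n + e / (3 * lip) * lip \<le> e" using elim lip_pos by simp
        finally show "\<bar>err n x t0\<bar> \<le> e" by simp
      qed
    qed
  qed
qed

theorem semigroup_limit:
  assumes T: "0 \<le> T"
  shows "uniform_limit {0..T} (\<lambda>n t. norm (S (enat n) t u - S \<infinity> t u)) (\<lambda>_. 0) sequentially"
proof (rule uniform_limitI)
  fix e :: real assume e: "0 < e"
  \<comment> \<open>Over one mesh width the error changes by at most \<open>lip * h\<close>, which
    is e/4.\<close>
  define h where "h = e / (4 * lip)"
  have h: "0 < h" using e lip_pos by (simp add: h_def)
  \<comment> \<open>The grid starts at \<open>h\<close> because the limit at a fixed time is
    available for positive times only; each \<open>t\<close> is compared with the next grid point to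
    its right.\<close>
  define J where "J = nat \<lfloor>T / h\<rfloor>"
  have "\<forall>\<^sub>F n in sequentially. \<forall>j\<in>{..J}. \<forall>x. \<bar>err n x (real (Suc j) * h)\<bar> \<le> e / 4"
    using h e by (intro eventually_ball_finite ballI err_limit) auto
  then show "\<forall>\<^sub>F n in sequentially. \<forall>t\<in>{0..T}. dist (norm (S (enat n) t u - S \<infinity> t u)) 0 < e"
  proof (eventually_elim, intro ballI)
    fix n t
    assume n: "\<forall>j\<in>{..J}. \<forall>x. \<bar>err n x (real (Suc j) * h)\<bar> \<le> e / 4" and t: "t \<in> {0..T}"
    define j where "j = nat \<lfloor>t / h\<rfloor>"
    have "t / h \<le> T / h" using t h by (intro divide_right_mono) auto
    then have jJ: "j \<in> {..J}" unfolding j_def J_def by (simp add: nat_mono floor_mono)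
    have j: "real j \<le> t / h" "t / h \<le> real (Suc j)"
      using t h unfolding j_def by (simp_all, linarith)
    have near: "\<bar>t - real (Suc j) * h\<bar> \<le> h"
      using j h by (simp add: field_simps abs_le_iff)
    have "norm (S (enat n) t u - S \<infinity> t u) \<le> e / 2"
    proof (rule bcontfun_norm_le)
      fix x
      have "apply_bcontfun (S (enat n) t u - S \<infinity> t u) x = err n x t"
        using t u by (simp add: minus_bcontfun.rep_eq T.semigroup_apply err_def)
      moreover have "\<bar>err n x t - err n x (real (Suc j) * h)\<bar> \<le> lip * h"
        using err_lipschitz[of t "real (Suc j) * h" n x] t h near lip_pos
        by (meson atLeastAtMost_iff less_imp_le mult_left_mono mult_nonneg_nonneg of_nat_0_le_iff order_trans)
      moreover have "lip * h = e / 4" using lip_pos by (simp add: h_def)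
      moreover have "\<bar>err n x (real (Suc j) * h)\<bar> \<le> e / 4" using n jJ by blast
      ultimately show "\<bar>apply_bcontfun (S (enat n) t u - S \<infinity> t u) x\<bar> \<le> e / 2" by linarith
    qed (use e in simp)
    then show "dist (norm (S (enat n) t u - S \<infinity> t u)) 0 < e" using e by simp
  qed
qed

end

end

theorem corollary3p1:
  fixes \<Omega> :: "'w set" and M :: "ennreal \<Rightarrow> 'w measure"
    and P :: "'a::{metric_space, second_countable_topology} option \<Rightarrow> 'w measure"
    and X :: "ennreal \<Rightarrow> 'w \<Rightarrow> 'a option" and \<theta> :: "ennreal \<Rightarrow> 'w \<Rightarrow> 'w"
    and \<Omega>' :: "'v set" and M' :: "ennreal \<Rightarrow> 'v measure"
    and P' :: "'a option \<Rightarrow> 'v measure"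
    and X' :: "ennreal \<Rightarrow> 'v \<Rightarrow> 'a option" and \<theta>' :: "ennreal \<Rightarrow> 'v \<Rightarrow> 'v"
    and m :: "'a measure" and p :: "real \<Rightarrow> 'a \<Rightarrow> 'a \<Rightarrow> ennreal"
    and \<mu> :: "enat \<Rightarrow> 'a measure"
    and A :: "enat \<Rightarrow> ennreal \<Rightarrow> 'w \<Rightarrow> ennreal"
    and S :: "enat \<Rightarrow> real \<Rightarrow> ('a \<Rightarrow>\<^sub>C real) \<Rightarrow> ('a \<Rightarrow>\<^sub>C real)"
    and u :: "'a \<Rightarrow>\<^sub>C real"
  assumes "transient_dual_process \<Omega> M P X \<theta> \<Omega>' M' P' X' \<theta>' m p"
    and "\<And>n. kato p (\<mu> n)"
    and "vague_convergence (\<lambda>n. \<mu> (enat n)) (\<mu> \<infinity>)"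
    and "uniform_limit UNIV (\<lambda>n x. enn2real (green_potential p 0 (\<mu> (enat n)) (\<lambda>_. 1) x))
           (\<lambda>x. enn2real (green_potential p 0 (\<mu> \<infinity>) (\<lambda>_. 1) x)) sequentially"
    and "\<And>n. PCAF \<Omega> P X \<theta> (A n)"
    and "\<And>n. revuz_measure P X m (A n) (\<mu> n)"
    and "\<And>n. integrated_semigroup (time_changed_resolvent P X (A n)) (S n)"
    and "u \<in> C0"
  shows "\<forall>T\<ge>0. uniform_limit {0..T} (\<lambda>n t. norm (S (enat n) t u - S \<infinity> t u)) (\<lambda>_. 0) sequentially"
proof -
  interpret tdp: transient_dual_process \<Omega> M P X \<theta> \<Omega>' M' P' X' \<theta>' m p by (rule assms(1))
  let ?G = "green p 0"
  have pot: "green_potential p 0 (\<mu> n) (\<lambda>_. 1) x = (\<integral>\<^sup>+y. ?G x y \<partial>\<mu> n)" for n x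
    by (simp add: green_potential_def)
  have real_pot: "enn2real (green_potential p 0 (\<mu> n) (\<lambda>_. 1) x) = real_potential ?G (\<mu> n) (\<lambda>_. 1) x" for n x
    by (simp add: pot real_potential_def)
  have radon: "radon (\<mu> n)" for n using assms(2)[of n] by (simp add: kato_def)
  obtain g where g: "\<And>n. g n \<in> C0" "\<And>n x. 0 \<le> apply_bcontfun (g n) x"
    "\<And>n x. green_potential p 0 (\<mu> n) (\<lambda>_. 1) x = ennreal (apply_bcontfun (g n) x)"
    using assms(2) unfolding kato_def by metis
  have "time_change_sequence \<Omega> M P X \<theta> A \<mu> ?G S (g \<infinity>)"
  proof
    fix n
    show "PCAF \<Omega> P X \<theta> (A n)" by (rule assms(5))
    \<comment> \<open>\<open>order_refl\<close> sets the discount rate to 0, where the exponential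
      factor is 1.\<close>
    show "AF_integral P X (A n) (\<lambda>_. 1) f x = (\<integral>\<^sup>+y. ?G x y * f y \<partial>\<mu> n)" if "f \<in> borel_measurable borel" for f x
      using tdp.revuz_formula[OF assms(2,5,6) order_refl that, of n x] by (simp add: green_potential_def)
    show "(\<integral>\<^sup>+y. ?G x y \<partial>\<mu> n) < \<infinity>" for x
      using g(3)[of n x] by (simp add: pot)
    show "integrated_semigroup (time_changed_resolvent P X (A n)) (S n)" by (rule assms(7))
    show "radon (\<mu> n)" by (rule radon)
  next
    show "real_potential ?G (\<mu> \<infinity>) (\<lambda>_. 1) = apply_bcontfun (g \<infinity>)"
      unfolding real_pot[symmetric, abs_def] using g(2,3) by simp
    show "uniform_limit UNIV (\<lambda>n. real_potential ?G (\<mu> (enat n)) (\<lambda>_. 1)) (real_potential ?G (\<mu> \<infinity>) (\<lambda>_. 1)) sequentially"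
      using assms(4) unfolding real_pot .
  qed (use assms(3) tdp.green_lsc tdp.locally_compact_space g(1) in auto)
  then interpret time_change_sequence \<Omega> M P X \<theta> A \<mu> ?G S "g \<infinity>" .
  show ?thesis using semigroup_limit[OF assms(8)] by blast
qed

end
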